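(* Let $r\ge1$ and let $\lambda^1,\dots,\lambda^r$ be partitions. Then the Macdonald cumulant satisfies \[\kappa^J(\lambda^1,\dots,\lambda^r)=O_1\left((q-1)^{r-1}\right).\] Here $O_1$ is understood as follows: every coefficient of $\kappa^J(\lambda^1,\dots,\lambda^r)/(q-1)^{r-1}$ in the monomial basis, viewed as a rational function of $q$ over $\mathbb{Q}(t)$, has no pole at $q=1$.
   Context: A partition is a weakly decreasing finite sequence of positive integers, extended by zeros. For partitions $\lambda,\mu$, $\lambda\oplus\mu:=(\lambda_1+\mu_1,\lambda_2+\mu_2,\dots)$. For $I\subseteq[r]=\{1,\dots,r\}$, set $\lambda^I:=\bigoplus_{i\in I}\lambda^i$. $J^{(q,t)}_\lambda$ denotes the integral form of the Macdonald symmetric function (Macdonald, Symmetric Functions and Hall Polynomials, Ch. VI, (8.3)). For a finite set $S$, $\mathcal{P}(S)$ is the lattice of set partitions of $S$ ordered by refinement, with Möbius function $\mu$; for $\pi\in\mathcal{P}([r])$ with $\#\pi$ blocks one has $\mu(\pi,\{[r]\})=(-1)^{\#\pi-1}(\#\pi-1)!$. The cumulant is \[\kappa^J(\lambda^1,\dots,\lambda^r):=\sum_{\pi\in\mathcal{P}([r])}\mu(\pi,\{[r]\})\prod_{B\in\pi}J^{(q,t)}_{\lambda^B}.\] For example, $\kappa^J(\lambda^1,\lambda^2)=J_{\lambda^1\oplus\lambda^2}-J_{\lambda^1}J_{\lambda^2}$. *)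

theory Defs
  imports
    "HOL-Library.Poly_Mapping"
    "HOL-Library.Disjoint_Sets"
    "HOL-Combinatorics.List_Permutation"
    "HOL-Computational_Algebra.Computational_Algebra"
begin

section \<open>Exponent vectors and partitions\<close>

text \<open>
  An element of type \<^typ>\<open>nat \<Rightarrow>\<^sub>0 nat\<close> is a finitely supported sequence of natural numbers, with
  positions counted from 0. Such a sequence is used both as an exponent vector
  (of the monomial \<open>x\<^sub>0^\<alpha>\<^sub>0 x\<^sub>1^\<alpha>\<^sub>1 \<dots>\<close>) and, when it is weakly decreasing, as a partition
  extended by zeros. The operation \<open>\<oplus>\<close> on partitions is then addition.
\<close>

definition is_partition :: "(nat \<Rightarrow>\<^sub>0 nat) \<Rightarrow> bool" where
  "is_partition l \<longleftrightarrow> antimono (Poly_Mapping.lookup l)"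

definition weight :: "(nat \<Rightarrow>\<^sub>0 nat) \<Rightarrow> nat" where
  "weight a = (\<Sum>i\<in>Poly_Mapping.keys a. Poly_Mapping.lookup a i)"

definition dominated :: "(nat \<Rightarrow>\<^sub>0 nat) \<Rightarrow> (nat \<Rightarrow>\<^sub>0 nat) \<Rightarrow> bool" where
  "dominated m l \<longleftrightarrow> weight m = weight l \<and>
     (\<forall>k. (\<Sum>i<k. Poly_Mapping.lookup m i) \<le> (\<Sum>i<k. Poly_Mapping.lookup l i))"

definition multiplicity_part :: "nat \<Rightarrow> (nat \<Rightarrow>\<^sub>0 nat) \<Rightarrow> nat" where
  "multiplicity_part n l = card {i. Poly_Mapping.lookup l i = n}"

definition z_part :: "(nat \<Rightarrow>\<^sub>0 nat) \<Rightarrow> nat" where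
  "z_part l = (\<Prod>n\<in>Poly_Mapping.range l. n ^ multiplicity_part n l * fact (multiplicity_part n l))"

text \<open>Cells of the Young diagram; rows and columns are counted from 0.\<close>

definition cells :: "(nat \<Rightarrow>\<^sub>0 nat) \<Rightarrow> (nat \<times> nat) set" where
  "cells l = {(i, j). j < Poly_Mapping.lookup l i}"

definition arm :: "(nat \<Rightarrow>\<^sub>0 nat) \<Rightarrow> nat \<times> nat \<Rightarrow> nat" where
  "arm l s = card {j. snd s < j \<and> (fst s, j) \<in> cells l}"

definition leg :: "(nat \<Rightarrow>\<^sub>0 nat) \<Rightarrow> nat \<times> nat \<Rightarrow> nat" where
  "leg l s = card {i. fst s < i \<and> (i, snd s) \<in> cells l}"

lemma weight_eq:
  assumes "finite A" "Poly_Mapping.keys a \<subseteq> A"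
  shows "weight a = (\<Sum>i\<in>A. Poly_Mapping.lookup a i)"
  unfolding weight_def
  by (rule sum.mono_neutral_left) (use assms in \<open>auto simp: in_keys_iff\<close>)

lemma weight_add: "weight (a + b) = weight a + weight b"
proof -
  let ?A = "Poly_Mapping.keys a \<union> Poly_Mapping.keys b"
  have "Poly_Mapping.keys (a + b) \<subseteq> ?A" by (rule Poly_Mapping.keys_add)
  then have "weight (a + b) = (\<Sum>i\<in>?A. Poly_Mapping.lookup (a + b) i)"
    by (intro weight_eq) auto
  also have "\<dots> = weight a + weight b"
    by (simp add: lookup_add sum.distrib weight_eq[of ?A])
  finally show ?thesis .
qed

lemma weight_zero [simp]: "weight 0 = 0"
  by (simp add: weight_def)

lemma lookup_map_key_bij:
  "bij f \<Longrightarrow> Poly_Mapping.lookup (Poly_Mapping.map_key f a) i = Poly_Mapping.lookup a (f i)"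
  by (simp add: map_key.rep_eq bij_is_inj)

lemma map_key_inv:
  assumes "bij f"
  shows "Poly_Mapping.map_key (inv f) (Poly_Mapping.map_key f a) = a"
    and "Poly_Mapping.map_key f (Poly_Mapping.map_key (inv f) a) = a"
  using assms
  by (auto intro!: poly_mapping_eqI
      simp: lookup_map_key_bij bij_imp_bij_inv bij_is_surj surj_f_inv_f bij_is_inj)

lemma weight_map_key:
  assumes "bij f"
  shows "weight (Poly_Mapping.map_key f a) = weight a"
proof -
  have K: "Poly_Mapping.keys (Poly_Mapping.map_key f a) = f -` Poly_Mapping.keys a"
    using assms by (simp add: keys_map_key bij_is_inj)
  have "bij_betw f (f -` Poly_Mapping.keys a) (Poly_Mapping.keys a)"
    using assms by (auto simp: bij_betw_def inj_on_def bij_def surj_image_vimage_eq)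
  then show ?thesis
    unfolding weight_def K using assms
    by (simp add: lookup_map_key_bij sum.reindex_bij_betw)
qed

lemma finite_bounded: "finite {b :: nat \<Rightarrow>\<^sub>0 nat. \<forall>i. Poly_Mapping.lookup b i \<le> Poly_Mapping.lookup a i}"
proof -
  let ?F = "{f. \<forall>i. (i \<in> Poly_Mapping.keys a \<longrightarrow> f i \<in> {..weight a}) \<and>
                    (i \<notin> Poly_Mapping.keys a \<longrightarrow> f i = (0::nat))}"
  have le: "Poly_Mapping.lookup a i \<le> weight a" for i
    by (cases "i \<in> Poly_Mapping.keys a") (auto simp: weight_def in_keys_iff intro: member_le_sum)
  have "finite ?F" by (rule finite_set_of_finite_funs) auto
  moreover have "Poly_Mapping.lookup ` {b. \<forall>i. Poly_Mapping.lookup b i \<le> Poly_Mapping.lookup a i} \<subseteq> ?F"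
  proof clarify
    fix b :: "nat \<Rightarrow>\<^sub>0 nat" and i
    assume b: "\<forall>i. Poly_Mapping.lookup b i \<le> Poly_Mapping.lookup a i"
    show "(i \<in> Poly_Mapping.keys a \<longrightarrow> Poly_Mapping.lookup b i \<in> {..weight a}) \<and>
          (i \<notin> Poly_Mapping.keys a \<longrightarrow> Poly_Mapping.lookup b i = 0)"
      using b[rule_format, of i] le[of i] by (auto simp: in_keys_iff)
  qed
  ultimately have "finite (Poly_Mapping.lookup ` {b. \<forall>i. Poly_Mapping.lookup b i \<le> Poly_Mapping.lookup a i})"
    by (rule rev_finite_subset)
  then show ?thesis
    by (rule finite_imageD) (auto intro: inj_onI poly_mapping_eqI)
qed

lemma finite_splittings: "finite {(b, c). b + c = (a :: nat \<Rightarrow>\<^sub>0 nat)}"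
proof -
  let ?B = "{b. \<forall>i. Poly_Mapping.lookup b i \<le> Poly_Mapping.lookup a i}"
  have "{(b, c). b + c = a} \<subseteq> ?B \<times> ?B"
    by (auto simp: lookup_add)
  then show ?thesis
    using finite_bounded finite_subset by blast
qed


section \<open>The ring of symmetric functions\<close>

text \<open>
  A symmetric function is a formal power series of bounded degree in the variables
  \<open>x\<^sub>0, x\<^sub>1, \<dots>\<close>, given by its coefficient function, that is invariant under permutations of
  the variables.
\<close>

typedef (overloaded) 'a symfun =
  "{f :: (nat \<Rightarrow>\<^sub>0 nat) \<Rightarrow> 'a::zero.
      (\<exists>d. \<forall>a. f a \<noteq> 0 \<longrightarrow> weight a \<le> d) \<and>
      (\<forall>\<sigma> a. bij \<sigma> \<longrightarrow> f (Poly_Mapping.map_key \<sigma> a) = f a)}"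
  morphisms sym_coeff Abs_symfun
  by (rule exI[of _ "\<lambda>_. 0"]) auto

setup_lifting type_definition_symfun

lemma symfun_eqI: "(\<And>a. sym_coeff f a = sym_coeff g a) \<Longrightarrow> f = g"
  by (simp add: sym_coeff_inject[symmetric] fun_eq_iff)

lemma sym_coeff_map_key: "bij \<sigma> \<Longrightarrow> sym_coeff f (Poly_Mapping.map_key \<sigma> a) = sym_coeff f a"
  using sym_coeff[of f] by auto

lemma sym_coeff_bounded: "\<exists>d. \<forall>a. sym_coeff f a \<noteq> 0 \<longrightarrow> weight a \<le> d"
  using sym_coeff[of f] by auto

lemma symfun_bounded2:
  assumes "\<exists>d. \<forall>a::nat \<Rightarrow>\<^sub>0 nat. f a \<noteq> 0 \<longrightarrow> weight a \<le> d"
    and "\<exists>d. \<forall>a::nat \<Rightarrow>\<^sub>0 nat. g a \<noteq> 0 \<longrightarrow> weight a \<le> d"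
  obtains d where "\<And>a. f a \<noteq> 0 \<Longrightarrow> weight a \<le> d" "\<And>a. g a \<noteq> 0 \<Longrightarrow> weight a \<le> d"
proof -
  from assms obtain d e where "\<forall>a. f a \<noteq> 0 \<longrightarrow> weight a \<le> d" "\<forall>a. g a \<noteq> 0 \<longrightarrow> weight a \<le> e"
    by blast
  then show ?thesis
    by (intro that[of "max d e"]) (auto intro: le_max_iff_disj[THEN iffD2])
qed

definition conv :: "((nat \<Rightarrow>\<^sub>0 nat) \<Rightarrow> 'a) \<Rightarrow> ((nat \<Rightarrow>\<^sub>0 nat) \<Rightarrow> 'a) \<Rightarrow> (nat \<Rightarrow>\<^sub>0 nat) \<Rightarrow> 'a::comm_ring_1"
  where "conv f g a = (\<Sum>(b, c) | b + c = a. f b * g c)"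

lemma conv_commute: "conv f g a = conv g f a"
  unfolding conv_def
  by (rule sum.reindex_bij_witness[of _ prod.swap prod.swap]) (auto simp: add.commute mult.commute)

lemma conv_distrib: "conv (\<lambda>a. f a + g a) h a = conv f h a + conv g h a"
  unfolding conv_def by (simp add: sum.distrib distrib_right case_prod_unfold)

lemma conv_assoc: "conv (conv f g) h a = conv f (conv g h) a"
proof -
  have "conv (conv f g) h a =
    (\<Sum>p | fst p + snd p = a. \<Sum>q | fst q + snd q = fst p. f (fst q) * g (snd q) * h (snd p))"
    unfolding conv_def by (simp add: case_prod_unfold sum_distrib_right)
  also have "\<dots> = (\<Sum>(p, q)\<in>(SIGMA p:{p. fst p + snd p = a}. {q. fst q + snd q = fst p}).
      f (fst q) * g (snd q) * h (snd p))"
    using finite_splittings by (intro sum.Sigma) (auto simp: case_prod_unfold)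
  also have "\<dots> = (\<Sum>(p, q)\<in>(SIGMA p:{p. fst p + snd p = a}. {q. fst q + snd q = snd p}).
      f (fst p) * (g (fst q) * h (snd q)))"
    by (rule sum.reindex_bij_witness[of _
          "\<lambda>(p, q). ((fst p + fst q, snd q), (fst p, fst q))"
          "\<lambda>(p, q). ((fst q, snd q + snd p), (snd q, snd p))"])
       (auto simp: add.assoc mult.assoc)
  also have "\<dots> = (\<Sum>p | fst p + snd p = a. \<Sum>q | fst q + snd q = snd p.
      f (fst p) * (g (fst q) * h (snd q)))"
    using finite_splittings by (intro sum.Sigma[symmetric]) (auto simp: case_prod_unfold)
  also have "\<dots> = conv f (conv g h) a"
    unfolding conv_def by (simp add: case_prod_unfold sum_distrib_left)
  finally show ?thesis .
qed

lemma conv_one: "conv (\<lambda>a. if a = 0 then 1 else 0) g a = g a"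
proof -
  have "conv (\<lambda>a. if a = 0 then 1 else 0) g a =
        (\<Sum>p\<in>{(0 :: nat \<Rightarrow>\<^sub>0 nat, a)}. case p of (b, c) \<Rightarrow> (if b = 0 then 1 else 0) * g c)"
    unfolding conv_def
    by (rule sum.mono_neutral_right) (use finite_splittings[of a] in \<open>auto split: if_splits\<close>)
  then show ?thesis by simp
qed

lemma conv_map_key:
  assumes \<sigma>: "bij \<sigma>"
    and f: "\<And>a. f (Poly_Mapping.map_key \<sigma> a) = f a"
    and g: "\<And>a. g (Poly_Mapping.map_key \<sigma> a) = g a"
  shows "conv f g (Poly_Mapping.map_key \<sigma> a) = conv f g a"
  unfolding conv_def
proof (rule sum.reindex_bij_witness[of _
        "\<lambda>(b, c). (Poly_Mapping.map_key \<sigma> b, Poly_Mapping.map_key \<sigma> c)"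
        "\<lambda>(b, c). (Poly_Mapping.map_key (inv \<sigma>) b, Poly_Mapping.map_key (inv \<sigma>) c)"], goal_cases)
  case (2 p)
  then show ?case using \<sigma>
    by (auto simp: map_key_plus[symmetric] bij_imp_bij_inv bij_is_inj map_key_inv)
next
  case (5 p)
  have "f (Poly_Mapping.map_key (inv \<sigma>) b) = f b" "g (Poly_Mapping.map_key (inv \<sigma>) b) = g b" for b
    using f[of "Poly_Mapping.map_key (inv \<sigma>) b"] g[of "Poly_Mapping.map_key (inv \<sigma>) b"] \<sigma>
    by (simp_all add: map_key_inv)
  then show ?case by (cases p) simp
qed (use \<sigma> in \<open>auto simp: map_key_inv map_key_plus bij_is_inj\<close>)

instantiation symfun :: (comm_ring_1) comm_ring_1
begin

lift_definition zero_symfun :: "'a symfun" is "\<lambda>_. 0"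
  by simp

lift_definition one_symfun :: "'a symfun" is "\<lambda>a. if a = 0 then 1 else 0"
proof (intro conjI allI impI exI[of _ 0])
  fix \<sigma> and a :: "nat \<Rightarrow>\<^sub>0 nat"
  assume "bij (\<sigma> :: nat \<Rightarrow> nat)"
  then have "Poly_Mapping.map_key \<sigma> a = 0 \<longleftrightarrow> a = 0"
    using map_key_inv(1)[of \<sigma> a]
    by (auto simp: bij_is_inj bij_imp_bij_inv)
  then show "(if Poly_Mapping.map_key \<sigma> a = 0 then 1 else 0) = (if a = 0 then 1 else (0 :: 'a))"
    by simp
qed (auto split: if_splits)

lift_definition plus_symfun :: "'a symfun \<Rightarrow> 'a symfun \<Rightarrow> 'a symfun" is "\<lambda>f g a. f a + g a"
proof (intro conjI, goal_cases)
  case (1 f g)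
  then obtain d where "\<And>a. f a \<noteq> 0 \<Longrightarrow> weight a \<le> d" "\<And>a. g a \<noteq> 0 \<Longrightarrow> weight a \<le> d"
    using symfun_bounded2[of f g] by blast
  then show ?case by (intro exI[of _ d]) force
qed auto

lift_definition uminus_symfun :: "'a symfun \<Rightarrow> 'a symfun" is "\<lambda>f a. - f a"
  by auto

lift_definition minus_symfun :: "'a symfun \<Rightarrow> 'a symfun \<Rightarrow> 'a symfun" is "\<lambda>f g a. f a - g a"
proof (intro conjI, goal_cases)
  case (1 f g)
  then obtain d where "\<And>a. f a \<noteq> 0 \<Longrightarrow> weight a \<le> d" "\<And>a. g a \<noteq> 0 \<Longrightarrow> weight a \<le> d"
    using symfun_bounded2[of f g] by blast
  then show ?case by (intro exI[of _ d]) force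
qed auto

lift_definition times_symfun :: "'a symfun \<Rightarrow> 'a symfun \<Rightarrow> 'a symfun" is "conv"
proof (intro conjI, goal_cases)
  case (1 f g)
  then obtain d where d: "\<And>a. f a \<noteq> 0 \<Longrightarrow> weight a \<le> d" "\<And>a. g a \<noteq> 0 \<Longrightarrow> weight a \<le> d"
    using symfun_bounded2[of f g] by blast
  show ?case
  proof (intro exI[of _ "d + d"] allI impI)
    fix a assume "conv f g a \<noteq> 0"
    then obtain b c where "b + c = a" "f b * g c \<noteq> 0"
      unfolding conv_def by (force elim: sum.not_neutral_contains_not_neutral)
    moreover from this have "f b \<noteq> 0" "g c \<noteq> 0" by auto
    ultimately show "weight a \<le> d + d"
      using d(1)[of b] d(2)[of c] weight_add[of b c] by simp
  qed
next
  case (2 f g)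
  then show ?case by (auto intro: conv_map_key)
qed

instance
proof
  fix f g h :: "'a symfun"
  show "f * g * h = f * (g * h)"
    by transfer (simp add: fun_eq_iff conv_assoc)
  show "f * g = g * f"
    by transfer (simp add: fun_eq_iff conv_commute)
  show "1 * f = f"
    by transfer (simp add: fun_eq_iff conv_one)
  show "(f + g) * h = f * h + g * h"
    by transfer (simp add: fun_eq_iff conv_distrib)
  show "(0 :: 'a symfun) \<noteq> 1"
    by transfer (auto simp: fun_eq_iff intro!: exI[of _ 0])
qed (transfer; simp add: fun_eq_iff algebra_simps)+

end

lift_definition sym_scale :: "'a::comm_ring_1 \<Rightarrow> 'a symfun \<Rightarrow> 'a symfun" is "\<lambda>c f a. c * f a"
  by (metis mult_zero_right)

lemma vector_space_sym_scale: "vector_space (sym_scale :: 'a::field \<Rightarrow> _)"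
  by unfold_locales (transfer; simp add: fun_eq_iff algebra_simps)+

definition rearrangement :: "(nat \<Rightarrow>\<^sub>0 nat) \<Rightarrow> (nat \<Rightarrow>\<^sub>0 nat) \<Rightarrow> bool" where
  "rearrangement l a \<longleftrightarrow> (\<exists>\<sigma>. bij \<sigma> \<and> a = Poly_Mapping.map_key \<sigma> l)"

lemma rearrangement_map_key:
  assumes "bij \<sigma>"
  shows "rearrangement l (Poly_Mapping.map_key \<sigma> a) \<longleftrightarrow> rearrangement l a"
proof -
  have *: "rearrangement l (Poly_Mapping.map_key \<tau> b)" if "bij \<tau>" "rearrangement l b" for \<tau> b
  proof -
    from that obtain \<rho> where "bij \<rho>" "b = Poly_Mapping.map_key \<rho> l"
      by (auto simp: rearrangement_def)
    with that show ?thesis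
      unfolding rearrangement_def
      by (intro exI[of _ "\<rho> \<circ> \<tau>"]) (simp add: bij_comp map_key_compose bij_is_inj)
  qed
  show ?thesis
    using *[of \<sigma> a] *[of "inv \<sigma>" "Poly_Mapping.map_key \<sigma> a"] assms
    by (auto simp: map_key_inv bij_imp_bij_inv)
qed

lift_definition monomial_sym :: "(nat \<Rightarrow>\<^sub>0 nat) \<Rightarrow> 'a::comm_ring_1 symfun" is
  "\<lambda>l a. if rearrangement l a then 1 else 0"
proof (intro conjI, goal_cases)
  case (1 l)
  then show ?case
    by (intro exI[of _ "weight l"]) (auto simp: rearrangement_def weight_map_key)
next
  case (2 l)
  then show ?case by (simp add: rearrangement_map_key)
qed

text \<open>The power sum \<open>p\<^sub>n\<close> is meant for \<open>n \<ge> 1\<close>, where it equals \<open>m\<^bsub>(n)\<^esub>\<close>.\<close>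

definition power_sum :: "nat \<Rightarrow> 'a::comm_ring_1 symfun" where
  "power_sum n = monomial_sym (Poly_Mapping.single 0 n)"

lemma sym_coeff_power_sum:
  "sym_coeff (power_sum n :: 'a::comm_ring_1 symfun) a =
     (if \<exists>i. a = Poly_Mapping.single i n then 1 else 0)"
proof -
  have "rearrangement (Poly_Mapping.single 0 n) a \<longleftrightarrow> (\<exists>i. a = Poly_Mapping.single i n)"
  proof
    assume "rearrangement (Poly_Mapping.single 0 n) a"
    then obtain \<sigma> where \<sigma>: "bij \<sigma>" "a = Poly_Mapping.map_key \<sigma> (Poly_Mapping.single (0::nat) n)"
      by (auto simp: rearrangement_def)
    then have "a = Poly_Mapping.map_key \<sigma> (Poly_Mapping.single (\<sigma> (inv \<sigma> 0)) n)"
      by (simp add: bij_is_surj surj_f_inv_f)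
    then show "\<exists>i. a = Poly_Mapping.single i n"
      using \<sigma>(1) by (auto simp: bij_is_inj)
  next
    assume "\<exists>i. a = Poly_Mapping.single i n"
    then obtain i where i: "a = Poly_Mapping.single i n" ..
    let ?s = "Transposition.transpose 0 i"
    have "bij ?s" by simp
    moreover have "a = Poly_Mapping.map_key ?s (Poly_Mapping.single 0 n)"
      using map_key_single[of ?s i n] i by (simp add: bij_is_inj)
    ultimately show "rearrangement (Poly_Mapping.single 0 n) a"
      unfolding rearrangement_def by blast
  qed
  then show ?thesis
    by (simp add: power_sum_def monomial_sym.rep_eq)
qed

definition power_sum_part :: "(nat \<Rightarrow>\<^sub>0 nat) \<Rightarrow> 'a::comm_ring_1 symfun" where
  "power_sum_part l = (\<Prod>i\<in>Poly_Mapping.keys l. power_sum (Poly_Mapping.lookup l i))"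


subsection \<open>The monomial basis\<close>

text \<open>
  For a partition \<open>\<mu>\<close>, the coefficient of \<open>m\<^sub>\<mu>\<close> in the monomial expansion of \<open>f\<close> is the
  coefficient of \<open>x^\<mu>\<close> in \<open>f\<close>, i.e. \<^term>\<open>sym_coeff f \<mu>\<close>.
\<close>

lemma rearrangement_partition_unique:
  assumes l: "is_partition l" and m: "is_partition m" and "rearrangement l m"
  shows "l = m"
proof -
  obtain \<sigma> where \<sigma>: "bij \<sigma>" "m = Poly_Mapping.map_key \<sigma> l"
    using assms by (auto simp: rearrangement_def)
  have fin: "finite {i. j < Poly_Mapping.lookup p i}" for j and p :: "nat \<Rightarrow>\<^sub>0 nat"
    by (rule finite_subset[of _ "Poly_Mapping.keys p"]) (auto simp: in_keys_iff)
  have init: "{i. j < Poly_Mapping.lookup p i} = {..<card {i. j < Poly_Mapping.lookup p i}}"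
    if p: "is_partition p" for j p
  proof -
    let ?S = "{i. j < Poly_Mapping.lookup p i}"
    have down: "i \<in> ?S" if "i' \<in> ?S" "i \<le> i'" for i i'
    proof -
      have "Poly_Mapping.lookup p i' \<le> Poly_Mapping.lookup p i"
        using p that(2) unfolding is_partition_def by (rule antimonoD)
      then show ?thesis using that(1) by simp
    qed
    define N where "N = (LEAST n. n \<notin> ?S)"
    have ex: "\<exists>n. n \<notin> ?S" by (rule ex_new_if_finite[OF infinite_UNIV_nat fin])
    have "N \<notin> ?S" unfolding N_def by (rule LeastI_ex[OF ex])
    moreover have "n \<in> ?S" if "n < N" for n
      using not_less_Least[of n "\<lambda>n. n \<notin> ?S"] that unfolding N_def by blast
    ultimately have "n \<in> ?S \<longleftrightarrow> n < N" for n
      using down[of n N] by (cases "n < N") auto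
    then have "?S = {..<N}" by (intro set_eqI) simp
    then show ?thesis by simp
  qed
  have "card {i. j < Poly_Mapping.lookup m i} = card {i. j < Poly_Mapping.lookup l i}" for j
  proof -
    have "{i. j < Poly_Mapping.lookup l i} = \<sigma> ` {i. j < Poly_Mapping.lookup m i}"
    proof (intro set_eqI iffI)
      fix i assume "i \<in> {i. j < Poly_Mapping.lookup l i}"
      then show "i \<in> \<sigma> ` {i. j < Poly_Mapping.lookup m i}"
        using \<sigma> by (intro image_eqI[of _ _ "inv \<sigma> i"])
          (simp_all add: lookup_map_key_bij bij_is_surj surj_f_inv_f)
    qed (use \<sigma> in \<open>auto simp: lookup_map_key_bij\<close>)
    then show ?thesis
      using card_image[OF inj_on_subset[OF bij_is_inj[OF \<sigma>(1)] subset_UNIV]] by simp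
  qed
  then have "{i. j < Poly_Mapping.lookup m i} = {i. j < Poly_Mapping.lookup l i}" for j
    using init[OF l] init[OF m] by metis
  then have "j < Poly_Mapping.lookup m i \<longleftrightarrow> j < Poly_Mapping.lookup l i" for i j
    by blast
  then show ?thesis
    by (intro poly_mapping_eqI antisym) (meson leI less_irrefl)+
qed

lemma ex_partition_rearrangement:
  obtains l where "is_partition l" "rearrangement l a"
proof -
  define n where "n = Suc (Max (insert 0 (Poly_Mapping.keys a)))"
  have keys: "i < n" if "i \<in> Poly_Mapping.keys a" for i
    using that by (auto simp: n_def less_Suc_eq_le)
  define xs where "xs = map (Poly_Mapping.lookup a) [0..<n]"
  define ys where "ys = rev (sort xs)"
  have len: "length ys = n" by (simp add: ys_def xs_def)
  have "mset xs = mset ys" by (simp add: ys_def)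
  then obtain \<sigma> where \<sigma>: "\<sigma> permutes {..<length ys}" "permute_list \<sigma> ys = xs"
    by (rule mset_eq_permutation)
  define l where "l = Poly_Mapping.map_key (inv \<sigma>) a"
  have b: "bij \<sigma>" using \<sigma>(1) by (rule permutes_bij)
  have al: "a = Poly_Mapping.map_key \<sigma> l" by (simp add: l_def map_key_inv b)
  have ls: "Poly_Mapping.lookup l (\<sigma> i) = Poly_Mapping.lookup a i" for i
    using b by (simp add: l_def lookup_map_key_bij bij_imp_bij_inv bij_is_inj)
  have big: "Poly_Mapping.lookup l i = 0" if "i \<ge> n" for i
  proof -
    have "\<sigma> i = i" using \<sigma>(1) that len by (simp add: permutes_not_in)
    then show ?thesis using ls[of i] keys[of i] that by (auto simp: in_keys_iff)
  qed
  have small: "Poly_Mapping.lookup l i = ys ! i" if "i < n" for i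
  proof -
    have "i \<in> \<sigma> ` {..<n}"
      using permutes_image[OF \<sigma>(1)] that len by simp
    then obtain k where k: "k < n" "\<sigma> k = i" by auto
    have "permute_list \<sigma> ys ! k = ys ! \<sigma> k"
      by (rule permute_list_nth[OF \<sigma>(1)]) (simp add: len k)
    then have "xs ! k = ys ! i" using \<sigma>(2) k by simp
    then show ?thesis using ls[of k] k by (simp add: xs_def)
  qed
  have "is_partition l"
    unfolding is_partition_def
  proof (rule antimonoI)
    fix i k :: nat assume ik: "i \<le> k"
    show "Poly_Mapping.lookup l k \<le> Poly_Mapping.lookup l i"
    proof (cases "k < n")
      case True
      have "sorted (rev ys)" by (simp add: ys_def)
      then show ?thesis using True ik small len by (simp add: sorted_rev_nth_mono)
    qed (simp add: big)
  qed
  moreover have "rearrangement l a" using al b by (auto simp: rearrangement_def)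
  ultimately show ?thesis by (rule that)
qed

lemma sym_coeff_sum: "sym_coeff (\<Sum>i\<in>A. f i) a = (\<Sum>i\<in>A. sym_coeff (f i) a)"
  by (induction A rule: infinite_finite_induct)
     (simp_all add: zero_symfun.rep_eq plus_symfun.rep_eq)

lemma finite_partitions_weight_le: "finite {l. is_partition l \<and> weight l \<le> d}"
proof (rule finite_subset[OF _ finite_bounded])
  define a :: "nat \<Rightarrow>\<^sub>0 nat" where "a = (\<Sum>i<d. Poly_Mapping.single i d)"
  have a: "Poly_Mapping.lookup a i = (if i < d then d else 0)" for i
    by (simp add: a_def lookup_sum lookup_single when_def)
  show "{l. is_partition l \<and> weight l \<le> d} \<subseteq>
        {b. \<forall>i. Poly_Mapping.lookup b i \<le> Poly_Mapping.lookup a i}"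
  proof clarify
    fix l i assume l: "is_partition l" "weight l \<le> d"
    have le: "Poly_Mapping.lookup l i * Suc i \<le> weight l"
    proof (cases "Poly_Mapping.lookup l i = 0")
      case False
      have ge: "Poly_Mapping.lookup l i \<le> Poly_Mapping.lookup l k" if "k \<le> i" for k
        using l(1) that unfolding is_partition_def by (rule antimonoD)
      have "Poly_Mapping.lookup l i * Suc i = (\<Sum>k\<le>i. Poly_Mapping.lookup l i)" by simp
      also have "\<dots> \<le> (\<Sum>k\<le>i. Poly_Mapping.lookup l k)"
        by (rule sum_mono) (simp add: ge)
      also have "\<dots> \<le> weight l"
        unfolding weight_def using ge False
        by (intro sum_mono2) (force simp: in_keys_iff)+
      finally show ?thesis .
    qed simp
    show "Poly_Mapping.lookup l i \<le> Poly_Mapping.lookup a i"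
    proof (cases "Poly_Mapping.lookup l i = 0")
      case False
      then have "Suc i \<le> Poly_Mapping.lookup l i * Suc i"
        by (cases "Poly_Mapping.lookup l i") auto
      moreover have "Poly_Mapping.lookup l i \<le> Poly_Mapping.lookup l i * Suc i" by simp
      ultimately show ?thesis
        using le l(2) unfolding a by auto
    qed simp
  qed
qed

lemma sym_coeff_scale_monomial:
  "sym_coeff (sym_scale c (monomial_sym l)) a = (if rearrangement l a then c else 0)"
  by (simp add: sym_scale.rep_eq monomial_sym.rep_eq)

lemma monomial_expansion:
  fixes f :: "'a::comm_ring_1 symfun"
  shows "finite {l. is_partition l \<and> sym_coeff f l \<noteq> 0}"
    and "f = (\<Sum>l | is_partition l \<and> sym_coeff f l \<noteq> 0. sym_scale (sym_coeff f l) (monomial_sym l))"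
proof -
  let ?S = "{l. is_partition l \<and> sym_coeff f l \<noteq> 0}"
  obtain d where "\<And>a. sym_coeff f a \<noteq> 0 \<Longrightarrow> weight a \<le> d"
    using sym_coeff_bounded[of f] by blast
  then show fin: "finite ?S"
    by (intro finite_subset[OF _ finite_partitions_weight_le[of d]]) auto
  show "f = (\<Sum>l\<in>?S. sym_scale (sym_coeff f l) (monomial_sym l))"
  proof (rule symfun_eqI)
    fix a
    obtain m where m: "is_partition m" "rearrangement m a"
      by (rule ex_partition_rearrangement)
    obtain \<sigma> where \<sigma>: "bij \<sigma>" "a = Poly_Mapping.map_key \<sigma> m"
      using m by (auto simp: rearrangement_def)
    have uniq: "l = m" if "is_partition l" "rearrangement l a" for l
    proof -
      have "rearrangement l m"
        using that(2) unfolding \<sigma>(2) rearrangement_map_key[OF \<sigma>(1)] .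
      then show ?thesis by (rule rearrangement_partition_unique[OF that(1) m(1)])
    qed
    have "sym_coeff (\<Sum>l\<in>?S. sym_scale (sym_coeff f l) (monomial_sym l)) a =
          (\<Sum>l\<in>?S. if l = m then sym_coeff f m else 0)"
      unfolding sym_coeff_sum sym_coeff_scale_monomial
      by (rule sum.cong[OF refl]) (auto dest: uniq simp: m(2))
    also have "\<dots> = sym_coeff f m"
      using fin m by (auto simp: sum.delta)
    also have "\<dots> = sym_coeff f a"
      using \<sigma> by (simp add: sym_coeff_map_key)
    finally show "sym_coeff f a = sym_coeff (\<Sum>l\<in>?S. sym_scale (sym_coeff f l) (monomial_sym l)) a"
      by simp
  qed
qed


section \<open>Macdonald symmetric functions\<close>

text \<open>The field \<open>\<rat>(q,t)\<close>, realised as \<open>\<rat>(t)(q)\<close>: the outer polynomial variable is \<open>q\<close>.\<close>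

type_synonym qt_field = "rat poly fract poly fract"

definition qvar :: qt_field where
  "qvar = Fract [:0, 1:] 1"

definition tvar :: qt_field where
  "tvar = Fract [:Fract [:0, 1:] 1:] 1"

text \<open>
  The \<open>(q,t)\<close>-deformed Hall scalar product: the bilinear form with
  \<open>\<langle>p\<^sub>\<lambda>, p\<^sub>\<mu>\<rangle> = \<delta>\<^bsub>\<lambda>\<mu>\<^esub> z\<^sub>\<lambda> \<Prod>\<^sub>i (1 - q^\<lambda>\<^sub>i) / (1 - t^\<lambda>\<^sub>i)\<close>. It is determined by these values because
  the \<open>p\<^sub>\<lambda>\<close> form a basis.
\<close>

definition z_qt :: "(nat \<Rightarrow>\<^sub>0 nat) \<Rightarrow> qt_field" where
  "z_qt l = of_nat (z_part l) *
     (\<Prod>i\<in>Poly_Mapping.keys l. (1 - qvar ^ Poly_Mapping.lookup l i) / (1 - tvar ^ Poly_Mapping.lookup l i))"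

definition is_qt_scalar_product :: "(qt_field symfun \<Rightarrow> qt_field symfun \<Rightarrow> qt_field) \<Rightarrow> bool" where
  "is_qt_scalar_product B \<longleftrightarrow>
     (\<forall>f. Vector_Spaces.linear sym_scale (*) (\<lambda>g. B f g)) \<and>
     (\<forall>g. Vector_Spaces.linear sym_scale (*) (\<lambda>f. B f g)) \<and>
     (\<forall>l m. is_partition l \<longrightarrow> is_partition m \<longrightarrow>
        B (power_sum_part l) (power_sum_part m) = (if l = m then z_qt l else 0))"

definition qt_scalar_product :: "qt_field symfun \<Rightarrow> qt_field symfun \<Rightarrow> qt_field" where
  "qt_scalar_product = (THE B. is_qt_scalar_product B)"

text \<open>
  The Macdonald symmetric functions \<open>P\<^sub>\<lambda>\<close> are the unique family, indexed by partitions, that is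
  unitriangular in the monomial basis for the dominance order and pairwise orthogonal.
  Values of \<open>P\<close> at arguments that are not partitions are irrelevant, so the definite description
  is applied to the value \<open>P\<^sub>\<lambda>\<close> and not to the function \<open>P\<close>.
\<close>

definition is_macdonald_family :: "((nat \<Rightarrow>\<^sub>0 nat) \<Rightarrow> qt_field symfun) \<Rightarrow> bool" where
  "is_macdonald_family P \<longleftrightarrow>
     (\<forall>l. is_partition l \<longrightarrow>
        (\<exists>u. P l = monomial_sym l +
           (\<Sum>m | is_partition m \<and> dominated m l \<and> m \<noteq> l. sym_scale (u m) (monomial_sym m)))) \<and>
     (\<forall>l m. is_partition l \<longrightarrow> is_partition m \<longrightarrow> l \<noteq> m \<longrightarrow> qt_scalar_product (P l) (P m) = 0)"

definition macdonald_P :: "(nat \<Rightarrow>\<^sub>0 nat) \<Rightarrow> qt_field symfun" where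
  "macdonald_P l = (THE f. \<exists>P. is_macdonald_family P \<and> P l = f)"

definition macdonald_c :: "(nat \<Rightarrow>\<^sub>0 nat) \<Rightarrow> qt_field" where
  "macdonald_c l = (\<Prod>s\<in>cells l. 1 - qvar ^ arm l s * tvar ^ (leg l s + 1))"

definition macdonald_J :: "(nat \<Rightarrow>\<^sub>0 nat) \<Rightarrow> qt_field symfun" where
  "macdonald_J l = sym_scale (macdonald_c l) (macdonald_P l)"

lemma finite_dominated: "finite {m. is_partition m \<and> dominated m l \<and> m \<noteq> l}"
  by (rule finite_subset[OF _ finite_partitions_weight_le[of "weight l"]]) (auto simp: dominated_def)

lemma finite_cells: "finite (cells l)"
proof -
  have "cells l = (SIGMA i:Poly_Mapping.keys l. {..<Poly_Mapping.lookup l i})"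
    by (auto simp: cells_def in_keys_iff)
  then show ?thesis by simp
qed


section \<open>Cumulants\<close>

text \<open>
  The Moebius function of the lattice of set partitions of \<open>A\<close>, ordered by refinement:
  \<open>\<mu>(\<pi>,\<pi>) = 1\<close> and \<open>\<mu>(\<pi>,\<sigma>) = - \<Sum>\<^bsub>\<pi> \<le> \<tau> < \<sigma>\<^esub> \<mu>(\<pi>,\<tau>)\<close> for \<open>\<pi> < \<sigma>\<close>.
\<close>

function partition_moebius :: "'a set \<Rightarrow> 'a set set \<Rightarrow> 'a set set \<Rightarrow> int" where
  "partition_moebius A \<pi> \<sigma> =
     (if \<not> (finite A \<and> refines A \<pi> \<sigma>) then 0
      else if \<pi> = \<sigma> then 1
      else - (\<Sum>\<tau>\<in>{\<tau>. refines A \<pi> \<tau> \<and> refines A \<tau> \<sigma> \<and> \<tau> \<noteq> \<sigma>}. partition_moebius A \<pi> \<tau>))"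
  by auto
termination
proof (relation "measure (\<lambda>(A, \<pi>, \<sigma>). card {\<tau>. refines A \<pi> \<tau> \<and> refines A \<tau> \<sigma>})", goal_cases)
  case (2 A \<pi> \<sigma> \<tau>)
  then have fin: "finite A" and \<tau>: "refines A \<pi> \<tau>" "refines A \<tau> \<sigma>" "\<tau> \<noteq> \<sigma>"
    and \<pi>\<sigma>: "refines A \<pi> \<sigma>" by auto
  have "{\<rho>. refines A \<pi> \<rho> \<and> refines A \<rho> \<tau>} \<subset> {\<rho>. refines A \<pi> \<rho> \<and> refines A \<rho> \<sigma>}"
  proof
    show "{\<rho>. refines A \<pi> \<rho> \<and> refines A \<rho> \<tau>} \<subseteq> {\<rho>. refines A \<pi> \<rho> \<and> refines A \<rho> \<sigma>}"
      using \<tau> by (auto intro: refines_trans)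
    have "refines A \<sigma> \<sigma>" using \<pi>\<sigma> by (simp add: refines_def) blast
    moreover have "\<not> refines A \<sigma> \<tau>" using \<tau> refines_asym by blast
    ultimately show "{\<rho>. refines A \<pi> \<rho> \<and> refines A \<rho> \<tau>} \<noteq> {\<rho>. refines A \<pi> \<rho> \<and> refines A \<rho> \<sigma>}"
      using \<pi>\<sigma> by blast
  qed
  moreover have "finite {\<rho>. refines A \<pi> \<rho> \<and> refines A \<rho> \<sigma>}"
    by (rule finite_subset[OF _ finitely_many_partition_on[OF fin]]) (auto simp: refines_def)
  ultimately show ?case by (simp add: psubset_card_mono)
qed simp

declare partition_moebius.simps [simp del]

definition macdonald_cumulant :: "nat \<Rightarrow> (nat \<Rightarrow> (nat \<Rightarrow>\<^sub>0 nat)) \<Rightarrow> qt_field symfun" where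
  "macdonald_cumulant r lam =
     (\<Sum>\<pi> | partition_on {1..r} \<pi>.
        of_int (partition_moebius {1..r} \<pi> {{1..r}}) * (\<Prod>B\<in>\<pi>. macdonald_J (\<Sum>i\<in>B. lam i)))"

text \<open>A rational function over a field has no pole at \<open>c\<close>.\<close>

definition no_pole_at :: "'a::field \<Rightarrow> 'a poly fract \<Rightarrow> bool" where
  "no_pole_at c x \<longleftrightarrow> (\<exists>a b. x = Fract a b \<and> poly b c \<noteq> 0)"

text \<open>\<open>f = O\<^sub>1(g)\<close>: all coefficients of \<open>f / g\<close> in the monomial basis are regular at \<open>q = 1\<close>.\<close>

definition big_O1 :: "qt_field symfun \<Rightarrow> qt_field \<Rightarrow> bool" where
  "big_O1 f g \<longleftrightarrow> (\<forall>m. is_partition m \<longrightarrow> no_pole_at 1 (sym_coeff f m / g))"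

end

theory Submission
  imports Defs
begin

text \<open>
  Macdonald's operator in infinitely many variables sends \<open>f\<close> to the constant term in \<open>z\<close> of
  \<open>\<Prod>\<^sub>i (1 - x\<^sub>i / (t z)) / (1 - x\<^sub>i / z) \<cdot> f[X + (q - 1) z]\<close>. It is self-adjoint, and triangular in
  the monomial basis with distinct eigenvalues \<open>ev l = 1 + (1 - 1/t) \<Sum>\<^sub>i t\<^sup>-\<^sup>i (q^l\<^sub>i - 1)\<close>, where
  \<open>i \<ge> 0\<close>. Hence the \<open>P\<^sub>l\<close> exist and are its eigenfunctions.

  Cumulants are the logarithm of the set function \<open>F I = J(\<lambda>\<^sup>I)\<close> with respect to convolution. The
  shift \<open>X \<mapsto> X + (q - 1) z\<close> is a ring homomorphism, and \<open>q^l\<^sub>i\<close> is multiplicative in \<open>l\<close>. Dividing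
  the eigenvalue equation by \<open>F\<close> therefore turns it into \<open>(H - ev) \<kappa>(I) = \<close> a sum of products
  of at least two cumulants of smaller sets, in which every factor gains a power of \<open>q - 1\<close>.
  At \<open>q = 1\<close>, the operator \<open>(H - ev) / (q - 1)\<close> is invertible strictly below \<open>\<lambda>\<^sup>I\<close> in the dominance
  order. By induction on \<open>I\<close> it remains to bound the coefficient of \<open>\<kappa>(I)\<close> at \<open>\<lambda>\<^sup>I\<close>. This is
  the cumulant of the normalising factors, which are products of terms \<open>1 - u q^(y I)\<close> with \<open>y\<close>
  additive; multiplying by such a term preserves the order of vanishing, again because \<open>q^(y I)\<close> is
  multiplicative.
\<close>

section \<open>Prepending an entry to an exponent vector\<close>

text \<open>Power counting drives the induction. If the cumulant of a block B has order |B| - 1 and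
  gains one power, a product over the blocks of a set partition of I has order |I|; dividing H - ev
  by q - 1 leaves |I| - 1. The terms linear in the cumulant of I itself add up to (H - ev) of it, so
  the estimate of the other terms is not circular. The eigenvalue is not multiplicative in the
  partition, but it is affine in the powers q^l_i, and each of these is; so F is divided out for
  every row separately. The obstacle is that H is the identity at q = 1, where all eigenvalues
  coincide. Their differences vanish there to order exactly one, because the derivative is a nonzero
  polynomial in 1/t, and this is what makes the count come out. At the top partition the difference
  is 0, so the leading coefficient cannot be reached through H.\<close>

lift_definition pcons :: "nat \<Rightarrow> (nat \<Rightarrow>\<^sub>0 nat) \<Rightarrow> (nat \<Rightarrow>\<^sub>0 nat)" is
  "\<lambda>k f i. case i of 0 \<Rightarrow> k | Suc j \<Rightarrow> f j"
proof -
  fix k and f :: "nat \<Rightarrow> nat"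
  assume "finite {x. f x \<noteq> 0}"
  then have "finite (insert 0 (Suc ` {x. f x \<noteq> 0}))" by simp
  moreover have "{x. (case x of 0 \<Rightarrow> k | Suc j \<Rightarrow> f j) \<noteq> 0} \<subseteq> insert 0 (Suc ` {x. f x \<noteq> 0})"
  proof
    fix x assume "x \<in> {x. (case x of 0 \<Rightarrow> k | Suc j \<Rightarrow> f j) \<noteq> 0}"
    then show "x \<in> insert 0 (Suc ` {x. f x \<noteq> 0})" by (cases x) auto
  qed
  ultimately show "finite {x. (case x of 0 \<Rightarrow> k | Suc j \<Rightarrow> f j) \<noteq> 0}"
    by (rule rev_finite_subset)
qed

definition ptail :: "(nat \<Rightarrow>\<^sub>0 nat) \<Rightarrow> (nat \<Rightarrow>\<^sub>0 nat)" where
  "ptail a = Poly_Mapping.map_key Suc a"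

lemma lookup_pcons_0 [simp]: "Poly_Mapping.lookup (pcons k a) 0 = k"
  by (simp add: pcons.rep_eq)

lemma lookup_pcons_Suc [simp]: "Poly_Mapping.lookup (pcons k a) (Suc i) = Poly_Mapping.lookup a i"
  by (simp add: pcons.rep_eq)

lemma lookup_pcons: "Poly_Mapping.lookup (pcons k a) i = (case i of 0 \<Rightarrow> k | Suc j \<Rightarrow> Poly_Mapping.lookup a j)"
  by (simp add: pcons.rep_eq)

lemma lookup_ptail [simp]: "Poly_Mapping.lookup (ptail a) i = Poly_Mapping.lookup a (Suc i)"
  by (simp add: ptail_def map_key.rep_eq)

lemma pcons_ptail [simp]: "pcons (Poly_Mapping.lookup a 0) (ptail a) = a"
  by (rule poly_mapping_eqI) (auto simp: lookup_pcons split: nat.splits)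

lemma ptail_pcons [simp]: "ptail (pcons k a) = a"
  by (rule poly_mapping_eqI) simp

lemma pcons_exhaust: obtains k b where "a = pcons k b"
  using pcons_ptail by metis

lemma pcons_eq_iff [simp]: "pcons k a = pcons j b \<longleftrightarrow> k = j \<and> a = b"
  by (metis lookup_pcons_0 ptail_pcons)

lemma pcons_add: "pcons k a + pcons j b = pcons (k + j) (a + b)"
  by (rule poly_mapping_eqI) (auto simp: lookup_pcons lookup_add split: nat.splits)

lemma pcons_0_0 [simp]: "pcons 0 0 = 0"
  by (rule poly_mapping_eqI) (auto simp: lookup_pcons split: nat.splits)

lemma pcons_eq_0_iff [simp]: "pcons k a = 0 \<longleftrightarrow> k = 0 \<and> a = 0"
  by (metis pcons_0_0 pcons_eq_iff)

lemma keys_pcons: "Poly_Mapping.keys (pcons k a) =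
    (if k = 0 then {} else {0}) \<union> Suc ` Poly_Mapping.keys a"
proof (intro set_eqI)
  fix i show "i \<in> Poly_Mapping.keys (pcons k a) \<longleftrightarrow>
      i \<in> (if k = 0 then {} else {0}) \<union> Suc ` Poly_Mapping.keys a"
    by (cases i) (auto simp: in_keys_iff)
qed

lemma weight_pcons: "weight (pcons k a) = k + weight a"
proof -
  have "(\<Sum>i\<in>Suc ` Poly_Mapping.keys a. Poly_Mapping.lookup (pcons k a) i) = weight a"
    by (simp add: sum.reindex weight_def)
  then show ?thesis
    unfolding weight_def keys_pcons by (subst sum.union_disjoint) auto
qed

text \<open>Every finitely supported sequence arises from 0 by finitely many prependings; the
  induction is on a bound beyond which the entries vanish. It plays the role of an induction on the
  number of variables.\<close>

lemma pcons_induct [case_names zero pcons]: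
  assumes "P 0" "\<And>k a. P a \<Longrightarrow> P (pcons k a)"
  shows "P a"
proof -
  have "(\<And>i. i \<ge> N \<Longrightarrow> Poly_Mapping.lookup a i = 0) \<Longrightarrow> P a" for N
  proof (induction N arbitrary: a)
    case 0
    then have "a = 0" by (intro poly_mapping_eqI) simp
    then show ?case using assms(1) by simp
  next
    case (Suc N)
    have "P (ptail a)" by (rule Suc.IH) (simp add: Suc.prems)
    then show ?case using assms(2) pcons_ptail by metis
  qed
  moreover have "Poly_Mapping.lookup a i = 0" if "i \<ge> Suc (Max (insert 0 (Poly_Mapping.keys a)))" for i
  proof (rule ccontr)
    assume "Poly_Mapping.lookup a i \<noteq> 0"
    then have "i \<le> Max (insert 0 (Poly_Mapping.keys a))"
      by (intro Max_ge) (auto simp: in_keys_iff)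
    with that show False by simp
  qed
  ultimately show ?thesis by blast
qed

section \<open>Partial sums of exponent vectors\<close>

abbreviation psum :: "(nat \<Rightarrow>\<^sub>0 nat) \<Rightarrow> nat \<Rightarrow> nat" where
  "psum a k \<equiv> (\<Sum>i<k. Poly_Mapping.lookup a i)"

lemma psum_pcons_Suc: "psum (pcons x a) (Suc k) = x + psum a k"
  by (simp add: sum.lessThan_Suc_shift del: sum.lessThan_Suc)

lemma psum_eqD:
  assumes "\<And>k. psum a k = psum b k"
  shows "a = b"
proof (rule poly_mapping_eqI)
  fix i
  show "Poly_Mapping.lookup a i = Poly_Mapping.lookup b i"
    using assms[of i] assms[of "Suc i"] by simp
qed

lemma splittings_pcons:
  "{p. fst p + snd p = pcons k a} =
     (\<lambda>(i, p). (pcons i (fst p), pcons (k - i) (snd p))) ` ({..k} \<times> {p. fst p + snd p = a})"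
proof (intro set_eqI iffI)
  fix p assume p: "p \<in> {p. fst p + snd p = pcons k a}"
  obtain i b where b: "fst p = pcons i b" by (rule pcons_exhaust)
  obtain j c where c: "snd p = pcons j c" by (rule pcons_exhaust)
  have "i + j = k" "b + c = a" using p b c by (auto simp: pcons_add)
  then show "p \<in> (\<lambda>(i, p). (pcons i (fst p), pcons (k - i) (snd p))) ` ({..k} \<times> {p. fst p + snd p = a})"
    using b c by (intro image_eqI[of _ _ "(i, (b, c))"]) (auto simp: prod_eq_iff)
qed (auto simp: pcons_add)

lemma conv_pcons:
  "conv f g (pcons k a) = (\<Sum>i\<le>k. conv (\<lambda>b. f (pcons i b)) (\<lambda>c. g (pcons (k - i) c)) a)"
proof -
  have inj: "inj_on (\<lambda>(i, p). (pcons i (fst p), pcons (k - i) (snd p))) ({..k} \<times> {p. fst p + snd p = a})"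
    by (auto simp: inj_on_def prod_eq_iff)
  have "conv f g (pcons k a) = (\<Sum>p | fst p + snd p = pcons k a. f (fst p) * g (snd p))"
    by (simp add: conv_def case_prod_unfold)
  also have "\<dots> = (\<Sum>(i, p)\<in>{..k} \<times> {p. fst p + snd p = a}.
      f (pcons i (fst p)) * g (pcons (k - i) (snd p)))"
    unfolding splittings_pcons by (subst sum.reindex[OF inj]) (simp add: case_prod_unfold)
  also have "\<dots> = (\<Sum>i\<le>k. conv (\<lambda>b. f (pcons i b)) (\<lambda>c. g (pcons (k - i) c)) a)"
    by (simp add: sum.cartesian_product conv_def case_prod_unfold)
  finally show ?thesis .
qed


section \<open>Coefficients in one distinguished variable\<close>

lemma map_key_pcons_swap:
  "Poly_Mapping.map_key (Transposition.transpose 0 (Suc 0)) (pcons i (pcons j a)) = pcons j (pcons i a)"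
  by (rule poly_mapping_eqI)
     (auto simp: lookup_map_key_bij lookup_pcons Transposition.transpose_def split: nat.splits)

lemma bij_lift_Suc:
  assumes "bij \<sigma>"
  defines "\<tau> \<equiv> \<lambda>i. case i of 0 \<Rightarrow> 0 | Suc j \<Rightarrow> Suc (\<sigma> j)"
  shows "bij \<tau>"
proof (rule o_bij)
  let ?\<rho> = "\<lambda>i. case i of 0 \<Rightarrow> 0 | Suc j \<Rightarrow> Suc (inv \<sigma> j)"
  show "?\<rho> \<circ> \<tau> = id" "\<tau> \<circ> ?\<rho> = id"
    using assms by (auto simp: \<tau>_def fun_eq_iff bij_is_inj bij_is_surj surj_f_inv_f split: nat.splits)
qed

text \<open>The coefficient of z^k in f(z, x_0, x_1, ...), that is, the adjoint of multiplication by
  the complete symmetric function h_k for the Hall scalar product. Symmetry survives because a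
  permutation of the remaining variables extends by fixing the new position 0.\<close>

lift_definition hperp :: "nat \<Rightarrow> 'a::comm_ring_1 symfun \<Rightarrow> 'a symfun" is
  "\<lambda>k f a. f (pcons k a)"
proof (intro conjI, goal_cases)
  case (1 k f)
  then obtain d where "\<forall>a. f a \<noteq> 0 \<longrightarrow> weight a \<le> d" by blast
  then show ?case
    by (intro exI[of _ d]) (metis add_leD2 weight_pcons)
next
  case (2 k f)
  show ?case
  proof (intro allI impI)
    fix \<sigma> :: "nat \<Rightarrow> nat" and a assume "bij \<sigma>"
    let ?\<tau> = "\<lambda>i. case i of 0 \<Rightarrow> 0 | Suc j \<Rightarrow> Suc (\<sigma> j)"
    have b: "bij ?\<tau>" using \<open>bij \<sigma>\<close> by (rule bij_lift_Suc)
    have "pcons k (Poly_Mapping.map_key \<sigma> a) = Poly_Mapping.map_key ?\<tau> (pcons k a)"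
      using \<open>bij \<sigma>\<close> b by (intro poly_mapping_eqI)
        (auto simp: lookup_map_key_bij lookup_pcons split: nat.splits)
    then show "f (pcons k (Poly_Mapping.map_key \<sigma> a)) = f (pcons k a)"
      using 2 b by auto
  qed
qed

lemma sym_coeff_hperp: "sym_coeff (hperp k f) a = sym_coeff f (pcons k a)"
  by (simp add: hperp.rep_eq)

text \<open>Shifting all positions by one is not a permutation, but on the positions that matter it
  agrees with a cycle: position \<open>N\<close> lies beyond the support, and its zero entry is
  moved to the front.\<close>

lemma sym_coeff_pcons_0: "sym_coeff f (pcons 0 a) = sym_coeff f a"
proof -
  define N where "N = Suc (Max (insert 0 (Poly_Mapping.keys a)))"
  have N: "Poly_Mapping.lookup a i = 0" if "i \<ge> N" for i
  proof (rule ccontr)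
    assume "Poly_Mapping.lookup a i \<noteq> 0"
    then have "i \<le> Max (insert 0 (Poly_Mapping.keys a))"
      by (intro Max_ge) (auto simp: in_keys_iff)
    with that show False by (simp add: N_def)
  qed
  let ?\<sigma> = "\<lambda>i. if i = 0 then N else if i \<le> N then i - 1 else i"
  let ?\<tau> = "\<lambda>i. if i = N then 0 else if i < N then i + 1 else i"
  have b: "bij ?\<sigma>"
    by (rule o_bij[of ?\<tau>]) (auto simp: fun_eq_iff)
  have "pcons 0 a = Poly_Mapping.map_key ?\<sigma> a"
    using b by (intro poly_mapping_eqI) (auto simp: lookup_map_key_bij lookup_pcons N split: nat.splits)
  then show ?thesis using b by (simp add: sym_coeff_map_key)
qed

lemma hperp_0 [simp]: "hperp 0 f = f"
  by (rule symfun_eqI) (simp add: sym_coeff_hperp sym_coeff_pcons_0)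

lemma sym_coeff_add: "sym_coeff (f + g) a = sym_coeff f a + sym_coeff g a"
  by (simp add: plus_symfun.rep_eq)

lemma sym_coeff_diff: "sym_coeff (f - g) a = sym_coeff f a - sym_coeff g a"
  by (simp add: minus_symfun.rep_eq)

lemma sym_coeff_zero [simp]: "sym_coeff 0 a = 0"
  by (simp add: zero_symfun.rep_eq)

lemma sym_coeff_one: "sym_coeff 1 a = (if a = 0 then 1 else 0)"
  by (simp add: one_symfun.rep_eq)

lemma sym_coeff_scale: "sym_coeff (sym_scale c f) a = c * sym_coeff f a"
  by (simp add: sym_scale.rep_eq)

lemma sym_coeff_mult: "sym_coeff (f * g) a = conv (sym_coeff f) (sym_coeff g) a"
  by (simp add: times_symfun.rep_eq)

lemma sym_coeff_mult_0: "sym_coeff (f * g) 0 = sym_coeff f 0 * sym_coeff g 0"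
proof -
  have "{p. fst p + snd p = (0 :: nat \<Rightarrow>\<^sub>0 nat)} = {(0, 0)}"
    by (auto simp: poly_mapping_eq_iff fun_eq_iff plus_poly_mapping.rep_eq)
  then show ?thesis by (simp add: sym_coeff_mult conv_def case_prod_unfold)
qed

lemma hperp_mult: "hperp k (f * g) = (\<Sum>i\<le>k. hperp i f * hperp (k - i) g)"
proof (rule symfun_eqI)
  fix a
  have "sym_coeff (hperp i f) = (\<lambda>b. sym_coeff f (pcons i b))" for i and f :: "'a symfun"
    by (simp add: fun_eq_iff sym_coeff_hperp)
  then show "sym_coeff (hperp k (f * g)) a = sym_coeff (\<Sum>i\<le>k. hperp i f * hperp (k - i) g) a"
    by (simp add: sym_coeff_hperp sym_coeff_mult conv_pcons sym_coeff_sum)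
qed

lemma hperp_commute: "hperp i (hperp j f) = hperp j (hperp i f)"
proof (rule symfun_eqI)
  fix a
  show "sym_coeff (hperp i (hperp j f)) a = sym_coeff (hperp j (hperp i f)) a"
    unfolding sym_coeff_hperp
    by (subst (2) map_key_pcons_swap[symmetric], subst sym_coeff_map_key) simp_all
qed

lemma hperp_add: "hperp k (f + g) = hperp k f + hperp k g"
  by (rule symfun_eqI) (simp add: sym_coeff_hperp sym_coeff_add)

lemma hperp_diff: "hperp k (f - g) = hperp k f - hperp k g"
  by (rule symfun_eqI) (simp add: sym_coeff_hperp sym_coeff_diff)

lemma hperp_scale: "hperp k (sym_scale c f) = sym_scale c (hperp k f)"
  by (rule symfun_eqI) (simp add: sym_coeff_hperp sym_coeff_scale)

lemma hperp_zero [simp]: "hperp k 0 = 0"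
  by (rule symfun_eqI) (simp add: sym_coeff_hperp)

lemma hperp_sum: "hperp k (\<Sum>i\<in>A. f i) = (\<Sum>i\<in>A. hperp k (f i))"
  by (induction A rule: infinite_finite_induct) (simp_all add: hperp_add)

lemma hperp_one: "hperp k 1 = (if k = 0 then 1 else 0)"
  by (rule symfun_eqI) (auto simp: sym_coeff_hperp sym_coeff_one)

lemma sym_scale_add_right: "sym_scale c (f + g) = sym_scale c f + sym_scale c g"
  by (rule symfun_eqI) (simp add: sym_coeff_add sym_coeff_scale algebra_simps)

lemma sym_scale_diff_right: "sym_scale c (f - g) = sym_scale c f - sym_scale c g"
  by (rule symfun_eqI) (simp add: sym_coeff_diff sym_coeff_scale algebra_simps)

lemma sym_scale_add_left: "sym_scale (c + d) f = sym_scale c f + sym_scale d f"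
  by (rule symfun_eqI) (simp add: sym_coeff_add sym_coeff_scale algebra_simps)

lemma sym_scale_diff_left: "sym_scale (c - d) f = sym_scale c f - sym_scale d f"
  by (rule symfun_eqI) (simp add: sym_coeff_diff sym_coeff_scale algebra_simps)

lemma sym_scale_scale [simp]: "sym_scale c (sym_scale d f) = sym_scale (c * d) f"
  by (rule symfun_eqI) (simp add: sym_coeff_scale mult.assoc)

lemma sym_scale_1 [simp]: "sym_scale 1 f = f"
  by (rule symfun_eqI) (simp add: sym_coeff_scale)

lemma sym_scale_0 [simp]: "sym_scale 0 f = 0" "sym_scale c 0 = 0"
  by (rule symfun_eqI, simp add: sym_coeff_scale)+

lemma sym_scale_sum_right: "sym_scale c (\<Sum>i\<in>A. f i) = (\<Sum>i\<in>A. sym_scale c (f i))"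
  by (rule symfun_eqI) (simp add: sym_coeff_scale sym_coeff_sum sum_distrib_left)

lemma sym_scale_sum_left: "sym_scale (\<Sum>i\<in>A. c i) f = (\<Sum>i\<in>A. sym_scale (c i) f)"
  by (rule symfun_eqI) (simp add: sym_coeff_scale sym_coeff_sum sum_distrib_right)

lemma sym_scale_mult_left [simp]: "sym_scale c f * g = sym_scale c (f * g)"
  by (rule symfun_eqI)
     (simp add: sym_coeff_scale sym_coeff_mult conv_def case_prod_unfold sum_distrib_left mult.assoc)

lemma sym_scale_mult_right [simp]: "f * sym_scale c g = sym_scale c (f * g)"
  by (metis mult.commute sym_scale_mult_left)

lemma of_nat_symfun: "of_nat n * f = sym_scale (of_nat n) f"
  by (induction n) (simp_all add: sym_scale_add_left distrib_right)

section \<open>Degree bounds and constants\<close>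

definition deg_le :: "nat \<Rightarrow> 'a::zero symfun \<Rightarrow> bool" where
  "deg_le d f \<longleftrightarrow> (\<forall>a. sym_coeff f a \<noteq> 0 \<longrightarrow> weight a \<le> d)"

lemma ex_deg_le: "\<exists>d. deg_le d f"
  using sym_coeff_bounded[of f] by (simp add: deg_le_def)

lemma deg_le_mono: "deg_le d f \<Longrightarrow> d \<le> e \<Longrightarrow> deg_le e f"
  by (auto simp: deg_le_def intro: le_trans)

lemma deg_le_hperp: "deg_le d f \<Longrightarrow> deg_le (d - k) (hperp k f)"
  by (force simp: deg_le_def sym_coeff_hperp weight_pcons)

lemma hperp_eq_0: "deg_le d f \<Longrightarrow> d < k \<Longrightarrow> hperp k f = 0"
  by (rule symfun_eqI) (force simp: deg_le_def sym_coeff_hperp weight_pcons)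

lemma deg_le_0 [simp]: "deg_le d 0"
  by (simp add: deg_le_def)

lemma deg_le_add: "deg_le d f \<Longrightarrow> deg_le d g \<Longrightarrow> deg_le d (f + g)"
  by (auto simp: deg_le_def sym_coeff_add) (metis add_0)

lemma deg_le_diff: "deg_le d f \<Longrightarrow> deg_le d g \<Longrightarrow> deg_le d (f - g)"
  by (auto simp: deg_le_def sym_coeff_diff) (metis diff_zero)

lemma deg_le_scale: "deg_le d f \<Longrightarrow> deg_le d (sym_scale c f)"
  by (auto simp: deg_le_def sym_coeff_scale) (metis mult_zero_right)

lemma deg_le_sum: "(\<And>i. i \<in> A \<Longrightarrow> deg_le d (f i)) \<Longrightarrow> deg_le d (\<Sum>i\<in>A. f i)"
  by (induction A rule: infinite_finite_induct) (auto simp: deg_le_add)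

lemma deg_le_mult:
  assumes "deg_le d f" "deg_le e g"
  shows "deg_le (d + e) (f * g)"
  unfolding deg_le_def
proof (intro allI impI)
  fix a assume "sym_coeff (f * g) a \<noteq> 0"
  then obtain b c where "b + c = a" "sym_coeff f b * sym_coeff g c \<noteq> 0"
    unfolding sym_coeff_mult conv_def by (force elim: sum.not_neutral_contains_not_neutral)
  moreover from this have "sym_coeff f b \<noteq> 0" "sym_coeff g c \<noteq> 0" by auto
  ultimately show "weight a \<le> d + e"
    using assms weight_add[of b c] by (auto simp: deg_le_def intro!: add_mono)
qed

lemma eq_const_if_hperp_eq_0:
  assumes "\<And>k. k \<ge> 1 \<Longrightarrow> hperp k f = 0"
  shows "f = sym_scale (sym_coeff f 0) 1"
proof (rule symfun_eqI)
  fix a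
  have "a \<noteq> 0 \<Longrightarrow> sym_coeff f a = 0"
  proof (induction a rule: pcons_induct)
    case (pcons k a)
    show ?case
    proof (cases k)
      case 0
      then show ?thesis using pcons by (simp add: sym_coeff_pcons_0)
    next
      case (Suc j)
      then show ?thesis using assms[of k] by (metis sym_coeff_hperp sym_coeff_zero le_add1 plus_1_eq_Suc)
    qed
  qed simp
  then show "sym_coeff f a = sym_coeff (sym_scale (sym_coeff f 0) 1) a"
    by (auto simp: sym_coeff_scale sym_coeff_one)
qed


section \<open>Adjoints of power sums\<close>

text \<open>
  Up to the factor \<open>k\<close>, this is the derivative with respect to the power sum \<open>p\<^sub>k\<close>: adding a
  variable \<open>z\<close> to \<open>f\<close> gives \<open>\<Sum>\<^sub>k z\<^sup>k hperp k f\<close>, and the recursion is the logarithmic derivative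
  in \<open>z\<close> of \<open>\<Sum>\<^sub>k z\<^sup>k hperp k = exp (\<Sum>\<^sub>k z\<^sup>k pperp k / k)\<close>.
\<close>

function pperp :: "nat \<Rightarrow> 'a::comm_ring_1 symfun \<Rightarrow> 'a symfun" where
  "pperp k f = of_nat k * hperp k f - (\<Sum>i\<in>{1..<k}. pperp i (hperp (k - i) f))"
  by auto
termination by (relation "measure fst") auto

declare pperp.simps [simp del]

lemma pperp_rec: "of_nat k * hperp k f = (\<Sum>i\<in>{1..k}. pperp i (hperp (k - i) f))"
proof (cases k)
  case (Suc j)
  then have "{1..k} = insert k {1..<k}" by auto
  then show ?thesis by (simp add: pperp.simps[of k])
qed simp

lemma pperp_add: "pperp k (f + g) = pperp k f + pperp k g"
proof (induction k arbitrary: f g rule: less_induct)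
  case (less k)
  then show ?case
    by (simp add: pperp.simps[of k] hperp_add distrib_left sum.distrib)
qed

lemma pperp_zero [simp]: "pperp k 0 = 0"
  using pperp_add[of k 0 0] by simp

lemma pperp_scale: "pperp k (sym_scale c f) = sym_scale c (pperp k f)"
proof (induction k arbitrary: f rule: less_induct)
  case (less k)
  then show ?case
    by (simp add: pperp.simps[of k] hperp_scale sym_scale_diff_right sym_scale_sum_right)
qed

lemma pperp_minus: "pperp k (- f) = - pperp k f"
  using pperp_add[of k f "- f"] by (simp add: minus_unique)

lemma pperp_diff: "pperp k (f - g) = pperp k f - pperp k g"
  using pperp_add[of k f "- g"] by (simp add: pperp_minus)

lemma pperp_sum: "pperp k (\<Sum>i\<in>A. f i) = (\<Sum>i\<in>A. pperp k (f i))"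
  by (induction A rule: infinite_finite_induct) (simp_all add: pperp_add)

lemma hperp_of_nat_mult: "hperp j (of_nat k * f) = of_nat k * hperp j f"
  by (simp add: of_nat_symfun hperp_scale)

lemma hperp_pperp: "hperp j (pperp k f) = pperp k (hperp j f)"
proof (induction k arbitrary: f rule: less_induct)
  case (less k)
  then show ?case
    by (simp add: pperp.simps[of k] hperp_diff hperp_of_nat_mult hperp_sum hperp_commute[of j])
qed

lemma pperp_commute: "pperp j (pperp k f) = pperp k (pperp j f)"
proof (induction k arbitrary: f rule: less_induct)
  case (less k)
  then show ?case
    by (simp add: pperp.simps[of k] pperp_diff of_nat_symfun pperp_scale pperp_sum hperp_pperp)
qed

lemma deg_le_pperp: "deg_le d f \<Longrightarrow> deg_le (d - k) (pperp k f)"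
proof (induction k arbitrary: d f rule: less_induct)
  case (less k)
  have "deg_le (d - k) (pperp i (hperp (k - i) f))" if "i \<in> {1..<k}" for i
  proof -
    have "d - (k - i) - i = d - k" using that by auto
    moreover have "deg_le (d - (k - i) - i) (pperp i (hperp (k - i) f))"
      using that by (intro less.IH deg_le_hperp[OF less.prems]) auto
    ultimately show ?thesis by (simp only:)
  qed
  then show ?case
    unfolding pperp.simps[of k] of_nat_symfun using less.prems
    by (intro deg_le_diff deg_le_scale deg_le_sum deg_le_hperp) auto
qed

text \<open>Both sides run over the triples i >= 1, v, w with i + v + w = k. Here i is grouped with
  v, in \<open>sum_triangle_snd\<close> with w.\<close>

lemma sum_triangle_fst:
  "(\<Sum>u\<le>k. \<Sum>i\<in>{1..u}. F i (u - i) (k - u)) = (\<Sum>i\<in>{1..k::nat}. \<Sum>v\<le>k - i. F i v (k - i - v))"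
  for F :: "nat \<Rightarrow> nat \<Rightarrow> nat \<Rightarrow> 'a::comm_monoid_add"
proof -
  have "(\<Sum>u\<le>k. \<Sum>i\<in>{1..u}. F i (u - i) (k - u))
      = (\<Sum>(u, i)\<in>(SIGMA u:{..k}. {1..u}). F i (u - i) (k - u))"
    by (rule sum.Sigma) auto
  also have "\<dots> = (\<Sum>(i, v)\<in>(SIGMA i:{1..k}. {..k - i}). F i v (k - i - v))"
    by (rule sum.reindex_bij_witness[of _ "\<lambda>(i, v). (i + v, i)" "\<lambda>(u, i). (i, u - i)"]) auto
  also have "\<dots> = (\<Sum>i\<in>{1..k}. \<Sum>v\<le>k - i. F i v (k - i - v))"
    by (rule sum.Sigma[symmetric]) auto
  finally show ?thesis .
qed

lemma sum_triangle_snd: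
  "(\<Sum>u\<le>k. \<Sum>i\<in>{1..k - u}. F i u (k - u - i)) = (\<Sum>i\<in>{1..k::nat}. \<Sum>v\<le>k - i. F i v (k - i - v))"
  for F :: "nat \<Rightarrow> nat \<Rightarrow> nat \<Rightarrow> 'a::comm_monoid_add"
proof -
  have "(\<Sum>u\<le>k. \<Sum>i\<in>{1..k - u}. F i u (k - u - i))
      = (\<Sum>(u, i)\<in>(SIGMA u:{..k}. {1..k - u}). F i u (k - u - i))"
    by (rule sum.Sigma) auto
  also have "\<dots> = (\<Sum>(i, v)\<in>(SIGMA i:{1..k}. {..k - i}). F i v (k - i - v))"
    by (rule sum.reindex_bij_witness[of _ "\<lambda>(i, v). (v, i)" "\<lambda>(u, i). (i, u)"])
       (auto simp: add.commute)
  also have "\<dots> = (\<Sum>i\<in>{1..k}. \<Sum>v\<le>k - i. F i v (k - i - v))"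
    by (rule sum.Sigma[symmetric]) auto
  finally show ?thesis .
qed

text \<open>Multiplying the coefficient of z^k by k is the Euler derivation in z, and k = u + (k -
  u) is its product rule. Expanding both factors by \<open>pperp_rec\<close> gives the recursion for
  the expected right side; the summands with i < k agree by induction, so those with i = k
  do.\<close>

lemma pperp_mult: "pperp k (f * g) = pperp k f * g + f * pperp k g"
proof (induction k arbitrary: f g rule: less_induct)
  case (less k)
  define Y where "Y i = (\<Sum>v\<le>k - i. pperp i (hperp v f) * hperp (k - i - v) g
      + hperp v f * pperp i (hperp (k - i - v) g))" for i
  have "(\<Sum>i\<in>{1..k}. pperp i (hperp (k - i) (f * g))) = of_nat k * hperp k (f * g)"
    by (simp add: pperp_rec)
  also have "\<dots> = (\<Sum>u\<le>k. of_nat (u + (k - u)) * (hperp u f * hperp (k - u) g))"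
    by (simp add: hperp_mult sum_distrib_left)
  also have "\<dots> = (\<Sum>u\<le>k. (of_nat u * hperp u f) * hperp (k - u) g
      + hperp u f * (of_nat (k - u) * hperp (k - u) g))"
    by (intro sum.cong refl) (simp only: of_nat_add algebra_simps)
  also have "\<dots> = (\<Sum>u\<le>k. \<Sum>i\<in>{1..u}. pperp i (hperp (u - i) f) * hperp (k - u) g)
      + (\<Sum>u\<le>k. \<Sum>i\<in>{1..k - u}. hperp u f * pperp i (hperp (k - u - i) g))"
    by (simp only: pperp_rec sum.distrib sum_distrib_left sum_distrib_right)
  also have "\<dots> = (\<Sum>i\<in>{1..k}. Y i)"
    unfolding Y_def sum.distrib
    using sum_triangle_fst[of "\<lambda>i v w. pperp i (hperp v f) * hperp w g" k]
      sum_triangle_snd[of "\<lambda>i v w. hperp v f * pperp i (hperp w g)" k] by simp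
  finally have eq: "(\<Sum>i\<in>{1..k}. pperp i (hperp (k - i) (f * g))) = (\<Sum>i\<in>{1..k}. Y i)" .
  show ?case
  proof (cases "k = 0")
    case True
    then show ?thesis by (simp add: pperp.simps[of 0])
  next
    case False
    then have ins: "{1..k} = insert k {1..<k}" by auto
    have "pperp i (hperp (k - i) (f * g)) = Y i" if "i \<in> {1..<k}" for i
      using less.IH[of i] that by (simp add: hperp_mult pperp_sum Y_def)
    then have "(\<Sum>i\<in>{1..<k}. pperp i (hperp (k - i) (f * g))) = (\<Sum>i\<in>{1..<k}. Y i)"
      by simp
    then have "pperp k (f * g) = Y k"
      using eq unfolding ins by simp
    then show ?thesis by (simp add: Y_def)
  qed
qed

lemma hperp_power_sum:
  assumes "j \<ge> 1"
  shows "hperp i (power_sum j) = (if i = 0 then power_sum j else if i = j then 1 else 0)"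
proof (cases "i = 0")
  case False
  show ?thesis
  proof (rule symfun_eqI)
    fix a
    have "(\<exists>l. pcons i a = Poly_Mapping.single l j) \<longleftrightarrow> i = j \<and> a = 0"
    proof
      assume "\<exists>l. pcons i a = Poly_Mapping.single l j"
      then obtain l where l: "pcons i a = Poly_Mapping.single l j" ..
      have "Poly_Mapping.lookup (pcons i a) 0 \<noteq> 0" using False by simp
      then have "l = 0" unfolding l by (auto simp: lookup_single when_def split: if_splits)
      moreover have "Poly_Mapping.single 0 j = pcons j 0"
        by (rule poly_mapping_eqI) (auto simp: lookup_pcons lookup_single when_def split: nat.splits)
      ultimately show "i = j \<and> a = 0" using l by simp
    next
      assume "i = j \<and> a = 0"
      then show "\<exists>l. pcons i a = Poly_Mapping.single l j"
        by (intro exI[of _ 0] poly_mapping_eqI)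
           (auto simp: lookup_pcons lookup_single when_def split: nat.splits)
    qed
    then show "sym_coeff (hperp i (power_sum j)) a =
        sym_coeff (if i = 0 then power_sum j else if i = j then 1 else 0) a"
      using False by (simp add: sym_coeff_hperp sym_coeff_power_sum sym_coeff_one)
  qed
qed simp

lemma pperp_one [simp]: "pperp k 1 = 0"
  using pperp_mult[of k 1 1] by simp

lemma pperp_power_sum:
  assumes "j \<ge> 1"
  shows "pperp k (power_sum j :: 'a::comm_ring_1 symfun) = (if k = j then of_nat k else 0)"
proof -
  have "pperp i (hperp (k - i) (power_sum j :: 'a symfun)) = 0" if "i \<in> {1..<k}" for i
    using that assms by (simp add: hperp_power_sum)
  then have "(\<Sum>i\<in>{1..<k}. pperp i (hperp (k - i) (power_sum j :: 'a symfun))) = 0"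
    by (rule sum.neutral[OF ballI])
  then show ?thesis using assms
    by (simp only: pperp.simps[of k]) (simp add: hperp_power_sum)
qed

lemma hperp_eq_0_if_pperp_eq_0:
  fixes f :: "'a::field_char_0 symfun"
  assumes "\<And>k. k \<ge> 1 \<Longrightarrow> pperp k f = 0" "k \<ge> 1"
  shows "hperp k f = 0"
proof -
  have "pperp i (hperp (k - i) f) = 0" if "i \<in> {1..k}" for i
    using assms(1)[of i] that by (simp add: hperp_pperp[symmetric])
  then have "of_nat k * hperp k f = 0"
    unfolding pperp_rec by (intro sum.neutral) auto
  then have "sym_scale (inverse (of_nat k)) (sym_scale (of_nat k) (hperp k f)) = 0"
    by (simp add: of_nat_symfun)
  then show ?thesis using assms(2) by simp
qed


section \<open>The plethystic shift \<open>X \<mapsto> X + (q - 1) z\<close>\<close>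

text \<open>The coefficient of z^k in f[X + (q - 1) z]. Adding the variable z once more yields
  f[X + q z], whose coefficient is q^k times \<open>hperp k f\<close>; the recursion solves this
  identity for its last term, so no general plethysm has to be defined.\<close>

function qshift :: "'a::comm_ring_1 \<Rightarrow> nat \<Rightarrow> 'a symfun \<Rightarrow> 'a symfun" where
  "qshift q k f = sym_scale (q ^ k) (hperp k f) - (\<Sum>i<k. hperp (k - i) (qshift q i f))"
  by auto
termination by (relation "measure (\<lambda>(q, k, f). k)") auto

declare qshift.simps [simp del]

lemma qshift_rec: "(\<Sum>i\<le>k. hperp (k - i) (qshift q i f)) = sym_scale (q ^ k) (hperp k f)"
proof -
  have "{..k} = insert k {..<k}" by auto
  then show ?thesis by (simp add: qshift.simps[of q k])
qed

lemma qshift_0 [simp]: "qshift q 0 f = f"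
  by (simp add: qshift.simps[of q 0])

lemma qshift_add: "qshift q k (f + g) = qshift q k f + qshift q k g"
proof (induction k arbitrary: f g rule: less_induct)
  case (less k)
  then show ?case
    by (simp add: qshift.simps[of q k] hperp_add sym_scale_add_right sum.distrib)
qed

lemma qshift_zero [simp]: "qshift q k 0 = 0"
  using qshift_add[of q k 0 0] by simp

lemma qshift_scale: "qshift q k (sym_scale c f) = sym_scale c (qshift q k f)"
proof (induction k arbitrary: f rule: less_induct)
  case (less k)
  then show ?case
    by (simp add: qshift.simps[of q k] hperp_scale sym_scale_diff_right sym_scale_sum_right mult.commute)
qed

lemma hperp_qshift: "hperp j (qshift q k f) = qshift q k (hperp j f)"
proof (induction k arbitrary: f rule: less_induct)
  case (less k)
  then show ?case
    by (simp add: qshift.simps[of q k] hperp_diff hperp_scale hperp_sum hperp_commute[of j])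
qed

text \<open>The second conjunct is separate because \<open>d - k\<close> is truncated to 0 for d <
  k, where the degree bound alone would still allow a constant.\<close>

lemma deg_le_qshift:
  assumes "deg_le d f"
  shows "deg_le (d - k) (qshift q k f) \<and> (d < k \<longrightarrow> qshift q k f = 0)"
proof (induction k rule: less_induct)
  case (less k)
  have "deg_le (d - k) (hperp (k - i) (qshift q i f))" if "i < k" for i
    using deg_le_hperp[of "d - i" "qshift q i f" "k - i"] less.IH[of i] that by simp
  moreover have "hperp (k - i) (qshift q i f) = 0" if "i < k" "d < k" for i
  proof (cases "d < i")
    case False
    then show ?thesis
      using hperp_eq_0[of "d - i" "qshift q i f" "k - i"] less.IH[of i] that by auto
  qed (use less.IH[of i] that in auto)
  ultimately show ?case
    unfolding qshift.simps[of q k] using assms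
    by (auto intro!: deg_le_diff deg_le_scale deg_le_sum deg_le_hperp simp: hperp_eq_0)
qed

lemma qshift_eq_0: "deg_le d f \<Longrightarrow> d < k \<Longrightarrow> qshift q k f = 0"
  using deg_le_qshift by blast

text \<open>Adding z to the product of the two shifts gives f[X + q z] g[X + q z], so the right side
  satisfies the recursion that defines the shift of the product. In the reindexing, \<open>u\<close>
  is the total z-degree of the first factor.\<close>

lemma qshift_mult: "qshift q k (f * g) = (\<Sum>i\<le>k. qshift q i f * qshift q (k - i) g)"
proof (induction k rule: less_induct)
  case (less k)
  define R where "R m = (\<Sum>i\<le>m. qshift q i f * qshift q (m - i) g)" for m
  let ?F = "\<lambda>j i j' i'. hperp j (qshift q i f) * hperp j' (qshift q i' g)"
  have "(\<Sum>m\<le>k. hperp (k - m) (R m)) =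
      (\<Sum>m\<le>k. \<Sum>i\<le>m. \<Sum>j\<le>k - m. ?F j i (k - m - j) (m - i))"
    by (simp add: R_def hperp_sum hperp_mult)
  also have "\<dots> = (\<Sum>(m, i, j)\<in>(SIGMA m:{..k}. SIGMA i:{..m}. {..k - m}). ?F j i (k - m - j) (m - i))"
    by (simp add: sum.Sigma)
  also have "\<dots> = (\<Sum>(u, i, i')\<in>(SIGMA u:{..k}. SIGMA i:{..u}. {..k - u}). ?F (u - i) i (k - u - i') i')"
    by (rule sum.reindex_bij_witness[of _ "\<lambda>(u, i, i'). (i + i', i, u - i)" "\<lambda>(m, i, j). (i + j, i, m - i)"])
       (auto simp: algebra_simps)
  also have "\<dots> = (\<Sum>u\<le>k. \<Sum>i\<le>u. \<Sum>i'\<le>k - u. ?F (u - i) i (k - u - i') i')"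
    by (simp add: sum.Sigma)
  also have "\<dots> = (\<Sum>u\<le>k. sym_scale (q ^ u) (hperp u f) * sym_scale (q ^ (k - u)) (hperp (k - u) g))"
    by (simp only: qshift_rec[symmetric] sum_product)
  also have "\<dots> = sym_scale (q ^ k) (hperp k (f * g))"
    by (simp add: hperp_mult sym_scale_sum_right power_add[symmetric])
  also have "\<dots> = (\<Sum>m\<le>k. hperp (k - m) (qshift q m (f * g)))"
    by (simp add: qshift_rec)
  finally have eq: "(\<Sum>m\<le>k. hperp (k - m) (R m)) = (\<Sum>m\<le>k. hperp (k - m) (qshift q m (f * g)))" .
  have ins: "{..k} = insert k {..<k}" by auto
  have "(\<Sum>m<k. hperp (k - m) (R m)) = (\<Sum>m<k. hperp (k - m) (qshift q m (f * g)))"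
    using less.IH by (simp add: R_def)
  then have "R k = qshift q k (f * g)"
    using eq unfolding ins by simp
  then show ?case by (simp add: R_def)
qed

lemma qshift_power_sum:
  assumes "j \<ge> 1"
  shows "qshift q k (power_sum j) =
    (if k = 0 then power_sum j else if k = j then sym_scale (q ^ j - 1) 1 else 0)"
proof (induction k rule: less_induct)
  case (less k)
  show ?case
  proof (cases "k = 0")
    case False
    have "(\<Sum>i<k. hperp (k - i) (qshift q i (power_sum j))) =
        (\<Sum>i<k. if i = 0 then hperp k (power_sum j) else 0)"
      using less by (intro sum.cong refl) (auto simp: hperp_scale hperp_one)
    then show ?thesis
      using False assms
      by (auto simp: qshift.simps[of q k] hperp_power_sum sym_scale_diff_left)
  qed simp
qed


section \<open>The Macdonald operator\<close>

text \<open>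
  The degree is an integer index, so that \<open>gfun s n\<close> vanishes for negative \<open>n\<close>. The generating
  function is \<open>\<Prod>\<^sub>i (1 - s x\<^sub>i z) / (1 - x\<^sub>i z)\<close>.
\<close>

lift_definition gfun :: "'a::comm_ring_1 \<Rightarrow> int \<Rightarrow> 'a symfun" is
  "\<lambda>s n a. if int (weight a) = n then (1 - s) ^ card (Poly_Mapping.keys a) else 0"
proof (intro conjI allI impI, goal_cases)
  case (1 s n)
  show ?case by (rule exI[of _ "nat n"]) (auto split: if_splits)
next
  case (2 s n \<sigma> a)
  have "card (\<sigma> -` Poly_Mapping.keys a) = card (Poly_Mapping.keys a)"
    using 2 by (intro card_vimage_inj) (auto simp: bij_is_inj bij_is_surj)
  then show ?case
    using 2 by (simp add: weight_map_key keys_map_key bij_is_inj)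
qed

lemma gfun_0 [simp]: "gfun s 0 = 1"
proof (rule symfun_eqI)
  fix a
  have "weight a = 0 \<longleftrightarrow> a = 0"
    by (auto simp: weight_def in_keys_iff intro!: poly_mapping_eqI)
  then show "sym_coeff (gfun s 0) a = sym_coeff 1 a"
    by (auto simp: gfun.rep_eq sym_coeff_one)
qed

lemma sym_coeff_gfun:
  "sym_coeff (gfun s n) a = (if int (weight a) = n then (1 - s) ^ card (Poly_Mapping.keys a) else 0)"
  by (simp add: gfun.rep_eq)

text \<open>(1 - s x) / (1 - x) = 1 + (1 - s) (x + x^2 + ...): a variable that occurs contributes 1
  - s, whatever its exponent.\<close>

lemma hperp_gfun:
  "hperp i (gfun s n) = (if i = 0 then gfun s n else sym_scale (1 - s) (gfun s (n - int i)))"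
proof (cases "i = 0")
  case False
  have "card (insert 0 (Suc ` Poly_Mapping.keys a)) = Suc (card (Poly_Mapping.keys a))" for a :: "nat \<Rightarrow>\<^sub>0 nat"
    by (subst card_insert_disjoint) (auto simp: card_image)
  then show ?thesis using False
    by (intro symfun_eqI) (auto simp: sym_coeff_hperp sym_coeff_gfun weight_pcons keys_pcons sym_coeff_scale)
qed simp

lemma sum_one_minus_power:
  fixes s :: "'a::comm_ring_1"
  shows "k \<ge> 1 \<Longrightarrow> (1 - s) * (\<Sum>i\<in>{1..<k}. 1 - s ^ i) = of_nat k * (1 - s) - (1 - s ^ k)"
  by (induction k rule: nat_induct_at_least) (simp_all add: algebra_simps)

text \<open>The logarithm of the generating function is the sum of (1 - s^k) p_k z^k / k, so k times
  the derivative by p_k multiplies it by (1 - s^k) z^k.\<close>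

lemma pperp_gfun:
  assumes "k \<ge> 1"
  shows "pperp k (gfun s n) = sym_scale (1 - s ^ k) (gfun s (n - int k))"
  using assms
proof (induction k arbitrary: n rule: less_induct)
  case (less k)
  have "pperp i (hperp (k - i) (gfun s n)) = sym_scale ((1 - s) * (1 - s ^ i)) (gfun s (n - int k))"
    if "i \<in> {1..<k}" for i
    using less.IH[of i "n - int (k - i)"] that by (simp add: hperp_gfun pperp_scale of_nat_diff)
  then have "pperp k (gfun s n) =
      sym_scale (of_nat k * (1 - s) - (1 - s) * (\<Sum>i\<in>{1..<k}. 1 - s ^ i)) (gfun s (n - int k))"
    using less.prems
    by (simp add: pperp.simps[of k] of_nat_symfun hperp_gfun sym_scale_diff_left[symmetric] sum_distrib_left
        sym_scale_sum_left[symmetric] mult.commute)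
  also have "of_nat k * (1 - s) - (1 - s) * (\<Sum>i\<in>{1..<k}. 1 - s ^ i) = 1 - s ^ k"
    using sum_one_minus_power[OF less.prems, of s] by simp
  finally show ?case .
qed

text \<open>
  \<open>macop N s q n f\<close> is the coefficient of \<open>z\<^sup>-\<^sup>n\<close> in
  \<open>\<Prod>\<^sub>i (1 - s x\<^sub>i / z) / (1 - x\<^sub>i / z) \<cdot> f[X + (q - 1) z]\<close>, for \<open>N\<close> at least the degree of \<open>f\<close>.
  For \<open>s = 1 / t\<close> and \<open>n = 0\<close> it is, up to normalisation, Macdonald's operator.
\<close>

definition macop :: "nat \<Rightarrow> 'a::comm_ring_1 \<Rightarrow> 'a \<Rightarrow> int \<Rightarrow> 'a symfun \<Rightarrow> 'a symfun" where
  "macop N s q n f = (\<Sum>m\<le>N. gfun s (n + int m) * qshift q m f)"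

lemma macop_add: "macop N s q n (f + g) = macop N s q n f + macop N s q n g"
  by (simp add: macop_def qshift_add distrib_left sum.distrib)

lemma macop_scale: "macop N s q n (sym_scale c f) = sym_scale c (macop N s q n f)"
  by (simp add: macop_def qshift_scale sym_scale_sum_right)

lemma macop_mono:
  assumes "deg_le M f" "M \<le> N"
  shows "macop N s q n f = macop M s q n f"
  unfolding macop_def using assms
  by (intro sum.mono_neutral_right) (auto simp: qshift_eq_0)

text \<open>Summing over all powers of the peeled variable sets it equal to z, which turns the shift
  by (q - 1) z into one by q z; this is \<open>qshift_rec\<close>. Pairs with j + m > N drop out for
  degree reasons.\<close>

lemma macop_hperp_full:
  assumes "deg_le N f"
  shows "(\<Sum>j\<le>N. macop N s q (n + int j) (hperp j f)) =
         (\<Sum>u\<le>N. sym_scale (q ^ u) (gfun s (n + int u) * hperp u f))"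
proof -
  let ?F = "\<lambda>j m. gfun s (n + int (j + m)) * hperp j (qshift q m f)"
  have zero: "?F j m = 0" if "\<not> j + m \<le> N" "m \<le> N" for j m
  proof -
    have "hperp j (qshift q m f) = 0"
      using deg_le_qshift[OF assms] that by (intro hperp_eq_0[of "N - m"]) auto
    then show ?thesis by simp
  qed
  have "(\<Sum>j\<le>N. macop N s q (n + int j) (hperp j f)) = (\<Sum>(j, m)\<in>{..N} \<times> {..N}. ?F j m)"
    by (simp add: macop_def hperp_qshift sum.cartesian_product add.assoc)
  also have "\<dots> = (\<Sum>(j, m)\<in>{(j, m). j + m \<le> N}. ?F j m)"
    by (rule sum.mono_neutral_right) (use zero in auto)
  also have "\<dots> = (\<Sum>(u, m)\<in>(SIGMA u:{..N}. {..u}). ?F (u - m) m)"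
    by (rule sum.reindex_bij_witness[of _ "\<lambda>(u, m). (u - m, m)" "\<lambda>(j, m). (j + m, m)"]) auto
  also have "\<dots> = (\<Sum>u\<le>N. \<Sum>m\<le>u. ?F (u - m) m)"
    by (rule sum.Sigma[symmetric]) auto
  also have "\<dots> = (\<Sum>u\<le>N. gfun s (n + int u) * (\<Sum>m\<le>u. hperp (u - m) (qshift q m f)))"
    by (simp add: sum_distrib_left)
  finally show ?thesis by (simp add: qshift_rec)
qed

text \<open>
  Peeling off the first variable \<open>x\<close>. The two expansions of \<open>(1 - s x / z) / (1 - x / z)\<close> in
  powers of \<open>x / z\<close> and of \<open>z / x\<close> differ by \<open>(1 - s) \<Sum>\<^sub>j (x / z)\<^sup>j\<close>, summed over all integers \<open>j\<close>;
  this delta function sets \<open>z = x\<close> and produces the last sum.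
\<close>

lemma hperp_macop:
  assumes f: "deg_le N f" and k: "k \<le> N"
  shows "hperp k (macop N s q n f) = sym_scale s (macop N s q n (hperp k f))
      - sym_scale (1 - s) (\<Sum>j\<in>{k<..N}. macop N s q (n + int j - int k) (hperp j f))
      + sym_scale (1 - s) (\<Sum>u\<le>N. sym_scale (q ^ u) (gfun s (n + int u - int k) * hperp u f))"
proof -
  let ?M = "\<lambda>j. macop N s q (n - int k + int j) (hperp j f)"
  have "hperp k (macop N s q n f) =
      (\<Sum>m\<le>N. \<Sum>j\<le>k. hperp (k - j) (gfun s (n + int m)) * qshift q m (hperp j f))"
    unfolding macop_def hperp_sum hperp_mult hperp_qshift
    by (intro sum.cong refl sum.reindex_bij_witness[of _ "\<lambda>j. k - j" "\<lambda>j. k - j"]) auto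
  also have "\<dots> = (\<Sum>j\<le>k. \<Sum>m\<le>N. hperp (k - j) (gfun s (n + int m)) * qshift q m (hperp j f))"
    by (rule sum.swap)
  also have "\<dots> = (\<Sum>j\<le>k. if j = k then ?M k else sym_scale (1 - s) (?M j))"
    unfolding macop_def
    by (intro sum.cong refl) (auto simp: hperp_gfun sym_scale_sum_right of_nat_diff algebra_simps)
  also have "\<dots> = ?M k + sym_scale (1 - s) (\<Sum>j<k. ?M j)"
  proof -
    have "{..k} = insert k {..<k}" by auto
    then show ?thesis by (simp add: sym_scale_sum_right)
  qed
  \<comment> \<open>The terms with j < k have a degree index below \<open>n\<close>. In the
    complement the indices exceed \<open>n\<close>, so that an induction can work with natural
    numbers as indices.\<close>
  also have "(\<Sum>j<k. ?M j) = (\<Sum>j\<le>N. ?M j) - ?M k - (\<Sum>j\<in>{k<..N}. ?M j)"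
  proof -
    have "{..N} = insert k {..<k} \<union> {k<..N}" using k by auto
    moreover have "{..<k} \<inter> {k<..N} = {}" by auto
    ultimately show ?thesis by (simp add: sum.union_disjoint)
  qed
  also have "(\<Sum>j\<le>N. ?M j) = (\<Sum>u\<le>N. sym_scale (q ^ u) (gfun s (n - int k + int u) * hperp u f))"
    by (rule macop_hperp_full[OF f])
  finally show ?thesis
    by (simp add: sym_scale_diff_right sym_scale_diff_left sym_scale_add_right algebra_simps)
qed


section \<open>Eigenvalues and triangularity for the dominance order\<close>

definition mac_ev :: "'a::comm_ring_1 \<Rightarrow> 'a \<Rightarrow> (nat \<Rightarrow>\<^sub>0 nat) \<Rightarrow> 'a" where
  "mac_ev s q a = 1 + (1 - s) * (\<Sum>i\<in>Poly_Mapping.keys a. s ^ i * (q ^ Poly_Mapping.lookup a i - 1))"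

lemma mac_ev_superset:
  assumes "finite A" "Poly_Mapping.keys a \<subseteq> A"
  shows "mac_ev s q a = 1 + (1 - s) * (\<Sum>i\<in>A. s ^ i * (q ^ Poly_Mapping.lookup a i - 1))"
proof -
  have "(\<Sum>i\<in>Poly_Mapping.keys a. s ^ i * (q ^ Poly_Mapping.lookup a i - 1)) =
        (\<Sum>i\<in>A. s ^ i * (q ^ Poly_Mapping.lookup a i - 1))"
    using assms by (intro sum.mono_neutral_left) (auto simp: in_keys_iff)
  then show ?thesis by (simp add: mac_ev_def)
qed

lemma mac_ev_0 [simp]: "mac_ev s q 0 = 1"
  by (simp add: mac_ev_def)

text \<open>A new first row moves all others down by one, which multiplies their contribution by s.
  This is the recursion that \<open>hperp_macop\<close> produces on the diagonal.\<close>

lemma mac_ev_pcons: "mac_ev s q (pcons x a) = (1 - s) * q ^ x + s * mac_ev s q a"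
proof -
  let ?K = "Poly_Mapping.keys a"
  have "mac_ev s q (pcons x a) = 1 + (1 - s) *
      (\<Sum>i\<in>insert 0 (Suc ` ?K). s ^ i * (q ^ Poly_Mapping.lookup (pcons x a) i - 1))"
    by (rule mac_ev_superset) (auto simp: keys_pcons)
  also have "(\<Sum>i\<in>insert 0 (Suc ` ?K). s ^ i * (q ^ Poly_Mapping.lookup (pcons x a) i - 1)) =
      (q ^ x - 1) + s * (\<Sum>i\<in>?K. s ^ i * (q ^ Poly_Mapping.lookup a i - 1))"
    by (subst sum.insert) (auto simp: sum.reindex sum_distrib_left mult.assoc)
  finally show ?thesis by (simp add: mac_ev_def algebra_simps)
qed

lemma psum_le_weight: "psum a k \<le> weight a"
proof -
  have "psum a k \<le> (\<Sum>i\<in>{..<k} \<union> Poly_Mapping.keys a. Poly_Mapping.lookup a i)"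
    by (rule sum_mono2) auto
  also have "\<dots> = weight a" by (rule weight_eq[symmetric]) auto
  finally show ?thesis .
qed

lemma psum_add: "psum (a + b) k = psum a k + psum b k"
  by (simp add: lookup_add sum.distrib)

lemma sym_coeff_mult_eq_0:
  assumes "\<And>b c. b + c = a \<Longrightarrow> sym_coeff f b * sym_coeff g c = 0"
  shows "sym_coeff (f * g) a = 0"
  unfolding sym_coeff_mult conv_def by (rule sum.neutral) (use assms in auto)

text \<open>Treats the delta-function term of \<open>hperp_macop\<close>. A monomial of
  \<open>gfun\<close> has weight n + u - x, and its partial sums are at most its weight; so only
  vectors \<open>pcons u c\<close> that lie above \<open>pcons x a\<close> up to the slack n can
  contribute.\<close>

lemma sym_coeff_gfun_mult_hperp_eq_0:
  assumes "\<And>c. \<lbrakk>weight (pcons u c) + n = weight (pcons x a);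
      \<And>k. psum (pcons x a) k \<le> psum (pcons u c) k + n\<rbrakk> \<Longrightarrow> sym_coeff f (pcons u c) = 0"
  shows "sym_coeff (gfun s (int n + int u - int x) * hperp u f) a = 0"
proof (rule sym_coeff_mult_eq_0)
  fix b c assume bc: "b + c = a"
  show "sym_coeff (gfun s (int n + int u - int x)) b * sym_coeff (hperp u f) c = 0"
  proof (cases "int (weight b) = int n + int u - int x")
    case True
    have "psum (pcons x a) k \<le> psum (pcons u c) k + n" for k
    proof (cases k)
      case (Suc j)
      have "psum a j = psum b j + psum c j" unfolding bc[symmetric] by (rule psum_add)
      moreover have "psum b j \<le> weight b" by (rule psum_le_weight)
      ultimately show ?thesis unfolding Suc psum_pcons_Suc using True by linarith
    qed simp
    moreover have "weight (pcons u c) + n = weight (pcons x a)"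
      using True bc weight_add[of b c] by (simp add: weight_pcons)
    ultimately have "sym_coeff f (pcons u c) = 0" by (intro assms)
    then show ?thesis by (simp add: sym_coeff_hperp)
  qed (simp add: sym_coeff_gfun)
qed

lemma psum_pcons_le:
  assumes "\<And>k. psum a k \<le> psum b k + n" and "x + n \<le> y + m"
  shows "psum (pcons x a) k \<le> psum (pcons y b) k + m"
proof (cases k)
  case (Suc j)
  show ?thesis unfolding Suc psum_pcons_Suc using assms(1)[of j] assms(2) by linarith
qed simp

text \<open>The coefficient of z^-n raises the weight by n and each partial sum by at most n.
  Peeling off the first entry turns n into n + (j - x), and this slack absorbs exactly the
  difference of the first entries. The bound on \<open>weight a\<close> keeps these entries in the
  range of \<open>hperp_macop\<close>.\<close>

lemma sym_coeff_macop_eq_0: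
  assumes "deg_le N f" "weight a \<le> N"
    and "\<And>b. \<lbrakk>weight b + n = weight a; \<And>k. psum a k \<le> psum b k + n\<rbrakk> \<Longrightarrow> sym_coeff f b = 0"
  shows "sym_coeff (macop N s q (int n) f) a = 0"
  using assms
proof (induction a arbitrary: n f rule: pcons_induct)
  case zero
  have "sym_coeff (macop N s q (int n) f) 0 =
      (\<Sum>m\<le>N. sym_coeff (gfun s (int n + int m)) 0 * sym_coeff (qshift q m f) 0)"
    by (simp add: macop_def sym_coeff_sum sym_coeff_mult_0)
  also have "\<dots> = 0"
    using zero(3)[of 0] by (intro sum.neutral) (auto simp: sym_coeff_gfun simp flip: of_nat_add)
  finally show ?case .
next
  case (pcons x a)
  have x: "x \<le> N" and a: "weight a \<le> N" using pcons.prems by (auto simp: weight_pcons)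
  have deg: "deg_le N (hperp j f)" for j
    using deg_le_hperp[OF pcons.prems(1)] by (rule deg_le_mono) simp
  have 1: "sym_coeff (macop N s q (int n) (hperp x f)) a = 0"
  proof (rule pcons.IH[OF deg a])
    fix b assume "weight b + n = weight a" and "\<And>k. psum a k \<le> psum b k + n"
    then show "sym_coeff (hperp x f) b = 0"
      unfolding sym_coeff_hperp
      by (intro pcons.prems(3) psum_pcons_le) (auto simp: weight_pcons)
  qed
  have 2: "sym_coeff (macop N s q (int n + int j - int x) (hperp j f)) a = 0" if "j \<in> {x<..N}" for j
  proof -
    have "sym_coeff (macop N s q (int (n + (j - x))) (hperp j f)) a = 0"
    proof (rule pcons.IH[OF deg a])
      fix b assume "weight b + (n + (j - x)) = weight a" and "\<And>k. psum a k \<le> psum b k + (n + (j - x))"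
      then show "sym_coeff (hperp j f) b = 0"
        unfolding sym_coeff_hperp using that
        by (intro pcons.prems(3) psum_pcons_le[where n = "n + (j - x)"]) (auto simp: weight_pcons)
    qed
    then show ?thesis using that by (simp add: of_nat_diff algebra_simps)
  qed
  have 3: "sym_coeff (gfun s (int n + int u - int x) * hperp u f) a = 0" for u
    by (rule sym_coeff_gfun_mult_hperp_eq_0) (rule pcons.prems(3))
  show ?case
    unfolding sym_coeff_hperp[symmetric] hperp_macop[OF pcons.prems(1) x]
    using 2 by (simp add: sym_coeff_add sym_coeff_diff sym_coeff_scale sym_coeff_sum 1 3)
qed

text \<open>The terms with j > x only see vectors with a larger first entry, which lie strictly
  above and where f vanishes. The delta-function term survives for u = x alone, contributing (1 - s)
  q^x, and \<open>mac_ev_pcons\<close> closes the recursion.\<close>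

lemma sym_coeff_macop_diag:
  assumes "deg_le N f" "weight a \<le> N"
    and "\<And>b. \<lbrakk>weight b = weight a; \<And>k. psum a k \<le> psum b k; b \<noteq> a\<rbrakk> \<Longrightarrow> sym_coeff f b = 0"
  shows "sym_coeff (macop N s q 0 f) a = mac_ev s q a * sym_coeff f a"
  using assms
proof (induction a arbitrary: f rule: pcons_induct)
  case zero
  have "sym_coeff (macop N s q 0 f) 0 =
      (\<Sum>m\<le>N. sym_coeff (gfun s (int m)) 0 * sym_coeff (qshift q m f) 0)"
    by (simp add: macop_def sym_coeff_sum sym_coeff_mult_0)
  also have "\<dots> = (\<Sum>m\<le>N. if m = 0 then sym_coeff f 0 else 0)"
    by (intro sum.cong) (auto simp: sym_coeff_gfun)
  finally show ?case by simp
next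
  case (pcons x a)
  have x: "x \<le> N" and a: "weight a \<le> N" using pcons.prems by (auto simp: weight_pcons)
  have deg: "deg_le N (hperp j f)" for j
    using deg_le_hperp[OF pcons.prems(1)] by (rule deg_le_mono) simp
  have le: "psum (pcons x a) k \<le> psum (pcons y b) k" if "\<And>k. psum a k \<le> psum b k + n" "x + n \<le> y" for k y b n
    using psum_pcons_le[of a b n x y 0] that by simp
  have 1: "sym_coeff (macop N s q 0 (hperp x f)) a = mac_ev s q a * sym_coeff f (pcons x a)"
    unfolding sym_coeff_hperp[symmetric]
  proof (rule pcons.IH[OF deg a])
    fix b assume "weight b = weight a" and "\<And>k. psum a k \<le> psum b k" "b \<noteq> a"
    then show "sym_coeff (hperp x f) b = 0"
      unfolding sym_coeff_hperp
      by (intro pcons.prems(3) le[of b 0]) (auto simp: weight_pcons)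
  qed
  have 2: "sym_coeff (macop N s q (int j - int x) (hperp j f)) a = 0" if "j \<in> {x<..N}" for j
  proof -
    have "sym_coeff (macop N s q (int (j - x)) (hperp j f)) a = 0"
    proof (rule sym_coeff_macop_eq_0[OF deg a])
      fix b assume "weight b + (j - x) = weight a" and "\<And>k. psum a k \<le> psum b k + (j - x)"
      then show "sym_coeff (hperp j f) b = 0"
        unfolding sym_coeff_hperp using that
        by (intro pcons.prems(3) le[of b "j - x"]) (auto simp: weight_pcons)
    qed
    then show ?thesis using that by (simp add: of_nat_diff algebra_simps)
  qed
  have 3: "sym_coeff (gfun s (int u - int x) * hperp u f) a = (if u = x then sym_coeff f (pcons x a) else 0)" for u
  proof (cases "u = x")
    case False
    have "sym_coeff (gfun s (int 0 + int u - int x) * hperp u f) a = 0"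
      by (rule sym_coeff_gfun_mult_hperp_eq_0) (use False in \<open>auto intro!: pcons.prems(3)\<close>)
    then show ?thesis using False by simp
  qed (simp add: sym_coeff_hperp)
  have "sym_coeff (macop N s q 0 f) (pcons x a) = s * (mac_ev s q a * sym_coeff f (pcons x a))
      + (1 - s) * (\<Sum>u\<le>N. q ^ u * (if u = x then sym_coeff f (pcons x a) else 0))"
    unfolding sym_coeff_hperp[where k = x and f = "macop N s q 0 f", symmetric] hperp_macop[OF pcons.prems(1) x]
    using 2 by (simp add: sym_coeff_add sym_coeff_diff sym_coeff_scale sym_coeff_sum 1 3)
  also have "(\<Sum>u\<le>N. q ^ u * (if u = x then sym_coeff f (pcons x a) else 0)) = q ^ x * sym_coeff f (pcons x a)"
    using x by (simp add: if_distrib[of "(*) _"] cong: if_cong)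
  finally show ?case by (simp add: mac_ev_pcons algebra_simps)
qed


section \<open>Power sum expansions\<close>

text \<open>Power sum products are indexed by multisets of parts, since a part can be added or
  removed there without sorting.\<close>

definition pmset :: "(nat \<Rightarrow>\<^sub>0 nat) \<Rightarrow> nat multiset" where
  "pmset l = image_mset (Poly_Mapping.lookup l) (mset_set (Poly_Mapping.keys l))"

lemma zero_notin_pmset: "0 \<notin># pmset l"
  by (auto simp: pmset_def in_keys_iff)

lemma pmset_0 [simp]: "pmset 0 = {#}"
  by (simp add: pmset_def)

lemma pmset_pcons: "pmset (pcons k a) = (if k = 0 then pmset a else add_mset k (pmset a))"
proof -
  have "image_mset (Poly_Mapping.lookup (pcons k a)) (mset_set (Suc ` Poly_Mapping.keys a)) = pmset a"
    unfolding pmset_def by (subst image_mset_mset_set[symmetric]) (auto simp: multiset.map_comp comp_def)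
  then show ?thesis by (auto simp: pmset_def keys_pcons)
qed

lemma pmset_map_key:
  assumes "bij \<sigma>"
  shows "pmset (Poly_Mapping.map_key \<sigma> a) = pmset a"
proof -
  have "\<sigma> ` (\<sigma> -` Poly_Mapping.keys a) = Poly_Mapping.keys a"
    using assms by (simp add: bij_is_surj surj_image_vimage_eq)
  then have "mset_set (Poly_Mapping.keys a) = image_mset \<sigma> (mset_set (\<sigma> -` Poly_Mapping.keys a))"
    using assms by (subst image_mset_mset_set) (auto intro: inj_on_subset[OF bij_is_inj])
  then have "pmset a = image_mset (\<lambda>i. Poly_Mapping.lookup a (\<sigma> i)) (mset_set (\<sigma> -` Poly_Mapping.keys a))"
    by (simp add: pmset_def multiset.map_comp comp_def)
  then show ?thesis
    using assms by (auto simp: pmset_def keys_map_key bij_is_inj lookup_map_key_bij intro!: image_mset_cong)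
qed

lemma pmset_surj:
  assumes "0 \<notin># M"
  obtains l where "is_partition l" "pmset l = M"
proof -
  have "\<exists>a. pmset a = M"
    using assms
  proof (induction M)
    case (add x M)
    then obtain a where "pmset a = M" by auto
    with add.prems show ?case by (intro exI[of _ "pcons x a"]) (auto simp: pmset_pcons)
  qed (auto intro: exI[of _ 0])
  then obtain a where a: "pmset a = M" ..
  obtain l where "is_partition l" "rearrangement l a" by (rule ex_partition_rearrangement)
  with a show ?thesis by (intro that[of l]) (auto simp: rearrangement_def pmset_map_key)
qed

lemma down_closed_eq_lessThan:
  fixes S :: "nat set"
  assumes "finite S" "\<And>i j. i \<in> S \<Longrightarrow> j \<le> i \<Longrightarrow> j \<in> S"
  shows "S = {..<card S}"
proof -
  have "\<exists>n. n \<notin> S" by (rule ex_new_if_finite[OF infinite_UNIV_nat assms(1)])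
  then obtain n where n: "n \<notin> S" "\<And>i. i < n \<Longrightarrow> i \<in> S"
    using exists_least_iff[of "\<lambda>n. n \<notin> S"] by blast
  have "S = {..<n}"
  proof (intro set_eqI iffI)
    fix i assume "i \<in> S"
    then show "i \<in> {..<n}" using assms(2)[of i n] n(1) by (meson lessThan_iff not_le)
  qed (use n in auto)
  then show ?thesis by simp
qed

text \<open>The entry at i exceeds j iff i is less than the number of parts exceeding j, and this
  number, a column length of the diagram, depends on the multiset only.\<close>

lemma pmset_inj:
  assumes "is_partition l" "is_partition m" "pmset l = pmset m"
  shows "l = m"
proof -
  have *: "i < size {#x \<in># pmset l. j < x#} \<longleftrightarrow> j < Poly_Mapping.lookup l i"
    if "is_partition l" for l i j
  proof -
    have S: "{i. j < Poly_Mapping.lookup l i} = {..<card {i. j < Poly_Mapping.lookup l i}}"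
    proof (rule down_closed_eq_lessThan)
      show "finite {i. j < Poly_Mapping.lookup l i}"
        by (rule finite_subset[of _ "Poly_Mapping.keys l"]) (auto simp: in_keys_iff)
      show "i' \<in> {i. j < Poly_Mapping.lookup l i}"
        if "i \<in> {i. j < Poly_Mapping.lookup l i}" "i' \<le> i" for i i'
        using antimonoD[OF \<open>is_partition l\<close>[unfolded is_partition_def] that(2)] that(1) by simp
    qed
    have "size {#x \<in># pmset l. j < x#} = card {i \<in> Poly_Mapping.keys l. j < Poly_Mapping.lookup l i}"
      by (simp add: pmset_def filter_mset_image_mset)
    also have "{i \<in> Poly_Mapping.keys l. j < Poly_Mapping.lookup l i} = {i. j < Poly_Mapping.lookup l i}"
      by (auto simp: in_keys_iff)
    finally show ?thesis using S by (metis lessThan_iff mem_Collect_eq)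
  qed
  have "j < Poly_Mapping.lookup l i \<longleftrightarrow> j < Poly_Mapping.lookup m i" for i j
    using *[OF assms(1), of i j] *[OF assms(2), of i j] assms(3) by simp
  then show ?thesis
    by (intro poly_mapping_eqI antisym) (meson leI less_irrefl)+
qed

definition power_sums :: "nat multiset \<Rightarrow> 'a::comm_ring_1 symfun" where
  "power_sums M = (\<Prod>k\<in>#M. power_sum k)"

lemma power_sum_part_eq: "power_sum_part l = power_sums (pmset l)"
  by (simp add: power_sum_part_def power_sums_def pmset_def prod_unfold_prod_mset multiset.map_comp comp_def)

lemma power_sums_simps [simp]:
  "power_sums {#} = 1" "power_sums (add_mset k M) = power_sum k * power_sums M"
  by (simp_all add: power_sums_def)

definition zeta :: "nat multiset \<Rightarrow> nat" where
  "zeta M = (\<Prod>k\<in>#M. k) * (\<Prod>k\<in>set_mset M. fact (count M k))"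

lemma zeta_empty [simp]: "zeta {#} = 1"
  by (simp add: zeta_def)

lemma zeta_add_mset: "zeta (add_mset k M) = zeta M * (k * Suc (count M k))"
proof -
  have "(\<Prod>j\<in>set_mset (add_mset k M). fact (count (add_mset k M) j)) =
      (fact (Suc (count M k)) :: nat) * (\<Prod>j\<in>set_mset M - {k}. fact (count M j))"
    by (simp add: prod.insert_remove)
  moreover have "(\<Prod>j\<in>set_mset M. fact (count M j)) =
      (fact (count M k) :: nat) * (\<Prod>j\<in>set_mset M - {k}. fact (count M j))"
    by (cases "k \<in># M") (simp_all add: prod.remove not_in_iff)
  ultimately show ?thesis unfolding zeta_def by (simp add: algebra_simps)
qed

lemma zeta_pos: "0 \<notin># M \<Longrightarrow> zeta M > 0"
  by (induction M) (auto simp: zeta_add_mset)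

lemma z_part_eq: "z_part l = zeta (pmset l)"
proof -
  have set: "set_mset (pmset l) = Poly_Mapping.range l"
    by (auto simp: pmset_def range.rep_eq in_keys_iff)
  have "multiplicity_part n l = count (pmset l) n" if "n \<in> Poly_Mapping.range l" for n
  proof -
    have "n \<noteq> 0" using that by (simp add: range.rep_eq)
    then have "{i. Poly_Mapping.lookup l i = n} = {i \<in> Poly_Mapping.keys l. Poly_Mapping.lookup l i = n}"
      by (auto simp: in_keys_iff)
    then show ?thesis
      by (simp add: multiplicity_part_def pmset_def count_image_mset' eq_commute[of n])
  qed
  then have "z_part l = (\<Prod>n\<in>set_mset (pmset l). n ^ count (pmset l) n * fact (count (pmset l) n))"
    unfolding z_part_def set by simp
  then show ?thesis
    by (simp add: zeta_def prod_mset_multiplicity prod.distrib)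
qed

section \<open>Taylor coefficients in the power sums\<close>

definition pders :: "nat multiset \<Rightarrow> 'a::comm_ring_1 symfun \<Rightarrow> 'a symfun" where
  "pders M f = fold_mset pperp f M"

interpretation pperp: comp_fun_commute "pperp :: nat \<Rightarrow> 'a::comm_ring_1 symfun \<Rightarrow> 'a symfun"
  by standard (auto simp: fun_eq_iff pperp_commute)

lemma pders_empty [simp]: "pders {#} f = f"
  by (simp add: pders_def)

lemma pders_add_mset: "pders (add_mset k M) f = pders M (pperp k f)"
  by (simp add: pders_def pperp.fold_mset_fun_left_comm)

text \<open>As \<open>pperp k\<close> is k times the derivative by p_k, this is
  \<open>zeta M\<close> times the coefficient of \<open>power_sums M\<close> in the power sum
  expansion.\<close>

definition pcoeff :: "nat multiset \<Rightarrow> 'a::comm_ring_1 symfun \<Rightarrow> 'a" where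
  "pcoeff M f = sym_coeff (pders M f) 0"

lemma pcoeff_empty [simp]: "pcoeff {#} f = sym_coeff f 0"
  by (simp add: pcoeff_def)

lemma pcoeff_add_mset [simp]: "pcoeff (add_mset k M) f = pcoeff M (pperp k f)"
  by (simp add: pcoeff_def pders_add_mset)

lemma pcoeff_add: "pcoeff M (f + g) = pcoeff M f + pcoeff M g"
  by (induction M arbitrary: f g) (simp_all add: pperp_add sym_coeff_add)

lemma pcoeff_scale: "pcoeff M (sym_scale c f) = c * pcoeff M f"
  by (induction M arbitrary: f) (simp_all add: pperp_scale sym_coeff_scale)

lemma pcoeff_zero [simp]: "pcoeff M 0 = 0"
  by (induction M) simp_all

lemma pcoeff_diff: "pcoeff M (f - g) = pcoeff M f - pcoeff M g"
  by (induction M arbitrary: f g) (simp_all add: pperp_diff sym_coeff_diff)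

lemma pcoeff_sum: "pcoeff M (\<Sum>i\<in>A. f i) = (\<Sum>i\<in>A. pcoeff M (f i))"
  by (induction A rule: infinite_finite_induct) (simp_all add: pcoeff_add)

lemma pperp_0 [simp]: "pperp 0 f = 0"
  by (simp add: pperp.simps[of 0])

lemma pperp_eq_0: "deg_le d f \<Longrightarrow> d < k \<Longrightarrow> pperp k f = 0"
proof (induction k arbitrary: d f rule: less_induct)
  case (less k)
  have "pperp i (hperp (k - i) f) = 0" if "i \<in> {1..<k}" for i
  proof (cases "d < k - i")
    case False
    then have "i < k" "d - (k - i) < i" using that less.prems by auto
    then show ?thesis using less.IH[OF _ deg_le_hperp[OF less.prems(1)]] by blast
  qed (simp add: hperp_eq_0[OF less.prems(1)])
  then show ?case
    unfolding pperp.simps[of k] by (simp add: hperp_eq_0[OF less.prems])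
qed

lemma pcoeff_eq_0:
  "deg_le d f \<Longrightarrow> 0 \<in># M \<or> d < sum_mset M \<Longrightarrow> pcoeff M f = 0"
proof (induction M arbitrary: d f)
  case (add k M)
  show ?case
  proof (cases "k = 0 \<or> d < k")
    case True
    then have "pperp k f = 0" using pperp_eq_0[OF add.prems(1)] by auto
    then show ?thesis by simp
  next
    case False
    then have "pcoeff M (pperp k f) = 0"
      using add.prems by (intro add.IH[of "d - k"] deg_le_pperp) auto
    then show ?thesis by simp
  qed
qed auto

text \<open>Leibniz rule: any one of the \<open>count M k\<close> derivatives by p_k can hit the
  factor, with value k, and all others annihilate it. For k outside of M both sides are 0.\<close>

lemma pcoeff_power_sum_mult:
  assumes "k \<ge> 1"
  shows "pcoeff M (power_sum k * f) = of_nat (k * count M k) * pcoeff (M - {#k#}) f"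
proof (induction M arbitrary: f)
  case empty
  have "\<not> (\<exists>i. (0 :: nat \<Rightarrow>\<^sub>0 nat) = Poly_Mapping.single i k)"
    using assms by (metis lookup_single_eq lookup_zero not_one_le_zero)
  then show ?case by (simp add: sym_coeff_mult_0 sym_coeff_power_sum)
next
  case (add j M)
  have eq: "pcoeff (add_mset j M) (power_sum k * f) =
      pcoeff M (pperp j (power_sum k) * f) + pcoeff M (power_sum k * pperp j f)"
    by (simp add: pperp_mult pcoeff_add)
  show ?case
  proof (cases "j = k")
    case True
    have "of_nat (k * count M k) * pcoeff (M - {#k#}) (pperp k f) = of_nat (k * count M k) * pcoeff M f"
    proof (cases "k \<in># M")
      case True
      then obtain L where "M = add_mset k L" by (metis insert_DiffM)
      then show ?thesis by simp
    qed (simp add: not_in_iff)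
    moreover have "pcoeff M (of_nat k * f) = of_nat k * pcoeff M f"
      by (simp add: of_nat_symfun pcoeff_scale)
    ultimately show ?thesis
      unfolding eq using True assms
      by (simp add: add.IH pperp_power_sum) (simp add: algebra_simps)
  next
    case False
    then have "add_mset j M - {#k#} = add_mset j (M - {#k#})" by simp
    then show ?thesis
      unfolding eq using False assms by (simp add: add.IH pperp_power_sum)
  qed
qed

lemma pcoeff_power_sums:
  assumes "0 \<notin># L"
  shows "pcoeff M (power_sums L) = (if M = L then of_nat (zeta L) else 0)"
  using assms
proof (induction L arbitrary: M)
  case empty
  then show ?case by (induction M) (auto simp: sym_coeff_one)
next
  case (add k L)
  then have k: "k \<ge> 1" by auto
  show ?case
  proof (cases "k \<in># M")
    case True
    then obtain M' where "M = add_mset k M'" by (metis insert_DiffM)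
    then show ?thesis
      using add k by (simp add: pcoeff_power_sum_mult zeta_add_mset del: pcoeff_add_mset)
  next
    case False
    then show ?thesis using k by (auto simp: pcoeff_power_sum_mult not_in_iff)
  qed
qed

text \<open>The derivatives of f have smaller degree and again vanishing Taylor coefficients, so
  they are 0 by induction on the degree; then f is constant, with value \<open>pcoeff {#} f\<close>.
  Both the spanning property of the power sums and the nondegeneracy of the form rest on
  this.\<close>

lemma eq_0_if_pcoeff_eq_0:
  fixes f :: "'a::field_char_0 symfun"
  assumes "\<And>M. pcoeff M f = 0"
  shows "f = 0"
proof -
  have "deg_le d f \<Longrightarrow> (\<And>M. pcoeff M f = 0) \<Longrightarrow> f = 0" for d
  proof (induction d arbitrary: f rule: less_induct)
    case (less d)
    have "pperp k f = 0" if "k \<ge> 1" for k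
    proof (cases "d < k")
      case False
      show ?thesis
        by (rule less.IH[of "d - k"])
           (use that False less.prems(2)[of "add_mset k M" for M] in \<open>auto intro!: deg_le_pperp less.prems(1)\<close>)
    qed (use pperp_eq_0[OF less.prems(1)] in auto)
    then have "hperp k f = 0" if "k \<ge> 1" for k
      using that by (intro hperp_eq_0_if_pperp_eq_0) auto
    then have "f = sym_scale (sym_coeff f 0) 1" by (rule eq_const_if_hperp_eq_0)
    also have "sym_coeff f 0 = 0" using less.prems(2)[of "{#}"] by simp
    finally show ?case by simp
  qed
  then show ?thesis using assms ex_deg_le by blast
qed

definition pexps :: "nat \<Rightarrow> nat multiset set" where
  "pexps N = {M. 0 \<notin># M \<and> sum_mset M \<le> N}"

lemma finite_pexps: "finite (pexps N)"
proof (rule finite_subset)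
  have "set xs \<subseteq> {..sum_mset (mset xs)} \<and> (0 \<notin> set xs \<longrightarrow> length xs \<le> sum_mset (mset xs))" for xs :: "nat list"
    by (induction xs) auto
  note * = this
  show "pexps N \<subseteq> mset ` {xs. set xs \<subseteq> {..N} \<and> length xs \<le> N}"
  proof
    fix M assume M: "M \<in> pexps N"
    obtain xs where xs: "mset xs = M" using ex_mset by blast
    show "M \<in> mset ` {xs. set xs \<subseteq> {..N} \<and> length xs \<le> N}"
      using M *[of xs] xs by (intro image_eqI[of _ _ xs]) (auto simp: pexps_def)
  qed
  show "finite (mset ` {xs. set xs \<subseteq> {..N} \<and> length xs \<le> N})"
    by (intro finite_imageI finite_lists_length_le) auto
qed

lemma power_sum_expansion:
  fixes f :: "'a::field_char_0 symfun"
  assumes "deg_le N f"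
  shows "f = (\<Sum>M\<in>pexps N. sym_scale (pcoeff M f / of_nat (zeta M)) (power_sums M))"
proof -
  let ?g = "\<Sum>M\<in>pexps N. sym_scale (pcoeff M f / of_nat (zeta M)) (power_sums M)"
  have "pcoeff L (f - ?g) = 0" for L
  proof -
    have "pcoeff L ?g = (\<Sum>M\<in>pexps N. if M = L then pcoeff L f else 0)"
      unfolding pcoeff_sum pcoeff_scale
    proof (rule sum.cong[OF refl])
      fix M assume "M \<in> pexps N"
      then have "0 \<notin># M" by (simp add: pexps_def)
      then show "pcoeff M f / of_nat (zeta M) * pcoeff L (power_sums M) = (if M = L then pcoeff L f else 0)"
        using zeta_pos[of M] by (auto simp: pcoeff_power_sums)
    qed
    also have "\<dots> = (if L \<in> pexps N then pcoeff L f else 0)"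
      using finite_pexps by simp
    also have "\<dots> = pcoeff L f"
      using pcoeff_eq_0[OF assms, of L] by (auto simp: pexps_def)
    finally show ?thesis by (simp add: pcoeff_diff)
  qed
  then have "f - ?g = 0" by (rule eq_0_if_pcoeff_eq_0)
  then show ?thesis by simp
qed


section \<open>The scalar product\<close>

text \<open>Since \<open>pcoeff L\<close> of p_L is already \<open>zeta L\<close>, a single division
  leaves \<open>zeta L\<close> times the product of the \<open>c k\<close> as the norm of
  p_L.\<close>

definition pweight :: "(nat \<Rightarrow> 'a::field_char_0) \<Rightarrow> nat multiset \<Rightarrow> 'a" where
  "pweight c M = (\<Prod>k\<in>#M. c k) / of_nat (zeta M)"

text \<open>The sum is finite because \<open>pcoeff M f\<close> vanishes outside of \<open>pexps N\<close> if \<open>f\<close> has degree \<open>N\<close>.\<close>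

definition pform :: "(nat \<Rightarrow> 'a::field_char_0) \<Rightarrow> 'a symfun \<Rightarrow> 'a symfun \<Rightarrow> 'a" where
  "pform c f g = (\<Sum>M | pcoeff M f \<noteq> 0. pweight c M * pcoeff M f * pcoeff M g)"

lemma pform_eq:
  assumes "deg_le N f"
  shows "pform c f g = (\<Sum>M\<in>pexps N. pweight c M * pcoeff M f * pcoeff M g)"
  unfolding pform_def
proof (rule sum.mono_neutral_left)
  show "{M. pcoeff M f \<noteq> 0} \<subseteq> pexps N"
  proof
    fix M assume "M \<in> {M. pcoeff M f \<noteq> 0}"
    then show "M \<in> pexps N" using pcoeff_eq_0[OF assms, of M] by (force simp: pexps_def not_le)
  qed
qed (auto simp: finite_pexps)

lemma ex_common_degree:
  obtains N where "deg_le N f" "deg_le N g"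
  using ex_deg_le[of f] ex_deg_le[of g] by (meson deg_le_mono max.cobounded1 max.cobounded2)

lemma pform_commute: "pform c f g = pform c g f"
proof -
  obtain N where "deg_le N f" "deg_le N g" by (rule ex_common_degree)
  then show ?thesis by (simp add: pform_eq mult_ac)
qed

lemma pform_add_right: "pform c f (g + h) = pform c f g + pform c f h"
  by (simp add: pform_def pcoeff_add distrib_left sum.distrib)

lemma pform_scale_right: "pform c f (sym_scale a g) = a * pform c f g"
  by (simp add: pform_def pcoeff_scale sum_distrib_left mult_ac)

lemma pform_add_left: "pform c (f + g) h = pform c f h + pform c g h"
  by (simp add: pform_commute[of c _ h] pform_add_right)

lemma pform_scale_left: "pform c (sym_scale a f) g = a * pform c f g"
  by (simp add: pform_commute[of c _ g] pform_scale_right)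

lemma pform_zero_right [simp]: "pform c f 0 = 0"
  using pform_scale_right[of c f 0 0] by simp

lemma pform_zero_left [simp]: "pform c 0 f = 0"
  by (simp add: pform_commute[of c 0])

lemma pform_diff_right: "pform c f (g - h) = pform c f g - pform c f h"
  using pform_add_right[of c f "g - h" h] by simp

lemma pform_diff_left: "pform c (f - g) h = pform c f h - pform c g h"
  by (simp add: pform_commute[of c _ h] pform_diff_right)

lemma pform_sum_left: "pform c (\<Sum>i\<in>A. g i) f = (\<Sum>i\<in>A. pform c (g i) f)"
  by (induction A rule: infinite_finite_induct) (simp_all add: pform_add_left)

lemma pform_power_sums:
  assumes "0 \<notin># L"
  shows "pform c f (power_sums L) = (\<Prod>k\<in>#L. c k) * pcoeff L f"
proof -
  obtain N where N: "deg_le N f" using ex_deg_le by blast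
  have "pform c f (power_sums L) =
      (\<Sum>M\<in>pexps N. if M = L then (\<Prod>k\<in>#L. c k) * pcoeff L f else 0)"
    unfolding pform_eq[OF N]
    using zeta_pos[OF assms] assms by (intro sum.cong) (auto simp: pcoeff_power_sums pweight_def)
  also have "\<dots> = (if L \<in> pexps N then (\<Prod>k\<in>#L. c k) * pcoeff L f else 0)"
    by (simp add: finite_pexps)
  also have "\<dots> = (\<Prod>k\<in>#L. c k) * pcoeff L f"
    using pcoeff_eq_0[OF N, of L] by (auto simp: pexps_def)
  finally show ?thesis .
qed

lemma pform_power_sums_both:
  assumes "0 \<notin># L" "0 \<notin># M"
  shows "pform c (power_sums L) (power_sums M) =
    (if L = M then of_nat (zeta L) * (\<Prod>k\<in>#L. c k) else 0)"
  using assms by (auto simp: pform_power_sums pcoeff_power_sums)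

lemma pform_nondegenerate:
  assumes "\<And>k. k \<ge> 1 \<Longrightarrow> c k \<noteq> 0" and "\<And>g. pform c f g = 0"
  shows "f = 0"
proof (rule eq_0_if_pcoeff_eq_0)
  fix L
  obtain N where N: "deg_le N f" using ex_deg_le by blast
  show "pcoeff L f = 0"
  proof (cases "0 \<in># L")
    case False
    then have "(\<Prod>k\<in>#L. c k) * pcoeff L f = 0"
      using assms(2)[of "power_sums L"] by (simp add: pform_power_sums)
    moreover have "c k \<noteq> 0" if "k \<in># L" for k
      using that False by (intro assms(1)) (metis One_nat_def Suc_leI bot_nat_0.not_eq_extremum)
    ultimately show ?thesis by (auto simp: prod_mset_zero_iff)
  qed (use pcoeff_eq_0[OF N] in auto)
qed

lemma deg_le_power_sum: "deg_le k (power_sum k)"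
  unfolding deg_le_def sym_coeff_power_sum by (auto simp: weight_def split: if_splits)

text \<open>Only the multisets \<open>add_mset k L\<close> contribute. There the factor
  \<open>w\<close> from the Leibniz rule cancels against the growth of \<open>zeta\<close>, and one
  factor \<open>c k\<close> is left over.\<close>

lemma pform_power_sum_mult:
  assumes "k \<ge> 1"
  shows "pform c (power_sum k * f) g = c k * pform c f (pperp k g)"
proof -
  obtain N where N: "deg_le N f" using ex_deg_le by blast
  have deg: "deg_le (k + N) (power_sum k * f)"
    by (intro deg_le_mult deg_le_power_sum N)
  have "pform c (power_sum k * f) g =
      (\<Sum>M\<in>pexps (k + N). pweight c M * pcoeff M (power_sum k * f) * pcoeff M g)"
    by (rule pform_eq[OF deg])
  also have "\<dots> = (\<Sum>M\<in>add_mset k ` pexps N. pweight c M * pcoeff M (power_sum k * f) * pcoeff M g)"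
  proof (rule sum.mono_neutral_right)
    show "\<forall>M\<in>pexps (k + N) - add_mset k ` pexps N. pweight c M * pcoeff M (power_sum k * f) * pcoeff M g = 0"
    proof
      fix M assume M: "M \<in> pexps (k + N) - add_mset k ` pexps N"
      have "k \<notin># M"
      proof
        assume "k \<in># M"
        then obtain L where L: "M = add_mset k L" by (metis insert_DiffM)
        with M have "L \<in> pexps N" by (auto simp: pexps_def)
        with M L show False by auto
      qed
      then show "pweight c M * pcoeff M (power_sum k * f) * pcoeff M g = 0"
        using assms by (simp add: pcoeff_power_sum_mult not_in_iff)
    qed
  qed (use assms finite_pexps[of "k + N"] in \<open>auto simp: pexps_def\<close>)
  also have "\<dots> = (\<Sum>L\<in>pexps N. pweight c (add_mset k L) * pcoeff (add_mset k L) (power_sum k * f)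
      * pcoeff (add_mset k L) g)"
    by (subst sum.reindex) (auto simp: inj_on_def)
  also have "\<dots> = (\<Sum>L\<in>pexps N. c k * (pweight c L * pcoeff L f * pcoeff L (pperp k g)))"
  proof (rule sum.cong[OF refl])
    fix L assume "L \<in> pexps N"
    then have z: "of_nat (zeta L) \<noteq> (0 :: 'a)" using zeta_pos[of L] by (simp add: pexps_def)
    define w :: 'a where "w = of_nat (k * Suc (count L k))"
    have w: "w \<noteq> 0" unfolding w_def of_nat_eq_0_iff using assms by simp
    have 1: "pcoeff (add_mset k L) (power_sum k * f) = w * pcoeff L f"
      using assms by (simp add: pcoeff_power_sum_mult w_def del: pcoeff_add_mset)
    have e: "pweight c (add_mset k L) = c k * (\<Prod>k\<in>#L. c k) / (of_nat (zeta L) * w)"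
      by (simp only: pweight_def zeta_add_mset of_nat_mult[of "zeta L"] w_def image_mset_add_mset prod_mset.add_mset)
    have 2: "pweight c (add_mset k L) * w = c k * pweight c L"
      unfolding e using z w by (simp add: pweight_def)
    have "pweight c (add_mset k L) * pcoeff (add_mset k L) (power_sum k * f) * pcoeff (add_mset k L) g =
        (pweight c (add_mset k L) * w) * pcoeff L f * pcoeff (add_mset k L) g"
      unfolding 1 by (simp only: mult.assoc)
    then show "pweight c (add_mset k L) * pcoeff (add_mset k L) (power_sum k * f)
        * pcoeff (add_mset k L) g = c k * (pweight c L * pcoeff L f * pcoeff L (pperp k g))"
      unfolding 2 by (simp add: mult.assoc)
  qed
  also have "\<dots> = c k * pform c f (pperp k g)"
    by (simp add: pform_eq[OF N] sum_distrib_left)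
  finally show ?thesis .
qed

lemma linear_eq_on_power_sums:
  fixes \<phi> \<psi> :: "'a::field_char_0 symfun \<Rightarrow> 'a"
  assumes "\<And>f g. \<phi> (f + g) = \<phi> f + \<phi> g" "\<And>c f. \<phi> (sym_scale c f) = c * \<phi> f"
    and "\<And>f g. \<psi> (f + g) = \<psi> f + \<psi> g" "\<And>c f. \<psi> (sym_scale c f) = c * \<psi> f"
    and "\<And>M. 0 \<notin># M \<Longrightarrow> \<phi> (power_sums M) = \<psi> (power_sums M)"
  shows "\<phi> f = \<psi> f"
proof -
  have zero: "\<phi> 0 = 0" "\<psi> 0 = 0"
    using assms(2)[of 0 0] assms(4)[of 0 0] by simp_all
  have "\<phi> (\<Sum>M\<in>A. sym_scale (x M) (power_sums M)) = \<psi> (\<Sum>M\<in>A. sym_scale (x M) (power_sums M))"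
    if "\<And>M. M \<in> A \<Longrightarrow> 0 \<notin># M" for A x
    using that by (induction A rule: infinite_finite_induct) (auto simp: zero assms)
  note * = this
  obtain N where N: "deg_le N f" using ex_deg_le by blast
  have "\<phi> (\<Sum>M\<in>pexps N. sym_scale (pcoeff M f / of_nat (zeta M)) (power_sums M)) =
      \<psi> (\<Sum>M\<in>pexps N. sym_scale (pcoeff M f / of_nat (zeta M)) (power_sums M))"
    by (rule *) (simp add: pexps_def)
  then show ?thesis by (simp only: power_sum_expansion[OF N, symmetric])
qed

lemma qshift_one: "qshift q n 1 = (if n = 0 then 1 else 0)"
proof (induction n rule: less_induct)
  case (less n)
  then have "(\<Sum>i<n. hperp (n - i) (qshift q i 1)) = 0"
    by (intro sum.neutral) (auto simp: hperp_one)
  then show ?case by (simp add: qshift.simps[of q n] hperp_one)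
qed

text \<open>
  The hypothesis on \<open>c\<close> says that, for this scalar product, multiplication with the generating
  function of \<open>gfun s\<close> at \<open>w\<close> is adjoint to \<open>f \<mapsto> f[X + (q - 1) s w]\<close>.
\<close>

lemma pform_gfun_mult:
  assumes c: "\<And>k. k \<ge> 1 \<Longrightarrow> c k * (1 - s ^ k) = s ^ k * (q ^ k - 1)"
  shows "pform c (gfun s (int n) * f) g = s ^ n * pform c f (qshift q n g)"
proof -
  have "pform c (gfun s (int n) * f) (power_sums L) = s ^ n * pform c f (qshift q n (power_sums L))"
    if "0 \<notin># L" for L
    using that
  proof (induction L arbitrary: n f)
    case empty
    have one: "pform c f 1 = sym_coeff f 0" for f
      using pform_power_sums[of "{#}" c f] by simp
    show ?case by (simp add: one sym_coeff_mult_0 sym_coeff_gfun qshift_one)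
  next
    case (add k L)
    then have k: "k \<ge> 1" by auto
    let ?g = "power_sums L"
    have IH: "pform c (gfun s (int m) * h) ?g = s ^ m * pform c h (qshift q m ?g)" for m h
      using add by simp
    have adj: "pform c h (power_sum k * g) = c k * pform c (pperp k h) g" for g h
      using pform_power_sum_mult[OF k] by (metis pform_commute)
    have shift: "qshift q n (power_sum k * ?g) =
        power_sum k * qshift q n ?g + (if k \<le> n then sym_scale (q ^ k - 1) (qshift q (n - k) ?g) else 0)"
    proof -
      have "qshift q n (power_sum k * ?g) = (\<Sum>i\<le>n. (if i = 0 then power_sum k * qshift q n ?g else 0)
          + (if i = k then sym_scale (q ^ k - 1) (qshift q (n - k) ?g) else 0))"
        unfolding qshift_mult using k by (intro sum.cong) (auto simp: qshift_power_sum)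
      then show ?thesis by (simp add: sum.distrib)
    qed
    have "pform c (gfun s (int n) * f) (power_sum k * ?g) =
        c k * ((1 - s ^ k) * pform c (gfun s (int n - int k) * f) ?g + pform c (gfun s (int n) * pperp k f) ?g)"
      unfolding adj by (simp add: pperp_mult pperp_gfun[OF k] pform_add_left pform_scale_left)
    also have "(1 - s ^ k) * pform c (gfun s (int n - int k) * f) ?g =
        (if k \<le> n then (1 - s ^ k) * s ^ (n - k) * pform c f (qshift q (n - k) ?g) else 0)"
    proof (cases "k \<le> n")
      case True
      then have "gfun s (int n - int k) = gfun s (int (n - k))" by (simp add: of_nat_diff)
      then show ?thesis using True by (simp only: IH) simp
    next
      case False
      then have "gfun s (int n - int k) = 0"
        by (intro symfun_eqI) (auto simp: sym_coeff_gfun)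
      then show ?thesis using False by simp
    qed
    also have "c k * (\<dots> + pform c (gfun s (int n) * pperp k f) ?g) =
        (if k \<le> n then s ^ n * (q ^ k - 1) * pform c f (qshift q (n - k) ?g) else 0)
        + s ^ n * (c k * pform c (pperp k f) (qshift q n ?g))"
    proof -
      \<comment> \<open>The hypothesis on \<open>c\<close> turns the effect of
        \<open>pperp k\<close> on the generating function into the constant q^k - 1 by which the
        shift changes p_k.\<close>
      have "c k * ((1 - s ^ k) * s ^ (n - k)) = s ^ n * (q ^ k - 1)" if "k \<le> n"
      proof -
        have "s ^ n = s ^ k * s ^ (n - k)" using that by (simp add: power_add[symmetric])
        then show ?thesis using c[OF k] by (simp add: mult_ac)
      qed
      then show ?thesis by (simp add: IH distrib_left)
    qed
    also have "\<dots> = s ^ n * pform c f (qshift q n (power_sum k * ?g))"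
      unfolding shift by (cases "k \<le> n") (simp_all add: pform_add_right adj pform_scale_right distrib_left mult.assoc)
    finally show ?case by simp
  qed
  then show ?thesis
    by (rule linear_eq_on_power_sums[where \<phi> = "pform c (gfun s (int n) * f)"
          and \<psi> = "\<lambda>g. s ^ n * pform c f (qshift q n g)", rotated 4])
       (simp_all only: pform_add_right pform_scale_right qshift_add qshift_scale distrib_left mult.left_commute not_False_eq_True)
qed

text \<open>\<open>macop\<close> depends on a degree bound, but all valid bounds give the same value
  (\<open>mac_H_eq\<close>). Choosing one gives a linear operator on the whole ring.\<close>

definition mac_H :: "'a::comm_ring_1 \<Rightarrow> 'a \<Rightarrow> 'a symfun \<Rightarrow> 'a symfun" where
  "mac_H s q f = macop (SOME d. deg_le d f) s q 0 f"

lemma mac_H_eq: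
  assumes "deg_le N f"
  shows "mac_H s q f = macop N s q 0 f"
proof -
  define d where "d = (SOME d. deg_le d f)"
  have "deg_le d f" unfolding d_def using ex_deg_le by (rule someI_ex)
  then have "macop d s q 0 f = macop (max d N) s q 0 f"
    using macop_mono[of d f "max d N"] by simp
  also have "\<dots> = macop N s q 0 f"
    using macop_mono[OF assms, of "max d N"] by simp
  finally show ?thesis by (simp add: mac_H_def d_def)
qed

lemma mac_H_add: "mac_H s q (f + g) = mac_H s q f + mac_H s q g"
proof -
  obtain N where "deg_le N f" "deg_le N g" by (rule ex_common_degree)
  then show ?thesis by (simp add: mac_H_eq[of N] deg_le_add macop_add)
qed

lemma mac_H_scale: "mac_H s q (sym_scale c f) = sym_scale c (mac_H s q f)"
proof -
  obtain N where "deg_le N f" using ex_deg_le by blast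
  then show ?thesis by (simp add: mac_H_eq[of N] deg_le_scale macop_scale)
qed

lemma mac_H_zero [simp]: "mac_H s q 0 = 0"
  using mac_H_scale[of s q 0 0] by simp

lemma mac_H_diff: "mac_H s q (f - g) = mac_H s q f - mac_H s q g"
  using mac_H_add[of s q "f - g" g] by simp

lemma mac_H_sum: "mac_H s q (\<Sum>i\<in>A. f i) = (\<Sum>i\<in>A. mac_H s q (f i))"
  by (induction A rule: infinite_finite_induct) (simp_all add: mac_H_add)

text \<open>Moved to the other side, \<open>gfun s m\<close> becomes s^m times
  \<open>qshift q m\<close>. The form is then a sum of s^m times the forms of
  \<open>qshift q m f\<close> and \<open>qshift q m g\<close>, which is symmetric in f and
  g.\<close>

lemma mac_H_self_adjoint:
  assumes c: "\<And>k. k \<ge> 1 \<Longrightarrow> c k * (1 - s ^ k) = s ^ k * (q ^ k - 1)"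
  shows "pform c (mac_H s q f) g = pform c f (mac_H s q g)"
proof -
  obtain N where N: "deg_le N f" "deg_le N g" by (rule ex_common_degree)
  have *: "pform c (macop N s q 0 f) g = (\<Sum>m\<le>N. s ^ m * pform c (qshift q m f) (qshift q m g))" for f g
    by (simp add: macop_def pform_sum_left pform_gfun_mult[OF c])
  have "pform c (macop N s q 0 f) g = pform c (macop N s q 0 g) f"
    unfolding * by (simp add: pform_commute[of c "qshift q m f" for m])
  then show ?thesis using N by (simp add: mac_H_eq[of N] pform_commute)
qed


section \<open>Triangularity\<close>

lemma sum_antimono_le:
  fixes f :: "nat \<Rightarrow> nat"
  assumes "antimono f" "finite A"
  shows "sum f A \<le> sum f {..<card A}"
  using assms(2)
proof (induction A rule: finite_linorder_max_induct)
  case (insert b A)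
  have "card A \<le> card {..<b}" using insert.hyps by (intro card_mono) auto
  then have "f b \<le> f (card A)" using antimonoD[OF assms(1)] by simp
  moreover have "b \<notin> A" using insert.hyps by auto
  ultimately show ?case using insert by (simp add: add.commute add_mono)
qed simp

text \<open>The first k entries of a rearrangement are entries of the partition at k distinct
  positions, hence at most its k largest.\<close>

lemma psum_rearrangement_le:
  assumes "is_partition l" "rearrangement l a"
  shows "psum a k \<le> psum l k"
proof -
  obtain \<sigma> where \<sigma>: "bij \<sigma>" "a = Poly_Mapping.map_key \<sigma> l"
    using assms(2) by (auto simp: rearrangement_def)
  have inj: "inj_on \<sigma> {..<k}" using bij_is_inj[OF \<sigma>(1)] inj_on_subset by blast
  then have "psum a k = sum (Poly_Mapping.lookup l) (\<sigma> ` {..<k})"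
    using \<sigma> by (simp add: sum.reindex lookup_map_key_bij)
  also have "\<dots> \<le> psum l (card (\<sigma> ` {..<k}))"
    using assms(1) by (intro sum_antimono_le) (auto simp: is_partition_def)
  finally show ?thesis using inj by (simp add: card_image)
qed

lemma weight_rearrangement: "rearrangement l a \<Longrightarrow> weight a = weight l"
  by (auto simp: rearrangement_def weight_map_key)

lemma dominated_refl [simp]: "dominated l l"
  by (simp add: dominated_def)

lemma dominated_trans: "dominated l m \<Longrightarrow> dominated m n \<Longrightarrow> dominated l n"
  unfolding dominated_def using le_trans by metis

lemma dominated_antisym: "dominated l m \<Longrightarrow> dominated m l \<Longrightarrow> l = m"
  unfolding dominated_def by (intro psum_eqD antisym) auto

lemma sym_coeff_monomial: "sym_coeff (monomial_sym l) a = (if rearrangement l a then 1 else 0)"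
  by (simp add: monomial_sym.rep_eq)

lemma rearrangement_refl [simp]: "rearrangement l l"
  unfolding rearrangement_def by (intro exI[of _ id]) (auto intro!: poly_mapping_eqI simp: lookup_map_key_bij)

lemma deg_le_monomial: "deg_le (weight l) (monomial_sym l)"
  by (auto simp: deg_le_def sym_coeff_monomial weight_rearrangement split: if_splits)

text \<open>A vector contributing at \<open>a\<close> is a rearrangement of l whose partial sums
  bound those of \<open>a\<close> and are bounded by those of l. For a = l this forces equality, so
  the diagonal lemma applies.\<close>

lemma mac_H_monomial:
  assumes l: "is_partition l"
  shows mac_H_monomial_dominated: "sym_coeff (mac_H s q (monomial_sym l)) a \<noteq> 0 \<Longrightarrow> dominated a l"
    and mac_H_monomial_diag: "sym_coeff (mac_H s q (monomial_sym l)) l = mac_ev s q l"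
proof -
  define N where "N = max (weight l) (weight a)"
  have N: "deg_le N (monomial_sym l)" by (rule deg_le_mono[OF deg_le_monomial]) (simp add: N_def)
  have dom: "weight a = weight l \<and> (\<forall>k. psum a k \<le> psum l k)"
    if "weight b = weight a" "\<And>k. psum a k \<le> psum b k" "rearrangement l b" for a b
    using that psum_rearrangement_le[OF l that(3)] weight_rearrangement[OF that(3)] le_trans by metis
  show "dominated a l" if nz: "sym_coeff (mac_H s q (monomial_sym l)) a \<noteq> 0"
  proof (rule ccontr)
    assume nd: "\<not> dominated a l"
    have "sym_coeff (macop N s q (int 0) (monomial_sym l)) a = 0"
    proof (rule sym_coeff_macop_eq_0[OF N])
      fix b assume "weight b + 0 = weight a" "\<And>k. psum a k \<le> psum b k + 0"
      then show "sym_coeff (monomial_sym l :: 'a symfun) b = 0"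
        using dom[of b a] nd by (auto simp: sym_coeff_monomial dominated_def)
    qed (simp add: N_def)
    then show False using nz by (simp add: mac_H_eq[OF N])
  qed
  have "sym_coeff (macop N s q 0 (monomial_sym l)) l = mac_ev s q l * sym_coeff (monomial_sym l) l"
  proof (rule sym_coeff_macop_diag[OF N])
    fix b assume b: "weight b = weight l" "\<And>k. psum l k \<le> psum b k" "b \<noteq> l"
    have "\<not> rearrangement l b"
    proof
      assume "rearrangement l b"
      then have "psum b k = psum l k" for k
        using b(2)[of k] psum_rearrangement_le[OF l, of b k] by simp
      then show False using psum_eqD b(3) by blast
    qed
    then show "sym_coeff (monomial_sym l :: 'a symfun) b = 0" by (simp add: sym_coeff_monomial)
  qed (simp add: N_def)
  then show "sym_coeff (mac_H s q (monomial_sym l)) l = mac_ev s q l"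
    by (simp add: mac_H_eq[OF N] sym_coeff_monomial)
qed

section \<open>Functions supported on down-closed sets of partitions\<close>

definition supp_in :: "(nat \<Rightarrow>\<^sub>0 nat) set \<Rightarrow> 'a::zero symfun \<Rightarrow> bool" where
  "supp_in S f \<longleftrightarrow> (\<forall>a. is_partition a \<longrightarrow> sym_coeff f a \<noteq> 0 \<longrightarrow> a \<in> S)"

definition down_closed :: "(nat \<Rightarrow>\<^sub>0 nat) set \<Rightarrow> bool" where
  "down_closed S \<longleftrightarrow> (\<forall>m\<in>S. is_partition m) \<and> (\<forall>m\<in>S. \<forall>a. is_partition a \<longrightarrow> dominated a m \<longrightarrow> a \<in> S)"

lemma symfun_eq_partitionI:
  assumes "\<And>a. is_partition a \<Longrightarrow> sym_coeff f a = sym_coeff g a"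
  shows "f = g"
proof (rule symfun_eqI)
  fix a
  obtain l where l: "is_partition l" "rearrangement l a" by (rule ex_partition_rearrangement)
  then have "sym_coeff f a = sym_coeff f l" "sym_coeff g a = sym_coeff g l"
    by (auto simp: rearrangement_def sym_coeff_map_key)
  then show "sym_coeff f a = sym_coeff g a" using assms[OF l(1)] by simp
qed

lemma sym_coeff_monomial_partition:
  "is_partition l \<Longrightarrow> is_partition a \<Longrightarrow> sym_coeff (monomial_sym l) a = (if a = l then 1 else 0)"
  using rearrangement_partition_unique[of l a] by (auto simp: sym_coeff_monomial)

lemma supp_in_empty: "supp_in {} f \<Longrightarrow> f = 0"
  by (rule symfun_eq_partitionI) (auto simp: supp_in_def)

lemma supp_in_add: "supp_in S f \<Longrightarrow> supp_in S g \<Longrightarrow> supp_in S (f + g)"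
  by (auto simp: supp_in_def sym_coeff_add)

lemma supp_in_diff: "supp_in S f \<Longrightarrow> supp_in S g \<Longrightarrow> supp_in S (f - g)"
  by (auto simp: supp_in_def sym_coeff_diff)

lemma supp_in_scale: "supp_in S f \<Longrightarrow> supp_in S (sym_scale c f)"
  by (auto simp: supp_in_def sym_coeff_scale)

lemma supp_in_mono: "supp_in S f \<Longrightarrow> S \<subseteq> T \<Longrightarrow> supp_in T f"
  by (auto simp: supp_in_def)

lemma supp_in_remove: "supp_in S f \<Longrightarrow> sym_coeff f m = 0 \<Longrightarrow> supp_in (S - {m}) f"
  by (auto simp: supp_in_def)

lemma supp_in_monomial: "is_partition l \<Longrightarrow> l \<in> S \<Longrightarrow> supp_in S (monomial_sym l)"
  by (auto simp: supp_in_def sym_coeff_monomial_partition split: if_splits)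

lemma supp_in_expansion:
  assumes "finite S" "\<forall>m\<in>S. is_partition m" "supp_in S f"
  shows "f = (\<Sum>m\<in>S. sym_scale (sym_coeff f m) (monomial_sym m))"
proof (rule symfun_eq_partitionI)
  fix a assume a: "is_partition a"
  have "sym_coeff (\<Sum>m\<in>S. sym_scale (sym_coeff f m) (monomial_sym m)) a =
      (\<Sum>m\<in>S. if m = a then sym_coeff f a else 0)"
    unfolding sym_coeff_sum sym_coeff_scale
    using assms a by (intro sum.cong) (auto simp: sym_coeff_monomial_partition)
  also have "\<dots> = sym_coeff f a"
    using assms a by (auto simp: supp_in_def)
  finally show "sym_coeff f a = sym_coeff (\<Sum>m\<in>S. sym_scale (sym_coeff f m) (monomial_sym m)) a" by simp
qed

text \<open>A dominance-maximal element can be removed without destroying down-closedness. Dominance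
  is only partial, so this stands in for an induction along a linear order.\<close>

lemma down_closed_induct [consumes 2, case_names empty remove]:
  assumes "finite S" "down_closed S" "P {}"
    and step: "\<And>S m. \<lbrakk>finite S; down_closed S; m \<in> S; down_closed (S - {m}); P (S - {m})\<rbrakk> \<Longrightarrow> P S"
  shows "P S"
  using assms(1,2)
proof (induction "card S" arbitrary: S)
  case 0
  then show ?case using assms(3) by simp
next
  case (Suc n)
  let ?R = "\<lambda>a b. dominated a b \<and> a \<noteq> b"
  have "S \<noteq> {}" using Suc.hyps(2) by auto
  moreover have "asymp_on S ?R" "transp_on S ?R"
    by (auto intro!: asymp_onI transp_onI intro: dominated_trans dest: dominated_antisym)
  ultimately obtain m where m: "m \<in> S" "\<And>a. a \<in> S \<Longrightarrow> a \<noteq> m \<Longrightarrow> \<not> dominated m a"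
    using Finite_Set.bex_max_element[OF Suc.prems(1), of ?R] by metis
  have "down_closed (S - {m})"
    using Suc.prems(2) m(2) unfolding down_closed_def by blast
  moreover have "P (S - {m})"
    using Suc calculation m(1) by (intro Suc.hyps(1)) auto
  ultimately show ?case using step[OF Suc.prems m(1)] by blast
qed

definition lower :: "(nat \<Rightarrow>\<^sub>0 nat) \<Rightarrow> (nat \<Rightarrow>\<^sub>0 nat) set" where
  "lower l = {m. is_partition m \<and> dominated m l \<and> m \<noteq> l}"

lemma down_closed_lower: "down_closed (lower l)"
  unfolding down_closed_def lower_def using dominated_trans dominated_antisym by blast

lemma finite_lower: "finite (lower l)"
  unfolding lower_def by (rule finite_dominated)

lemma lower_subset: "down_closed S \<Longrightarrow> m \<in> S \<Longrightarrow> lower m \<subseteq> S - {m}"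
  unfolding down_closed_def lower_def by blast

lemma supp_in_mac_H_monomial:
  assumes "is_partition l"
  shows "supp_in (lower l) (mac_H s q (monomial_sym l) - sym_scale (mac_ev s q l) (monomial_sym l))"
  unfolding supp_in_def
proof (intro allI impI)
  fix a assume a: "is_partition a"
    and nz: "sym_coeff (mac_H s q (monomial_sym l) - sym_scale (mac_ev s q l) (monomial_sym l)) a \<noteq> 0"
  have "a \<noteq> l"
    using nz by (auto simp: sym_coeff_diff sym_coeff_scale sym_coeff_monomial mac_H_monomial_diag[OF assms])
  moreover from this have "sym_coeff (mac_H s q (monomial_sym l)) a \<noteq> 0"
    using nz a assms by (auto simp: sym_coeff_diff sym_coeff_scale sym_coeff_monomial_partition)
  then have "dominated a l" by (rule mac_H_monomial_dominated[OF assms])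
  ultimately show "a \<in> lower l" using a by (simp add: lower_def)
qed

text \<open>Back substitution: at a maximal m the equation fixes the coefficient \<open>x\<close>,
  because the diagonal entry is nonzero. The off-diagonal part \<open>r\<close> of the image is
  supported on the smaller set and goes to the right side.\<close>

lemma mac_H_solve:
  fixes c :: "'a::field_char_0"
  assumes "finite S" "down_closed S" "\<And>m. m \<in> S \<Longrightarrow> mac_ev s q m \<noteq> c" "supp_in S v"
  shows "\<exists>w. supp_in S w \<and> mac_H s q w - sym_scale c w = v"
  using assms
proof (induction S arbitrary: v rule: down_closed_induct)
  case empty
  then have "v = 0" by (intro supp_in_empty)
  then show ?case by (intro exI[of _ 0]) (auto simp: supp_in_def)
next
  case (remove S m)
  have m: "is_partition m" using remove.hyps(2,3) by (auto simp: down_closed_def)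
  define x where "x = sym_coeff v m / (mac_ev s q m - c)"
  define r where "r = mac_H s q (monomial_sym m) - sym_scale (mac_ev s q m) (monomial_sym m)"
  have r: "supp_in (S - {m}) r"
    unfolding r_def
    using supp_in_mono[OF supp_in_mac_H_monomial[OF m] lower_subset[OF remove.hyps(2,3)]] .
  have "supp_in (S - {m}) (v - sym_scale (sym_coeff v m) (monomial_sym m))"
    using remove.prems(2) m remove.hyps(3)
    by (intro supp_in_remove supp_in_diff supp_in_scale supp_in_monomial)
       (auto simp: sym_coeff_diff sym_coeff_scale sym_coeff_monomial)
  then have "supp_in (S - {m}) (v - sym_scale (sym_coeff v m) (monomial_sym m) - sym_scale x r)"
    using r by (intro supp_in_diff[of _ _ "sym_scale x r"] supp_in_scale)
  from remove.IH[OF _ this] remove.prems(1)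
  obtain w where w: "supp_in (S - {m}) w"
    "mac_H s q w - sym_scale c w = v - sym_scale (sym_coeff v m) (monomial_sym m) - sym_scale x r"
    by auto
  have x: "x * (mac_ev s q m - c) = sym_coeff v m"
    using remove.prems(1)[OF remove.hyps(3)] by (simp add: x_def)
  have "mac_H s q (sym_scale x (monomial_sym m) + w) - sym_scale c (sym_scale x (monomial_sym m) + w) =
      sym_scale x r + sym_scale (x * (mac_ev s q m - c)) (monomial_sym m) + (mac_H s q w - sym_scale c w)"
    by (simp add: r_def mac_H_add mac_H_scale sym_scale_add_right sym_scale_diff_right sym_scale_diff_left
        right_diff_distrib mult.commute)
  also have "\<dots> = v" unfolding x w(2) by simp
  finally show ?case
    using w(1) m remove.hyps(3)
    by (intro exI[of _ "sym_scale x (monomial_sym m) + w"] conjI supp_in_add supp_in_scale supp_in_monomial)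
       (auto intro: supp_in_mono)
qed

text \<open>H - ev has diagonal entry 0 at l, but it maps the monomial function of l strictly below
  l, where it is invertible; the correction \<open>w\<close> cancels that image.\<close>

lemma ex_eigenfunction:
  fixes s q :: "'a::field_char_0"
  assumes l: "is_partition l"
    and ev: "\<And>m. m \<in> lower l \<Longrightarrow> mac_ev s q m \<noteq> mac_ev s q l"
  shows "\<exists>f. supp_in (lower l) (f - monomial_sym l) \<and> mac_H s q f = sym_scale (mac_ev s q l) f"
proof -
  obtain w where w: "supp_in (lower l) w"
    "mac_H s q w - sym_scale (mac_ev s q l) w = mac_H s q (monomial_sym l) - sym_scale (mac_ev s q l) (monomial_sym l)"
    using mac_H_solve[OF finite_lower down_closed_lower ev supp_in_mac_H_monomial[OF l]] by blast
  have "supp_in (lower l) (monomial_sym l - w - monomial_sym l)"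
    using w(1) by (auto simp: supp_in_def uminus_symfun.rep_eq)
  moreover have "mac_H s q (monomial_sym l - w) = sym_scale (mac_ev s q l) (monomial_sym l - w)"
    using w(2) by (simp add: mac_H_diff sym_scale_diff_right algebra_simps)
  ultimately show ?thesis by blast
qed


section \<open>Rational functions near \<open>q = 1\<close>\<close>

text \<open>A relation instead of an evaluation map: regularity and the value are asserted together,
  so that each closure rule proves both.\<close>

definition has_value :: "'a::field \<Rightarrow> 'a poly fract \<Rightarrow> 'a \<Rightarrow> bool" where
  "has_value c x v \<longleftrightarrow> (\<exists>a b. x = Fract a b \<and> poly b c \<noteq> 0 \<and> v = poly a c / poly b c)"

lemma no_pole_at_iff: "no_pole_at c x \<longleftrightarrow> (\<exists>v. has_value c x v)"
  by (auto simp: no_pole_at_def has_value_def)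

lemma has_value_Fract_1: "has_value c (Fract p 1) (poly p c)"
  unfolding has_value_def by (intro exI[of _ p] exI[of _ 1]) auto

lemma has_value_add: "has_value c x v \<Longrightarrow> has_value c y w \<Longrightarrow> has_value c (x + y) (v + w)"
proof -
  assume "has_value c x v" "has_value c y w"
  then obtain a b a' b' where *: "x = Fract a b" "poly b c \<noteq> 0" "v = poly a c / poly b c"
    "y = Fract a' b'" "poly b' c \<noteq> 0" "w = poly a' c / poly b' c"
    by (auto simp: has_value_def)
  then have "b \<noteq> 0" "b' \<noteq> 0" by auto
  with * show ?thesis
    unfolding has_value_def
    by (intro exI[of _ "a * b' + a' * b"] exI[of _ "b * b'"]) (simp add: add_frac_eq)
qed

lemma has_value_mult: "has_value c x v \<Longrightarrow> has_value c y w \<Longrightarrow> has_value c (x * y) (v * w)"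
proof -
  assume "has_value c x v" "has_value c y w"
  then obtain a b a' b' where *: "x = Fract a b" "poly b c \<noteq> 0" "v = poly a c / poly b c"
    "y = Fract a' b'" "poly b' c \<noteq> 0" "w = poly a' c / poly b' c"
    by (auto simp: has_value_def)
  then show ?thesis
    unfolding has_value_def
    by (intro exI[of _ "a * a'"] exI[of _ "b * b'"]) auto
qed

lemma has_value_inverse:
  assumes "has_value c x v" "v \<noteq> 0"
  shows "has_value c (inverse x) (inverse v)"
proof -
  obtain a b where *: "x = Fract a b" "poly b c \<noteq> 0" "v = poly a c / poly b c"
    using assms(1) by (auto simp: has_value_def)
  with assms(2) show ?thesis
    unfolding has_value_def by (intro exI[of _ b] exI[of _ a]) auto
qed

lemma has_value_minus:
  assumes "has_value c x v"
  shows "has_value c (- x) (- v)"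
proof -
  obtain a b where *: "x = Fract a b" "poly b c \<noteq> 0" "v = poly a c / poly b c"
    using assms by (auto simp: has_value_def)
  then show ?thesis
    unfolding has_value_def by (intro exI[of _ "- a"] exI[of _ b]) auto
qed

lemma has_value_diff: "has_value c x v \<Longrightarrow> has_value c y w \<Longrightarrow> has_value c (x - y) (v - w)"
  using has_value_add[of c x v "- y" "- w"] has_value_minus[of c y w] by simp

lemma has_value_0: "has_value c 0 0"
  using has_value_Fract_1[of c 0] by (simp add: Zero_fract_def)

lemma has_value_1: "has_value c 1 1"
  using has_value_Fract_1[of c 1] by (simp add: One_fract_def)

text \<open>A fraction equal to 0 has numerator 0. Exhibiting a nonzero value thereby proves that a
  rational function is nonzero.\<close>

lemma has_value_0D:
  assumes "has_value c 0 v"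
  shows "v = 0"
proof -
  obtain a b where *: "0 = Fract a b" "poly b c \<noteq> 0" "v = poly a c / poly b c"
    using assms by (auto simp: has_value_def)
  then have "b \<noteq> 0" by auto
  with *(1) have "a = 0" by (simp add: Zero_fract_def eq_fract)
  with *(3) show ?thesis by simp
qed

lemma has_value_sum:
  "(\<And>i. i \<in> A \<Longrightarrow> has_value c (x i) (v i)) \<Longrightarrow> has_value c (\<Sum>i\<in>A. x i) (\<Sum>i\<in>A. v i)"
  by (induction A rule: infinite_finite_induct) (auto intro: has_value_add has_value_0)

lemma has_value_power: "has_value c x v \<Longrightarrow> has_value c (x ^ n) (v ^ n)"
  by (induction n) (auto intro: has_value_mult has_value_1)

lemma has_value_qvar: "has_value 1 qvar 1"
  unfolding qvar_def using has_value_Fract_1[of 1 "[:0, 1:]"] by simp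

abbreviation tval :: "rat poly fract" where
  "tval \<equiv> Fract [:0, 1:] 1"

lemma has_value_tvar: "has_value c tvar tval"
  unfolding tvar_def using has_value_Fract_1[of c "[:tval:]"] by simp

lemma Fract_1_power: "Fract p 1 ^ n = Fract (p ^ n) 1"
  by (induction n) (simp_all add: One_fract_def)

lemma Fract_1_eq_iff: "Fract p 1 = Fract r 1 \<longleftrightarrow> p = r"
  by (simp add: eq_fract)

lemma Fract_1_eq_1_iff: "Fract p 1 = 1 \<longleftrightarrow> p = 1"
  by (simp add: One_fract_def eq_fract)

lemma Fract_1_eq_0_iff: "Fract p 1 = 0 \<longleftrightarrow> p = 0"
  by (simp add: Zero_fract_def eq_fract)

lemma X_power_neq_1: "k \<ge> 1 \<Longrightarrow> [:0, 1 :: 'a::field:] ^ k \<noteq> 1"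
proof
  assume "k \<ge> 1" and eq: "[:0, 1 :: 'a:] ^ k = 1"
  have "poly ([:0, 1 :: 'a:] ^ k) 0 = poly 1 0" unfolding eq ..
  then show False using \<open>k \<ge> 1\<close> by (cases k) auto
qed

lemma qvar_power_neq_1: "k \<ge> 1 \<Longrightarrow> qvar ^ k \<noteq> 1"
  unfolding qvar_def Fract_1_power Fract_1_eq_1_iff by (rule X_power_neq_1)

lemma tval_power_neq_1: "k \<ge> 1 \<Longrightarrow> tval ^ k \<noteq> 1"
  unfolding Fract_1_power Fract_1_eq_1_iff by (rule X_power_neq_1)

lemma tval_neq_0: "tval \<noteq> 0"
  unfolding Fract_1_eq_0_iff by simp

lemma tvar_neq_0: "tvar \<noteq> 0"
  unfolding tvar_def Fract_1_eq_0_iff using tval_neq_0 by simp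

lemma tvar_power_neq_1: "k \<ge> 1 \<Longrightarrow> tvar ^ k \<noteq> 1"
proof
  assume k: "k \<ge> 1" and eq: "tvar ^ k = 1"
  have "has_value 1 (tvar ^ k - 1) (tval ^ k - 1)"
    by (intro has_value_diff has_value_power has_value_tvar has_value_1)
  then have "has_value 1 0 (tval ^ k - 1)" unfolding eq by simp
  then have "tval ^ k - 1 = 0" by (rule has_value_0D)
  then show False using tval_power_neq_1[OF k] by simp
qed

abbreviation svar :: qt_field where "svar \<equiv> inverse tvar"

lemma has_value_svar: "has_value c svar (inverse tval)"
  by (intro has_value_inverse has_value_tvar tval_neq_0)

section \<open>Order of vanishing at q = 1\<close>

definition ord_ge :: "nat \<Rightarrow> qt_field \<Rightarrow> bool" where
  "ord_ge k x \<longleftrightarrow> no_pole_at 1 (x / (qvar - 1) ^ k)"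

lemma qvar_neq_1: "qvar \<noteq> 1"
  using qvar_power_neq_1[of 1] by simp

lemma ord_ge_0I: "has_value 1 x v \<Longrightarrow> ord_ge 0 x"
  by (auto simp: ord_ge_def no_pole_at_iff)

lemma ord_ge_zero [simp]: "ord_ge k 0"
  using has_value_0 by (auto simp: ord_ge_def no_pole_at_iff)

lemma ord_ge_add: "ord_ge k x \<Longrightarrow> ord_ge k y \<Longrightarrow> ord_ge k (x + y)"
  unfolding ord_ge_def no_pole_at_iff add_divide_distrib by (blast intro: has_value_add)

lemma ord_ge_minus: "ord_ge k x \<Longrightarrow> ord_ge k (- x)"
  unfolding ord_ge_def no_pole_at_iff by (auto intro: has_value_minus)

lemma ord_ge_diff: "ord_ge k x \<Longrightarrow> ord_ge k y \<Longrightarrow> ord_ge k (x - y)"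
  using ord_ge_add[of k x "- y"] ord_ge_minus[of k y] by simp

lemma ord_ge_sum: "(\<And>i. i \<in> A \<Longrightarrow> ord_ge k (x i)) \<Longrightarrow> ord_ge k (\<Sum>i\<in>A. x i)"
  by (induction A rule: infinite_finite_induct) (auto intro: ord_ge_add)

lemma ord_ge_mult:
  assumes "ord_ge j x" "ord_ge k y"
  shows "ord_ge (j + k) (x * y)"
proof -
  have eq: "x * y / (qvar - 1) ^ (j + k) = (x / (qvar - 1) ^ j) * (y / (qvar - 1) ^ k)"
    by (simp add: power_add)
  from assms obtain v w where "has_value 1 (x / (qvar - 1) ^ j) v" "has_value 1 (y / (qvar - 1) ^ k) w"
    unfolding ord_ge_def no_pole_at_iff by blast
  from has_value_mult[OF this] show ?thesis
    unfolding ord_ge_def no_pole_at_iff eq by blast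
qed

lemma ord_ge_0_svar: "ord_ge 0 svar" and ord_ge_0_tvar: "ord_ge 0 tvar"
  and ord_ge_0_qvar: "ord_ge 0 qvar" and ord_ge_0_one: "ord_ge 0 1"
  by (blast intro: ord_ge_0I has_value_svar has_value_tvar has_value_qvar has_value_1)+

lemma ord_ge_0_power: "ord_ge 0 x \<Longrightarrow> ord_ge 0 (x ^ n)"
  by (induction n) (auto simp: ord_ge_0_one dest: ord_ge_mult[of 0 _ 0])

lemma has_value_q_int: "has_value 1 ((qvar ^ n - 1) / (qvar - 1)) (of_nat n)"
proof -
  have "(qvar ^ n - 1) / (qvar - 1) = (\<Sum>i<n. qvar ^ i)"
    using qvar_neq_1 by (simp add: power_diff_1_eq)
  moreover have "has_value 1 (\<Sum>i<n. qvar ^ i) (\<Sum>i<n. 1 ^ i)"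
    by (intro has_value_sum has_value_power has_value_qvar)
  ultimately show ?thesis by simp
qed

lemma ord_ge_q_power: "ord_ge 1 (qvar ^ n - 1)"
  using has_value_q_int by (auto simp: ord_ge_def no_pole_at_iff)

text \<open>A function with nonzero value at 1 is a unit of the local ring at that point.\<close>

lemma ord_ge_cancel:
  assumes "has_value 1 u v" "v \<noteq> 0" "ord_ge k (u * x)"
  shows "ord_ge k x"
proof -
  have "u \<noteq> 0" using assms(1,2) has_value_0D by auto
  then have x: "inverse u * (u * x) = x" by (simp flip: mult.assoc)
  moreover have "ord_ge 0 (inverse u)" using has_value_inverse[OF assms(1,2)] by (rule ord_ge_0I)
  ultimately show ?thesis using ord_ge_mult[of 0 "inverse u" k "u * x"] assms(3) by (simp only: x add_0)
qed

text \<open>After multiplication by t^N the sum is a polynomial in t whose coefficient at t^(N - i)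
  is d_i.\<close>

lemma inverse_tval_sum_neq_0:
  fixes d :: "nat \<Rightarrow> int"
  assumes "i \<le> N" "d i \<noteq> 0"
  shows "(\<Sum>i\<le>N. inverse tval ^ i * of_int (d i)) \<noteq> 0"
proof
  assume eq: "(\<Sum>i\<le>N. inverse tval ^ i * of_int (d i)) = 0"
  have const: "of_int z = Fract [:of_int z :: rat:] 1" for z :: int
  proof -
    have "of_nat n = Fract [:of_nat n :: rat:] 1" for n
      by (induction n) (simp_all add: Zero_fract_def One_fract_def one_pCons)
    then show ?thesis by (cases z) (simp_all add: One_fract_def one_pCons)
  qed
  have sum: "(\<Sum>i\<in>A. Fract (f i) 1) = Fract (\<Sum>i\<in>A. f i) 1" for A :: "nat set" and f :: "nat \<Rightarrow> rat poly"
    by (induction A rule: infinite_finite_induct) (simp_all add: Zero_fract_def)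
  have "0 = tval ^ N * (\<Sum>i\<le>N. inverse tval ^ i * of_int (d i))"
    unfolding eq by simp
  also have "\<dots> = (\<Sum>i\<le>N. tval ^ (N - i) * of_int (d i))"
    unfolding sum_distrib_left using tval_neq_0
    by (intro sum.cong) (auto simp: power_diff field_simps)
  also have "\<dots> = Fract (\<Sum>i\<le>N. [:0, 1:] ^ (N - i) * [:of_int (d i):]) 1"
    unfolding const Fract_1_power by (simp add: sum)
  also have "(\<Sum>i\<le>N. [:0, 1:] ^ (N - i) * [:of_int (d i):]) = (\<Sum>i\<le>N. monom (of_int (d i) :: rat) (N - i))"
    by (simp add: monom_altdef mult.commute)
  finally have "(\<Sum>i\<le>N. monom (of_int (d i) :: rat) (N - i)) = 0"
    by (simp add: Zero_fract_def Fract_1_eq_iff)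
  then have "0 = coeff (\<Sum>i\<le>N. monom (of_int (d i) :: rat) (N - i)) (N - i)" by simp
  also have "\<dots> = (\<Sum>j\<le>N. if j = i then of_int (d i) else 0)"
    unfolding coeff_sum using assms(1) by (intro sum.cong) auto
  also have "\<dots> = of_int (d i)" using assms(1) by simp
  finally show False using assms(2) by simp
qed

text \<open>(q^n - 1) / (q - 1) has value n at q = 1, so the value is (1 - 1/t) times the sum of
  t^-i (a_i - b_i). It separates the eigenvalues, and it shows that dividing by their differences
  costs exactly one power of q - 1.\<close>

lemma mac_ev_diff_value:
  assumes "a \<noteq> b"
  shows "\<exists>v. v \<noteq> 0 \<and> has_value 1 ((mac_ev svar qvar a - mac_ev svar qvar b) / (qvar - 1)) v"
proof -
  obtain j where j: "Poly_Mapping.lookup a j \<noteq> Poly_Mapping.lookup b j"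
    using assms by (meson poly_mapping_eqI)
  define N where "N = Max (insert j (Poly_Mapping.keys a \<union> Poly_Mapping.keys b))"
  have N: "i \<le> N" if "i \<in> insert j (Poly_Mapping.keys a \<union> Poly_Mapping.keys b)" for i
    unfolding N_def using that by (intro Max_ge) auto
  define d where "d i = int (Poly_Mapping.lookup a i) - int (Poly_Mapping.lookup b i)" for i
  let ?qa = "\<lambda>a i. (qvar ^ Poly_Mapping.lookup a i - 1) / (qvar - 1)"
  have "mac_ev svar qvar a - mac_ev svar qvar b = (1 - svar) *
      (\<Sum>i\<le>N. svar ^ i * (qvar ^ Poly_Mapping.lookup a i - qvar ^ Poly_Mapping.lookup b i))"
    using N by (simp add: mac_ev_superset[of "{..N}"] subset_iff right_diff_distrib[symmetric] sum_subtractf[symmetric])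
  moreover have "(\<Sum>i\<le>N. svar ^ i * (?qa a i - ?qa b i)) =
      (\<Sum>i\<le>N. svar ^ i * (qvar ^ Poly_Mapping.lookup a i - qvar ^ Poly_Mapping.lookup b i)) / (qvar - 1)"
    by (simp add: sum_divide_distrib diff_divide_distrib[symmetric])
  ultimately have "(mac_ev svar qvar a - mac_ev svar qvar b) / (qvar - 1) =
      (1 - svar) * (\<Sum>i\<le>N. svar ^ i * (?qa a i - ?qa b i))"
    by simp
  moreover have "has_value 1 ((1 - svar) * (\<Sum>i\<le>N. svar ^ i * (?qa a i - ?qa b i)))
      ((1 - inverse tval) * (\<Sum>i\<le>N. inverse tval ^ i *
        (of_nat (Poly_Mapping.lookup a i) - of_nat (Poly_Mapping.lookup b i))))"
    by (intro has_value_mult has_value_diff has_value_sum has_value_power has_value_svar has_value_1 has_value_q_int)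
  moreover have "(\<Sum>i\<le>N. inverse tval ^ i * of_int (d i)) \<noteq> 0"
    using j N[of j] by (intro inverse_tval_sum_neq_0[of j]) (auto simp: d_def)
  moreover have "inverse tval \<noteq> 1"
    using tval_power_neq_1[of 1] by (metis inverse_1 inverse_inverse_eq order_refl power_one_right)
  ultimately show ?thesis by (intro exI conjI) (auto simp: d_def)
qed

lemma mac_ev_inj:
  assumes "a \<noteq> b"
  shows "mac_ev svar qvar a \<noteq> mac_ev svar qvar b"
proof
  assume eq: "mac_ev svar qvar a = mac_ev svar qvar b"
  obtain v where v: "v \<noteq> 0" "has_value 1 ((mac_ev svar qvar a - mac_ev svar qvar b) / (qvar - 1)) v"
    using mac_ev_diff_value[OF assms] by (elim exE conjE)
  have "has_value 1 0 v" using v(2) unfolding eq by simp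
  then have "v = 0" by (rule has_value_0D)
  with v(1) show False ..
qed


section \<open>Macdonald symmetric functions as eigenfunctions\<close>

definition qt_ratio :: "nat \<Rightarrow> qt_field" where
  "qt_ratio k = (1 - qvar ^ k) / (1 - tvar ^ k)"

lemma qt_ratio_neq_0: "k \<ge> 1 \<Longrightarrow> qt_ratio k \<noteq> 0"
  using qvar_power_neq_1[of k] tvar_power_neq_1[of k] by (simp add: qt_ratio_def)

text \<open>The reason for s = 1/t: this is the hypothesis of \<open>pform_gfun_mult\<close> for the
  (q,t)-scalar product.\<close>

lemma qt_ratio_adjoint: "k \<ge> 1 \<Longrightarrow> qt_ratio k * (1 - svar ^ k) = svar ^ k * (qvar ^ k - 1)"
  using tvar_power_neq_1[of k] tvar_neq_0
  by (simp add: qt_ratio_def field_simps)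

lemma z_qt_eq: "z_qt l = of_nat (zeta (pmset l)) * (\<Prod>k\<in>#pmset l. qt_ratio k)"
  by (simp add: z_qt_def z_part_eq qt_ratio_def pmset_def prod_unfold_prod_mset multiset.map_comp comp_def)

lemma vector_space_mult: "vector_space ((*) :: 'a::field \<Rightarrow> _)"
  by unfold_locales (simp_all add: algebra_simps)

lemma is_qt_scalar_product_pform: "is_qt_scalar_product (pform qt_ratio)"
  unfolding is_qt_scalar_product_def
proof (intro conjI allI impI)
  fix f
  show "Vector_Spaces.linear sym_scale (*) (pform qt_ratio f)"
    by (simp add: Vector_Spaces.linear_iff vector_space_sym_scale vector_space_mult pform_add_right pform_scale_right)
  show "Vector_Spaces.linear sym_scale (*) (\<lambda>g. pform qt_ratio g f)"
    by (simp add: Vector_Spaces.linear_iff vector_space_sym_scale vector_space_mult pform_add_left pform_scale_left)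
next
  fix l m assume "is_partition l" "is_partition m"
  then show "pform qt_ratio (power_sum_part l) (power_sum_part m) = (if l = m then z_qt l else 0)"
    using pmset_inj[of l m] by (auto simp: power_sum_part_eq pform_power_sums_both zero_notin_pmset z_qt_eq)
qed

lemma is_qt_scalar_product_unique:
  assumes B: "is_qt_scalar_product B"
  shows "B = pform qt_ratio"
proof (intro ext)
  fix f g
  have add: "B f (g + h) = B f g + B f h" "B (f + h) g = B f g + B h g" for f g h
    using B by (simp_all add: is_qt_scalar_product_def Vector_Spaces.linear_iff)
  have scale: "B f (sym_scale c g) = c * B f g" "B (sym_scale c f) g = c * B f g" for f g c
    using B by (simp_all add: is_qt_scalar_product_def Vector_Spaces.linear_iff)
  have "B (power_sums L) (power_sums M) = pform qt_ratio (power_sums L) (power_sums M)"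
    if L: "0 \<notin># L" and M: "0 \<notin># M" for L M
  proof -
    obtain l where l: "is_partition l" "pmset l = L" by (rule pmset_surj[OF L])
    obtain m where m: "is_partition m" "pmset m = M" by (rule pmset_surj[OF M])
    show ?thesis
      using B is_qt_scalar_product_pform l(1) m(1)
      unfolding is_qt_scalar_product_def l(2)[symmetric] m(2)[symmetric] power_sum_part_eq[symmetric]
      by metis
  qed
  note * = this
  have "B f (power_sums M) = pform qt_ratio f (power_sums M)" if M: "0 \<notin># M" for M
    by (rule linear_eq_on_power_sums[where \<phi> = "\<lambda>f. B f (power_sums M)"
          and \<psi> = "\<lambda>f. pform qt_ratio f (power_sums M)"])
       (simp_all add: add scale pform_add_left pform_scale_left * M)
  then show "B f g = pform qt_ratio f g"
    by - (rule linear_eq_on_power_sums[where \<phi> = "B f" and \<psi> = "pform qt_ratio f"],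
       simp_all add: add scale pform_add_right pform_scale_right)
qed

lemma qt_scalar_product_eq: "qt_scalar_product = pform qt_ratio"
  unfolding qt_scalar_product_def
  using is_qt_scalar_product_pform is_qt_scalar_product_unique by (rule the_equality)

lemma triangular_iff:
  assumes "is_partition l"
  shows "(\<exists>u. f = monomial_sym l +
      (\<Sum>m | is_partition m \<and> dominated m l \<and> m \<noteq> l. sym_scale (u m) (monomial_sym m)))
    \<longleftrightarrow> supp_in (lower l) (f - monomial_sym l)"
proof
  assume "\<exists>u. f = monomial_sym l +
      (\<Sum>m | is_partition m \<and> dominated m l \<and> m \<noteq> l. sym_scale (u m) (monomial_sym m))"
  then obtain u where u: "f - monomial_sym l = (\<Sum>m\<in>lower l. sym_scale (u m) (monomial_sym m))"
    by (auto simp: lower_def)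
  show "supp_in (lower l) (f - monomial_sym l)"
    unfolding u supp_in_def
  proof (intro allI impI)
    fix a assume a: "is_partition a"
      "sym_coeff (\<Sum>m\<in>lower l. sym_scale (u m) (monomial_sym m)) a \<noteq> 0"
    then obtain m where "m \<in> lower l" "sym_coeff (sym_scale (u m) (monomial_sym m)) a \<noteq> 0"
      unfolding sym_coeff_sum by (meson sum.not_neutral_contains_not_neutral)
    then show "a \<in> lower l"
      using a(1) by (auto simp: sym_coeff_scale sym_coeff_monomial_partition lower_def split: if_splits)
  qed
next
  assume "supp_in (lower l) (f - monomial_sym l)"
  from supp_in_expansion[OF finite_lower _ this]
  have "f = monomial_sym l + (\<Sum>m\<in>lower l. sym_scale (sym_coeff (f - monomial_sym l) m) (monomial_sym m))"
    by (simp add: lower_def algebra_simps)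
  then show "\<exists>u. f = monomial_sym l +
      (\<Sum>m | is_partition m \<and> dominated m l \<and> m \<noteq> l. sym_scale (u m) (monomial_sym m))"
    unfolding lower_def by (rule exI[where x = "sym_coeff (f - monomial_sym l)"])
qed

lemma is_macdonald_family_iff:
  "is_macdonald_family P \<longleftrightarrow>
     (\<forall>l. is_partition l \<longrightarrow> supp_in (lower l) (P l - monomial_sym l)) \<and>
     (\<forall>l m. is_partition l \<longrightarrow> is_partition m \<longrightarrow> l \<noteq> m \<longrightarrow> pform qt_ratio (P l) (P m) = 0)"
  unfolding is_macdonald_family_def qt_scalar_product_eq by (auto simp: triangular_iff)

text \<open>By unitriangularity, subtracting a multiple of \<open>P m\<close> for a maximal m leaves
  a function supported on the rest; so the \<open>P m\<close> with m in S span the functions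
  supported in S.\<close>

lemma orthogonal_supp_in:
  assumes P: "is_macdonald_family P"
    and "finite S" "down_closed S" "\<And>m. m \<in> S \<Longrightarrow> pform qt_ratio f (P m) = 0" "supp_in S g"
  shows "pform qt_ratio f g = 0"
  using assms(2-)
proof (induction S arbitrary: g rule: down_closed_induct)
  case empty
  then show ?case using supp_in_empty by fastforce
next
  case (remove S m)
  have m: "is_partition m" using remove.hyps(2,3) by (auto simp: down_closed_def)
  have Pm: "supp_in (lower m) (P m - monomial_sym m)"
    using P m by (simp add: is_macdonald_family_iff)
  let ?r = "g - sym_scale (sym_coeff g m) (monomial_sym m)"
  have "supp_in (S - {m}) ?r"
    using remove.prems(2) m remove.hyps(3)
    by (intro supp_in_remove supp_in_diff supp_in_scale supp_in_monomial)
       (auto simp: sym_coeff_diff sym_coeff_scale sym_coeff_monomial)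
  then have "supp_in (S - {m}) (?r - sym_scale (sym_coeff g m) (P m - monomial_sym m))"
    using supp_in_mono[OF Pm lower_subset[OF remove.hyps(2,3)]]
    by (intro supp_in_diff[of _ ?r] supp_in_scale)
  then have "pform qt_ratio f (?r - sym_scale (sym_coeff g m) (P m - monomial_sym m)) = 0"
    by (rule remove.IH[rotated]) (use remove.prems(1) in auto)
  moreover have "?r - sym_scale (sym_coeff g m) (P m - monomial_sym m) = g - sym_scale (sym_coeff g m) (P m)"
    by (simp add: sym_scale_diff_right)
  ultimately show ?case
    using remove.prems(1)[OF remove.hyps(3)] by (simp add: pform_diff_right pform_scale_right)
qed

text \<open>The difference d is supported below l and orthogonal to everything supported there. A
  \<open>P m\<close> with m outside of \<open>lower l\<close> is orthogonal to the
  \<open>P b\<close> spanning that space, hence to d as well. So d is orthogonal to all functions,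
  and nondegeneracy applies.\<close>

lemma macdonald_family_unique:
  assumes P: "is_macdonald_family P" and P': "is_macdonald_family P'" and l: "is_partition l"
  shows "P l = P' l"
proof -
  define d where "d = P l - P' l"
  have "supp_in (lower l) ((P l - monomial_sym l) - (P' l - monomial_sym l))"
    using P P' l by (auto simp only: is_macdonald_family_iff intro!: supp_in_diff[of _ "P l - monomial_sym l"])
  then have d: "supp_in (lower l) d" by (simp add: d_def)
  have part: "is_partition m" if "m \<in> lower l" for m using that by (simp add: lower_def)
  have "pform qt_ratio (Q l) g = 0" if Q: "is_macdonald_family Q" and g: "supp_in (lower l) g" for Q g
  proof (rule orthogonal_supp_in[OF Q finite_lower down_closed_lower _ g])
    fix m assume "m \<in> lower l"
    then show "pform qt_ratio (Q l) (Q m) = 0"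
      using Q l by (auto simp: is_macdonald_family_iff lower_def)
  qed
  from this[OF P] this[OF P'] have d_lower: "pform qt_ratio d g = 0" if "supp_in (lower l) g" for g
    using that by (simp add: d_def pform_diff_left)
  have dP: "pform qt_ratio d (P m) = 0" if m: "is_partition m" for m
  proof (cases "m \<in> lower l")
    case True
    have "supp_in (lower l) (P m - monomial_sym m + monomial_sym m)"
      using P m lower_subset[OF down_closed_lower True] True
      by (intro supp_in_add supp_in_monomial) (auto simp: is_macdonald_family_iff intro: supp_in_mono)
    then show ?thesis using d_lower by simp
  next
    case False
    have "pform qt_ratio (P m) d = 0"
    proof (rule orthogonal_supp_in[OF P finite_lower down_closed_lower _ d])
      fix b assume "b \<in> lower l"
      then show "pform qt_ratio (P m) (P b) = 0"
        using P m False part[of b] by (auto simp: is_macdonald_family_iff)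
    qed
    then show ?thesis by (simp add: pform_commute)
  qed
  have "pform qt_ratio d g = 0" for g
  proof -
    obtain N where N: "deg_le N g" using ex_deg_le by blast
    let ?S = "{m. is_partition m \<and> weight m \<le> N}"
    have "down_closed ?S" by (auto simp: down_closed_def dominated_def)
    moreover have "supp_in ?S g" using N by (auto simp: supp_in_def deg_le_def)
    ultimately show ?thesis
      using orthogonal_supp_in[OF P finite_partitions_weight_le[of N]] dP by blast
  qed
  then have "d = 0" using pform_nondegenerate[of qt_ratio d] qt_ratio_neq_0 by blast
  then show ?thesis by (simp add: d_def)
qed

lemma macdonald_P_exists:
  "\<exists>P. is_macdonald_family P \<and>
     (\<forall>l. is_partition l \<longrightarrow> mac_H svar qvar (P l) = sym_scale (mac_ev svar qvar l) (P l))"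
proof -
  have "\<exists>f. supp_in (lower l) (f - monomial_sym l) \<and>
      mac_H svar qvar f = sym_scale (mac_ev svar qvar l) f" if "is_partition l" for l
    by (rule ex_eigenfunction[OF that mac_ev_inj]) (simp add: lower_def)
  then obtain P where P: "\<And>l. is_partition l \<Longrightarrow> supp_in (lower l) (P l - monomial_sym l)"
      "\<And>l. is_partition l \<Longrightarrow> mac_H svar qvar (P l) = sym_scale (mac_ev svar qvar l) (P l)"
    by metis
  have "pform qt_ratio (P l) (P m) = 0" if "is_partition l" "is_partition m" "l \<noteq> m" for l m
  proof -
    have "mac_ev svar qvar l * pform qt_ratio (P l) (P m) = mac_ev svar qvar m * pform qt_ratio (P l) (P m)"
      using mac_H_self_adjoint[OF qt_ratio_adjoint, of "P l" "P m"] P(2)[OF that(1)] P(2)[OF that(2)]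
      by (simp add: pform_scale_left pform_scale_right)
    then show ?thesis using mac_ev_inj[OF that(3)] by simp
  qed
  with P show ?thesis by (intro exI[of _ P]) (auto simp: is_macdonald_family_iff)
qed

lemma
  assumes l: "is_partition l"
  shows supp_in_macdonald_P: "supp_in (lower l) (macdonald_P l - monomial_sym l)"
    and mac_H_macdonald_P: "mac_H svar qvar (macdonald_P l) = sym_scale (mac_ev svar qvar l) (macdonald_P l)"
proof -
  from macdonald_P_exists obtain P where P: "is_macdonald_family P \<and>
     (\<forall>l. is_partition l \<longrightarrow> mac_H svar qvar (P l) = sym_scale (mac_ev svar qvar l) (P l))" ..
  then have fam: "is_macdonald_family P" ..
  have eq: "macdonald_P l = P l"
    unfolding macdonald_P_def
  proof (rule the_equality)
    show "\<exists>Q. is_macdonald_family Q \<and> Q l = P l" by (intro exI[of _ P] conjI fam refl)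
  next
    fix f assume "\<exists>Q. is_macdonald_family Q \<and> Q l = f"
    then obtain Q where Q: "is_macdonald_family Q \<and> Q l = f" ..
    then have "Q l = P l" by (intro macdonald_family_unique[OF _ fam l]) simp
    with Q show "f = P l" by simp
  qed
  show "supp_in (lower l) (macdonald_P l - monomial_sym l)"
    unfolding eq using fam l unfolding is_macdonald_family_iff by blast
  show "mac_H svar qvar (macdonald_P l) = sym_scale (mac_ev svar qvar l) (macdonald_P l)"
    unfolding eq using P l by simp
qed


section \<open>Cumulants of set functions\<close>

text \<open>
  Grouping the blocks of a set partition by the block containing a given \<open>m\<close> expresses
  \<open>F I = \<Sum>\<^bsub>\<pi>\<^esub> \<Prod>\<^bsub>B \<in> \<pi>\<^esub> K B\<close> without set partitions. For the convolution product of set functions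
  this says \<open>F = exp K\<close>, the marking of \<open>m\<close> being a derivation.
\<close>

definition is_cumulant :: "('i set \<Rightarrow> 'a::comm_ring_1) \<Rightarrow> ('i set \<Rightarrow> 'a) \<Rightarrow> bool" where
  "is_cumulant F K \<longleftrightarrow> F {} = 1 \<and>
     (\<forall>I. finite I \<longrightarrow> (\<forall>m\<in>I. F I = (\<Sum>B | m \<in> B \<and> B \<subseteq> I. K B * F (I - B))))"

lemma is_cumulant_empty: "is_cumulant F K \<Longrightarrow> F {} = 1"
  by (simp add: is_cumulant_def)

lemma is_cumulant_rec:
  "is_cumulant F K \<Longrightarrow> finite I \<Longrightarrow> m \<in> I \<Longrightarrow> F I = (\<Sum>B | m \<in> B \<and> B \<subseteq> I. K B * F (I - B))"
  by (auto simp: is_cumulant_def)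

lemma finite_subsets_containing: "finite I \<Longrightarrow> finite {B. m \<in> B \<and> B \<subseteq> I}"
  by (rule finite_subset[of _ "Pow I"]) auto

lemma is_cumulant_split:
  assumes "is_cumulant F K" "finite I" "m \<in> I"
  shows "F I = K I + (\<Sum>B | m \<in> B \<and> B \<subset> I. K B * F (I - B))"
proof -
  have "{B. m \<in> B \<and> B \<subseteq> I} = insert I {B. m \<in> B \<and> B \<subset> I}" using assms(3) by auto
  moreover have "finite {B. m \<in> B \<and> B \<subset> I}"
    by (rule finite_subset[OF _ finite_subsets_containing[OF assms(2), of m]]) auto
  ultimately show ?thesis
    using is_cumulant_rec[OF assms] is_cumulant_empty[OF assms(1)] by simp
qed

lemma is_cumulant_unique:
  assumes "is_cumulant F K" "is_cumulant G L" "finite I" "I \<noteq> {}" "\<And>A. A \<subseteq> I \<Longrightarrow> F A = G A"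
  shows "K I = L I"
  using assms(3-5)
proof (induction I rule: finite_psubset_induct)
  case (psubset I)
  then obtain m where m: "m \<in> I" by auto
  have "K B * F (I - B) = L B * G (I - B)" if "B \<in> {B. m \<in> B \<and> B \<subset> I}" for B
    using that psubset.IH[of B] psubset.prems(2)[of "I - B"] psubset.prems(2) by force
  then have "(\<Sum>B | m \<in> B \<and> B \<subset> I. K B * F (I - B)) = (\<Sum>B | m \<in> B \<and> B \<subset> I. L B * G (I - B))"
    by (rule sum.cong[OF refl])
  then show ?case
    using is_cumulant_split[OF assms(1) psubset.hyps m] is_cumulant_split[OF assms(2) psubset.hyps m]
      psubset.prems(2)[of I] by simp
qed


subsection \<open>Set partitions\<close>

lemma partition_on_Diff_insert:
  assumes "partition_on I \<pi>" "B \<in> \<pi>"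
  shows "partition_on (I - B) (\<pi> - {B})"
proof (rule partition_onI)
  show "\<Union>(\<pi> - {B}) = I - B"
    using assms by (force simp: partition_on_def disjoint_def)
  show "disjnt p q" if "p \<in> \<pi> - {B}" "q \<in> \<pi> - {B}" "p \<noteq> q" for p q
    using partition_onD2[OF assms(1)] that by (auto simp: pairwise_def)
qed (use partition_onD3[OF assms(1)] in auto)

lemma partition_on_insert_block:
  assumes "partition_on (I - B) \<pi>" "B \<subseteq> I" "B \<noteq> {}"
  shows "partition_on I (insert B \<pi>)"
  using assms partition_onD1[OF assms(1)] by (subst partition_on_insert) (auto simp: disjnt_def)

lemma notin_partition_on_Diff: "partition_on (I - B) \<pi> \<Longrightarrow> B \<noteq> {} \<Longrightarrow> B \<notin> \<pi>"
  by (auto simp: partition_on_def)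

lemma partitions_by_block:
  assumes "m \<in> I"
  shows "{\<pi>. partition_on I \<pi>} =
      (\<lambda>(B, \<pi>). insert B \<pi>) ` (SIGMA B:{B. m \<in> B \<and> B \<subseteq> I}. {\<pi>. partition_on (I - B) \<pi>})"
    and "inj_on (\<lambda>(B, \<pi>). insert B \<pi>) (SIGMA B:{B. m \<in> B \<and> B \<subseteq> I}. {\<pi>. partition_on (I - B) \<pi>})"
proof -
  let ?S = "SIGMA B:{B. m \<in> B \<and> B \<subseteq> I}. {\<pi>. partition_on (I - B) \<pi>}"
  show "{\<pi>. partition_on I \<pi>} = (\<lambda>(B, \<pi>). insert B \<pi>) ` ?S"
  proof (intro set_eqI iffI)
    fix \<pi> assume "\<pi> \<in> {\<pi>. partition_on I \<pi>}"
    then have \<pi>: "partition_on I \<pi>" by simp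
    then obtain B where B: "B \<in> \<pi>" "m \<in> B" using assms by (auto simp: partition_on_def)
    then have "(B, \<pi> - {B}) \<in> ?S"
      using partition_on_Diff_insert[OF \<pi>] partition_onD1[OF \<pi>] by auto
    moreover have "\<pi> = (\<lambda>(B, \<pi>). insert B \<pi>) (B, \<pi> - {B})" using B by auto
    ultimately show "\<pi> \<in> (\<lambda>(B, \<pi>). insert B \<pi>) ` ?S" by (rule rev_image_eqI)
  qed (auto intro!: partition_on_insert_block)
  have *: "B = C" if "(B, \<pi>) \<in> ?S" "(C, \<rho>) \<in> ?S" "insert B \<pi> = insert C \<rho>" for B C \<pi> \<rho>
  proof (rule ccontr)
    assume "B \<noteq> C"
    then have "B \<in> \<rho>" using that(3) by auto
    then have "B \<subseteq> I - C" using that(2) by (auto simp: partition_on_def)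
    then show False using that(1,2) by auto
  qed
  show "inj_on (\<lambda>(B, \<pi>). insert B \<pi>) ?S"
  proof (rule inj_onI, clarify)
    fix B C \<pi> \<rho>
    assume mem: "m \<in> B" "B \<subseteq> I" "partition_on (I - B) \<pi>" "m \<in> C" "C \<subseteq> I" "partition_on (I - C) \<rho>"
      and eq: "insert B \<pi> = insert C \<rho>"
    have "B = C" using *[of B \<pi> C \<rho>] mem eq by auto
    moreover have "B \<notin> \<pi>" "C \<notin> \<rho>"
      using notin_partition_on_Diff mem by (metis empty_iff)+
    ultimately show "B = C \<and> \<pi> = \<rho>" using eq by (metis insert_ident)
  qed
qed

definition set_exp :: "('i set \<Rightarrow> 'a::comm_ring_1) \<Rightarrow> 'i set \<Rightarrow> 'a" where
  "set_exp K I = (\<Sum>\<pi> | partition_on I \<pi>. \<Prod>B\<in>\<pi>. K B)"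

lemma is_cumulant_set_exp: "is_cumulant (set_exp K) K"
  unfolding is_cumulant_def
proof (intro conjI allI impI ballI)
  show "set_exp K {} = 1" by (simp add: set_exp_def partition_on_empty)
next
  fix I :: "'a set" and m assume I: "finite I" "m \<in> I"
  let ?S = "SIGMA B:{B. m \<in> B \<and> B \<subseteq> I}. {\<pi>. partition_on (I - B) \<pi>}"
  have "set_exp K I = (\<Sum>(B, \<pi>)\<in>?S. \<Prod>C\<in>insert B \<pi>. K C)"
    unfolding set_exp_def partitions_by_block(1)[OF I(2)]
    by (subst sum.reindex[OF partitions_by_block(2)[OF I(2)]]) (simp add: case_prod_unfold)
  also have "\<dots> = (\<Sum>(B, \<pi>)\<in>?S. K B * (\<Prod>C\<in>\<pi>. K C))"
  proof (rule sum.cong[OF refl], clarify)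
    fix B \<pi> assume "m \<in> B" "B \<subseteq> I" "partition_on (I - B) \<pi>"
    then show "(\<Prod>C\<in>insert B \<pi>. K C) = K B * (\<Prod>C\<in>\<pi>. K C)"
      using notin_partition_on_Diff[of I B \<pi>] finite_elements[of "I - B" \<pi>] I(1)
      by (subst prod.insert) auto
  qed
  also have "\<dots> = (\<Sum>B | m \<in> B \<and> B \<subseteq> I. \<Sum>\<pi> | partition_on (I - B) \<pi>. K B * (\<Prod>C\<in>\<pi>. K C))"
    by (rule sum.Sigma[symmetric])
       (use I in \<open>auto intro!: finite_subsets_containing finitely_many_partition_on\<close>)
  also have "\<dots> = (\<Sum>B | m \<in> B \<and> B \<subseteq> I. K B * set_exp K (I - B))"
    by (simp add: set_exp_def sum_distrib_left)
  finally show "set_exp K I = (\<Sum>B | m \<in> B \<and> B \<subseteq> I. K B * set_exp K (I - B))" .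
qed

lemma partition_on_proper_block:
  assumes "partition_on I \<pi>" "\<pi> \<noteq> {I}" "B \<in> \<pi>"
  shows "B \<subset> I"
proof -
  have "B \<subseteq> I" using assms by (auto simp: partition_on_def)
  moreover have "B \<noteq> I"
  proof
    assume "B = I"
    then have "partition_on {} (\<pi> - {I})" using partition_on_Diff_insert[OF assms(1,3)] by simp
    then have "\<pi> - {I} = {}" by (simp add: partition_on_empty)
    then show False using assms(2,3) \<open>B = I\<close> by auto
  qed
  ultimately show ?thesis by auto
qed

text \<open>In the exponential formula, \<open>set_log F I\<close> is the term of the one-block
  partition, while all other partitions involve proper subsets. Solving for it is a recursion on the
  cardinality, whence the value 0 on infinite sets.\<close>

function set_log :: "('i set \<Rightarrow> 'a::comm_ring_1) \<Rightarrow> 'i set \<Rightarrow> 'a" where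
  "set_log F I = (if finite I then F I - (\<Sum>\<pi>\<in>{\<pi>. partition_on I \<pi> \<and> \<pi> \<noteq> {I}}. \<Prod>B\<in>\<pi>. set_log F B) else 0)"
  by auto
termination
  by (relation "measure (\<lambda>(F, I). card I)")
     (auto dest!: partition_on_proper_block intro!: psubset_card_mono)

declare set_log.simps [simp del]

lemma set_exp_set_log:
  assumes "F {} = 1" "finite I"
  shows "set_exp (set_log F) I = F I"
proof (cases "I = {}")
  case True
  then show ?thesis by (simp add: set_exp_def partition_on_empty assms(1))
next
  case False
  then have "{\<pi>. partition_on I \<pi>} = insert {I} {\<pi>. partition_on I \<pi> \<and> \<pi> \<noteq> {I}}"
    using partition_on_space[of I] by auto
  moreover have "finite {\<pi>. partition_on I \<pi> \<and> \<pi> \<noteq> {I}}"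
    by (rule finite_subset[OF _ finitely_many_partition_on[OF assms(2)]]) auto
  ultimately have "set_exp (set_log F) I =
      set_log F I + (\<Sum>\<pi> | partition_on I \<pi> \<and> \<pi> \<noteq> {I}. \<Prod>B\<in>\<pi>. set_log F B)"
    by (simp add: set_exp_def)
  then show ?thesis using assms(2) by (simp add: set_log.simps[of F I])
qed

lemma is_cumulant_set_log:
  fixes F :: "'i set \<Rightarrow> 'a::comm_ring_1"
  assumes "F {} = 1"
  shows "is_cumulant F (set_log F)"
  unfolding is_cumulant_def
proof (intro conjI allI impI ballI)
  fix I :: "'i set" and m assume I: "finite I" "m \<in> I"
  have "F I = set_exp (set_log F) I" using set_exp_set_log[of F, OF assms I(1)] by simp
  also have "\<dots> = (\<Sum>B | m \<in> B \<and> B \<subseteq> I. set_log F B * set_exp (set_log F) (I - B))"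
    by (rule is_cumulant_rec[OF is_cumulant_set_exp I])
  also have "\<dots> = (\<Sum>B | m \<in> B \<and> B \<subseteq> I. set_log F B * F (I - B))"
    using set_exp_set_log[of F, OF assms] I(1) by simp
  finally show "F I = (\<Sum>B | m \<in> B \<and> B \<subseteq> I. set_log F B * F (I - B))" .
qed (rule assms)


subsection \<open>Moebius inversion on set partitions\<close>

lemma sum_partition_moebius:
  assumes "finite A" "refines A \<pi> \<sigma>"
  shows "(\<Sum>\<tau> | refines A \<pi> \<tau> \<and> refines A \<tau> \<sigma>. partition_moebius A \<pi> \<tau>) = (if \<pi> = \<sigma> then 1 else 0)"
proof (cases "\<pi> = \<sigma>")
  case True
  then have "{\<tau>. refines A \<pi> \<tau> \<and> refines A \<tau> \<sigma>} = {\<pi>}"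
    using assms(2) refines_asym by blast
  then show ?thesis using True assms by (simp add: partition_moebius.simps)
next
  case False
  let ?S = "{\<tau>. refines A \<pi> \<tau> \<and> refines A \<tau> \<sigma> \<and> \<tau> \<noteq> \<sigma>}"
  have "{\<tau>. refines A \<pi> \<tau> \<and> refines A \<tau> \<sigma>} = insert \<sigma> ?S"
    using assms(2) refines_refl[of A \<sigma>] by (auto simp: refines_def)
  moreover have "finite ?S"
    by (rule finite_subset[OF _ finitely_many_partition_on[OF assms(1)]]) (auto simp: refines_def)
  ultimately show ?thesis
    using assms False by (simp add: partition_moebius.simps[of A \<pi> \<sigma>])
qed

lemma refines_top: "A \<noteq> {} \<Longrightarrow> refines A \<pi> {A} \<longleftrightarrow> partition_on A \<pi>"
  by (auto simp: refines_def partition_on_space) (auto simp: partition_on_def)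

text \<open>Refining a partition means partitioning its blocks independently. The two halves are
  recovered from their union by testing which parts lie inside \<open>B\<close>; this gives
  injectivity and disjointness.\<close>

lemma refinements_by_block:
  assumes "partition_on A \<pi>" "B \<in> \<pi>"
  defines "S \<equiv> {\<tau>. partition_on B \<tau>} \<times> {\<tau>. refines (A - B) \<tau> (\<pi> - {B})}"
  shows "{\<tau>. refines A \<tau> \<pi>} = (\<lambda>(\<tau>, \<tau>'). \<tau> \<union> \<tau>') ` S"
    and "inj_on (\<lambda>(\<tau>, \<tau>'). \<tau> \<union> \<tau>') S"
    and "\<And>\<tau> \<tau>'. (\<tau>, \<tau>') \<in> S \<Longrightarrow> \<tau> \<inter> \<tau>' = {}"
proof -
  have B: "B \<subseteq> A" using assms by (auto simp: partition_on_def)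
  have block: "{p \<in> \<tau> \<union> \<tau>'. p \<subseteq> B} = \<tau> \<and> {p \<in> \<tau> \<union> \<tau>'. \<not> p \<subseteq> B} = \<tau>'"
    if "(\<tau>, \<tau>') \<in> S" for \<tau> \<tau>'
  proof -
    have "p \<subseteq> B" if "p \<in> \<tau>" for p
      using that \<open>(\<tau>, \<tau>') \<in> S\<close> by (auto simp: S_def partition_on_def)
    moreover have "\<not> p \<subseteq> B" if p: "p \<in> \<tau>'" for p
    proof -
      have "partition_on (A - B) \<tau>'" using \<open>(\<tau>, \<tau>') \<in> S\<close> by (simp add: S_def refines_def)
      then have "p \<subseteq> A - B" "p \<noteq> {}" using p by (auto simp: partition_on_def)
      then show ?thesis by auto
    qed
    ultimately show ?thesis by auto
  qed
  show "\<tau> \<inter> \<tau>' = {}" if "(\<tau>, \<tau>') \<in> S" for \<tau> \<tau>'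
  proof (rule equals0I)
    fix p assume "p \<in> \<tau> \<inter> \<tau>'"
    then have "p \<in> {p \<in> \<tau> \<union> \<tau>'. p \<subseteq> B}" "p \<in> {p \<in> \<tau> \<union> \<tau>'. \<not> p \<subseteq> B}"
      unfolding block[OF that, THEN conjunct1] block[OF that, THEN conjunct2] by auto
    then show False by simp
  qed
  show "inj_on (\<lambda>(\<tau>, \<tau>'). \<tau> \<union> \<tau>') S"
  proof (rule inj_onI)
    fix x y assume "x \<in> S" "y \<in> S" and eq: "(\<lambda>(\<tau>, \<tau>'). \<tau> \<union> \<tau>') x = (\<lambda>(\<tau>, \<tau>'). \<tau> \<union> \<tau>') y"
    then show "x = y" using block[of "fst x" "snd x"] block[of "fst y" "snd y"]
      by (simp add: case_prod_unfold prod_eq_iff)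
  qed
  show "{\<tau>. refines A \<tau> \<pi>} = (\<lambda>(\<tau>, \<tau>'). \<tau> \<union> \<tau>') ` S"
  proof (intro set_eqI iffI)
    fix \<tau> assume "\<tau> \<in> {\<tau>. refines A \<tau> \<pi>}"
    then have r: "refines A \<tau> \<pi>" by simp
    let ?\<tau>1 = "{p \<in> \<tau>. p \<subseteq> B}" and ?\<tau>2 = "{p \<in> \<tau>. \<not> p \<subseteq> B}"
    have \<tau>: "partition_on A \<tau>" using r by (simp add: refines_def)
    have 1: "partition_on B ?\<tau>1" by (rule refines_obtains_subset[OF r assms(2)])
    have un: "\<Union>?\<tau>1 = B" using partition_onD1[OF 1] by simp
    have dis: "p \<inter> p' = {}" if "p \<in> \<tau>" "p' \<in> \<tau>" "p \<noteq> p'" for p p'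
      using partition_onD2[OF \<tau>] that by (auto simp: disjoint_def)
    have disB: "p \<inter> B = {}" if p: "p \<in> ?\<tau>2" for p
    proof -
      have "p \<inter> p' = {}" if "p' \<in> ?\<tau>1" for p' using dis[of p p'] p that by auto
      then have "p \<inter> \<Union>?\<tau>1 = {}" by blast
      then show ?thesis unfolding un .
    qed
    have "\<Union>?\<tau>2 = A - B"
    proof (intro set_eqI iffI)
      fix x assume "x \<in> \<Union>?\<tau>2"
      then show "x \<in> A - B" using disB partition_onD1[OF \<tau>] by blast
    next
      fix x assume "x \<in> A - B"
      then show "x \<in> \<Union>?\<tau>2" using partition_onD1[OF \<tau>] by blast
    qed
    then have 2: "partition_on (A - B) ?\<tau>2"
      using partition_onD2[OF \<tau>] partition_onD3[OF \<tau>] by (auto simp: partition_on_def pairwise_def)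
    have "\<exists>Y\<in>\<pi> - {B}. X \<subseteq> Y" if "X \<in> ?\<tau>2" for X
      using r that by (auto simp: refines_def)
    then have "(?\<tau>1, ?\<tau>2) \<in> S"
      using 1 2 partition_on_Diff_insert[OF assms(1,2)] by (auto simp: S_def refines_def)
    moreover have "\<tau> = (\<lambda>(\<tau>, \<tau>'). \<tau> \<union> \<tau>') (?\<tau>1, ?\<tau>2)" by auto
    ultimately show "\<tau> \<in> (\<lambda>(\<tau>, \<tau>'). \<tau> \<union> \<tau>') ` S" by (rule rev_image_eqI)
  next
    fix \<tau> assume "\<tau> \<in> (\<lambda>(\<tau>, \<tau>'). \<tau> \<union> \<tau>') ` S"
    then obtain \<tau>1 \<tau>2 where \<tau>: "\<tau> = \<tau>1 \<union> \<tau>2" and 1: "partition_on B \<tau>1"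
      and 2: "refines (A - B) \<tau>2 (\<pi> - {B})" by (auto simp: S_def)
    have part2: "partition_on (A - B) \<tau>2" using 2 by (simp add: refines_def)
    have sub: "p \<subseteq> B" if "p \<in> \<tau>1" for p using that 1 by (auto simp: partition_on_def)
    have sub': "p \<subseteq> A - B" if "p \<in> \<tau>2" for p using that part2 by (auto simp: partition_on_def)
    have "partition_on A (\<tau>1 \<union> \<tau>2)"
    proof (rule partition_onI)
      show "\<Union>(\<tau>1 \<union> \<tau>2) = A" using partition_onD1[OF 1] partition_onD1[OF part2] B by auto
      show "disjnt p p'" if "p \<in> \<tau>1 \<union> \<tau>2" "p' \<in> \<tau>1 \<union> \<tau>2" "p \<noteq> p'" for p p'
        using that disjointD[OF partition_onD2[OF 1], of p p'] disjointD[OF partition_onD2[OF part2], of p p']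
          sub[of p] sub[of p'] sub'[of p] sub'[of p'] unfolding disjnt_def by blast
    qed (use partition_onD3[OF 1] partition_onD3[OF part2] in auto)
    moreover have "\<exists>Y\<in>\<pi>. X \<subseteq> Y" if "X \<in> \<tau>1 \<union> \<tau>2" for X
      using that sub[of X] assms(2) 2 by (auto simp: refines_def)
    ultimately show "\<tau> \<in> {\<tau>. refines A \<tau> \<pi>}"
      unfolding \<tau> using assms(1) by (simp add: refines_def)
  qed
qed

lemma prod_set_exp:
  assumes "finite A" "partition_on A \<pi>"
  shows "(\<Prod>B\<in>\<pi>. set_exp K B) = (\<Sum>\<tau> | refines A \<tau> \<pi>. \<Prod>C\<in>\<tau>. K C)"
proof -
  have "finite \<pi>" using finite_elements[OF assms] .
  then show ?thesis using assms
  proof (induction \<pi> arbitrary: A rule: finite_induct)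
    case empty
    then have "A = {}" by (simp add: partition_on_def)
    then have "{\<tau>. refines A \<tau> {}} = {{}}" by (auto simp: refines_def partition_on_empty)
    then show ?case by simp
  next
    case (insert B \<pi>)
    let ?S = "{\<tau>. partition_on B \<tau>} \<times> {\<tau>. refines (A - B) \<tau> \<pi>}"
    have \<pi>: "insert B \<pi> - {B} = \<pi>" using insert.hyps by auto
    note block = refinements_by_block[OF insert.prems(2) insertI1, unfolded \<pi>]
    have B: "finite B" "B \<subseteq> A" using insert.prems finite_subset by (auto simp: partition_on_def)
    have "partition_on (A - B) \<pi>"
      using partition_on_Diff_insert[OF insert.prems(2) insertI1] \<pi> by simp
    then have IH: "(\<Prod>B\<in>\<pi>. set_exp K B) = (\<Sum>\<tau> | refines (A - B) \<tau> \<pi>. \<Prod>C\<in>\<tau>. K C)"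
      using insert.prems(1) by (intro insert.IH) auto
    have "(\<Prod>B\<in>insert B \<pi>. set_exp K B) =
        (\<Sum>\<tau> | partition_on B \<tau>. \<Prod>C\<in>\<tau>. K C) * (\<Sum>\<tau> | refines (A - B) \<tau> \<pi>. \<Prod>C\<in>\<tau>. K C)"
      unfolding prod.insert[OF insert.hyps] IH by (simp add: set_exp_def)
    also have "\<dots> = (\<Sum>(\<tau>, \<tau>')\<in>?S. (\<Prod>C\<in>\<tau>. K C) * (\<Prod>C\<in>\<tau>'. K C))"
      by (simp add: sum_product sum.cartesian_product)
    also have "\<dots> = (\<Sum>(\<tau>, \<tau>')\<in>?S. \<Prod>C\<in>\<tau> \<union> \<tau>'. K C)"
    proof (rule sum.cong[OF refl], clarify)
      fix \<tau> \<tau>' assume p: "partition_on B \<tau>" "refines (A - B) \<tau>' \<pi>"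
      then have "finite \<tau>" "finite \<tau>'"
        using finite_elements B insert.prems(1) by (auto simp: refines_def)
      moreover have "\<tau> \<inter> \<tau>' = {}" using block(3)[of \<tau> \<tau>'] p by simp
      ultimately show "(\<Prod>C\<in>\<tau>. K C) * (\<Prod>C\<in>\<tau>'. K C) = (\<Prod>C\<in>\<tau> \<union> \<tau>'. K C)"
        by (rule prod.union_disjoint[symmetric])
    qed
    also have "\<dots> = (\<Sum>\<tau> | refines A \<tau> (insert B \<pi>). \<Prod>C\<in>\<tau>. K C)"
      unfolding block(1) by (subst sum.reindex[OF block(2)]) (simp add: case_prod_unfold)
    finally show ?case .
  qed
qed

text \<open>The recursion for the Moebius function controls sums over its upper argument, while the
  claim sums over the lower one. Hence \<open>S \<tau>\<close> is summed once more over all \<tau>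
  below \<sigma>: exchanging the sums collapses the total to \<open>G \<sigma>\<close>, and the
  induction hypothesis removes every \<tau> other than \<sigma>.\<close>

lemma moebius_inversion:
  fixes G K :: "'i set set \<Rightarrow> 'a::comm_ring_1"
  assumes A: "finite A" and G: "\<And>\<pi>. partition_on A \<pi> \<Longrightarrow> G \<pi> = (\<Sum>\<tau> | refines A \<tau> \<pi>. K \<tau>)"
    and \<sigma>: "partition_on A \<sigma>"
  shows "(\<Sum>\<pi> | refines A \<pi> \<sigma>. of_int (partition_moebius A \<pi> \<sigma>) * G \<pi>) = K \<sigma>"
  using \<sigma>
proof (induction "card {\<pi>. refines A \<pi> \<sigma>}" arbitrary: \<sigma> rule: less_induct)
  case less
  let ?\<mu> = "\<lambda>\<pi> \<sigma>. of_int (partition_moebius A \<pi> \<sigma>) :: 'a"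
  define S where "S \<sigma> = (\<Sum>\<pi> | refines A \<pi> \<sigma>. ?\<mu> \<pi> \<sigma> * G \<pi>)" for \<sigma>
  have fin: "finite {\<pi>. refines A \<pi> \<sigma>}" for \<sigma>
    by (rule finite_subset[OF _ finitely_many_partition_on[OF A]]) (auto simp: refines_def)
  have self: "refines A \<sigma> \<sigma>" using less.prems by (rule refines_refl)
  have IH: "S \<tau> = K \<tau>" if \<tau>: "refines A \<tau> \<sigma>" "\<tau> \<noteq> \<sigma>" for \<tau>
    unfolding S_def
  proof (rule less.hyps)
    have "\<sigma> \<notin> {\<rho>. refines A \<rho> \<tau>}" using \<tau> refines_asym by blast
    moreover have "{\<rho>. refines A \<rho> \<tau>} \<subseteq> {\<rho>. refines A \<rho> \<sigma>}" using \<tau> refines_trans by blast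
    ultimately have "{\<rho>. refines A \<rho> \<tau>} \<subset> {\<rho>. refines A \<rho> \<sigma>}" using self by blast
    then show "card {\<rho>. refines A \<rho> \<tau>} < card {\<rho>. refines A \<rho> \<sigma>}" by (rule psubset_card_mono[OF fin])
    show "partition_on A \<tau>" using \<tau> by (simp add: refines_def)
  qed
  have "(\<Sum>\<tau> | refines A \<tau> \<sigma>. S \<tau>) =
      (\<Sum>\<tau> | refines A \<tau> \<sigma>. \<Sum>\<pi> | refines A \<pi> \<sigma>. if refines A \<pi> \<tau> then ?\<mu> \<pi> \<tau> * G \<pi> else 0)"
  proof (rule sum.cong[OF refl])
    fix \<tau> assume "\<tau> \<in> {\<tau>. refines A \<tau> \<sigma>}"
    then have eq: "{\<pi>. refines A \<pi> \<tau>} = {\<pi> \<in> {\<pi>. refines A \<pi> \<sigma>}. refines A \<pi> \<tau>}"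
      using refines_trans by blast
    show "S \<tau> = (\<Sum>\<pi> | refines A \<pi> \<sigma>. if refines A \<pi> \<tau> then ?\<mu> \<pi> \<tau> * G \<pi> else 0)"
      unfolding S_def eq sum.inter_filter[OF fin] ..
  qed
  also have "\<dots> = (\<Sum>\<pi> | refines A \<pi> \<sigma>. \<Sum>\<tau> | refines A \<tau> \<sigma>. if refines A \<pi> \<tau> then ?\<mu> \<pi> \<tau> * G \<pi> else 0)"
    by (rule sum.swap)
  also have "\<dots> = (\<Sum>\<pi> | refines A \<pi> \<sigma>. if \<pi> = \<sigma> then G \<sigma> else 0)"
  proof (rule sum.cong[OF refl])
    fix \<pi> assume \<pi>: "\<pi> \<in> {\<pi>. refines A \<pi> \<sigma>}"
    have eq: "{\<tau>. refines A \<pi> \<tau> \<and> refines A \<tau> \<sigma>} = {\<tau> \<in> {\<tau>. refines A \<tau> \<sigma>}. refines A \<pi> \<tau>}"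
      by auto
    have "(\<Sum>\<tau> | refines A \<tau> \<sigma>. if refines A \<pi> \<tau> then ?\<mu> \<pi> \<tau> * G \<pi> else 0) =
        of_int (\<Sum>\<tau> | refines A \<pi> \<tau> \<and> refines A \<tau> \<sigma>. partition_moebius A \<pi> \<tau>) * G \<pi>"
      unfolding eq of_int_sum sum_distrib_right sum.inter_filter[OF fin] by (rule sum.cong) auto
    then show "(\<Sum>\<tau> | refines A \<tau> \<sigma>. if refines A \<pi> \<tau> then ?\<mu> \<pi> \<tau> * G \<pi> else 0) = (if \<pi> = \<sigma> then G \<sigma> else 0)"
      using sum_partition_moebius[OF A, of \<pi> \<sigma>] \<pi> by (simp del: of_int_sum)
  qed
  also have "\<dots> = (\<Sum>\<tau> | refines A \<tau> \<sigma>. K \<tau>)" using self fin G[OF less.prems] by simp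
  finally have eq: "(\<Sum>\<tau> | refines A \<tau> \<sigma>. S \<tau>) = (\<Sum>\<tau> | refines A \<tau> \<sigma>. K \<tau>)" .
  have ins: "{\<tau>. refines A \<tau> \<sigma>} = insert \<sigma> {\<tau>. refines A \<tau> \<sigma> \<and> \<tau> \<noteq> \<sigma>}" using self by auto
  have "finite {\<tau>. refines A \<tau> \<sigma> \<and> \<tau> \<noteq> \<sigma>}" by (rule finite_subset[OF _ fin[of \<sigma>]]) auto
  then have "S \<sigma> + (\<Sum>\<tau> | refines A \<tau> \<sigma> \<and> \<tau> \<noteq> \<sigma>. S \<tau>) = K \<sigma> + (\<Sum>\<tau> | refines A \<tau> \<sigma> \<and> \<tau> \<noteq> \<sigma>. K \<tau>)"
    using eq unfolding ins by simp
  then have "S \<sigma> = K \<sigma>" by (simp add: IH)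
  then show ?case by (simp add: S_def)
qed

lemma moebius_sum_eq_set_log:
  fixes F :: "'i set \<Rightarrow> 'a::comm_ring_1"
  assumes A: "finite A" "A \<noteq> {}" and F: "F {} = 1"
  shows "(\<Sum>\<pi> | partition_on A \<pi>. of_int (partition_moebius A \<pi> {A}) * (\<Prod>B\<in>\<pi>. F B)) = set_log F A"
proof -
  have "(\<Prod>B\<in>\<pi>. F B) = (\<Sum>\<tau> | refines A \<tau> \<pi>. \<Prod>C\<in>\<tau>. set_log F C)" if \<pi>: "partition_on A \<pi>" for \<pi>
  proof -
    have "set_exp (set_log F) B = F B" if "B \<in> \<pi>" for B
      using A(1) \<pi> that finite_subset[of B A]
      by (intro set_exp_set_log F) (auto simp: partition_on_def)
    then have "(\<Prod>B\<in>\<pi>. F B) = (\<Prod>B\<in>\<pi>. set_exp (set_log F) B)" by simp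
    then show ?thesis using prod_set_exp[OF A(1) \<pi>] by simp
  qed
  from moebius_inversion[OF A(1) this partition_on_space[OF A(2)]]
  show ?thesis using A(2) by (simp add: refines_top)
qed


subsection \<open>Convolution of set functions\<close>

definition set_conv :: "('i set \<Rightarrow> 'a::comm_ring_1) \<Rightarrow> ('i set \<Rightarrow> 'a) \<Rightarrow> 'i set \<Rightarrow> 'a" where
  "set_conv F G I = (\<Sum>A | A \<subseteq> I. F A * G (I - A))"

lemma finite_subsets: "finite I \<Longrightarrow> finite {A. A \<subseteq> I}"
  by (simp flip: Pow_def)

lemma set_conv_commute: "finite I \<Longrightarrow> set_conv F G I = set_conv G F I"
  unfolding set_conv_def
  by (rule sum.reindex_bij_witness[of _ "\<lambda>A. I - A" "\<lambda>A. I - A"])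
     (auto simp: double_diff mult.commute)

text \<open>A chain of B inside A inside I amounts to B and the subset A - B of I - B: associativity
  of convolution with a marked element.\<close>

lemma sum_nested_subsets:
  assumes I: "finite I"
  shows "(\<Sum>A | A \<subseteq> I \<and> m \<in> A. (\<Sum>B | m \<in> B \<and> B \<subseteq> A. K B * F (A - B)) * G (I - A)) =
         (\<Sum>B | m \<in> B \<and> B \<subseteq> I. K B * set_conv F G (I - B))"
proof -
  have fin: "finite A" if "A \<subseteq> I" for A using that I finite_subset by auto
  have "(\<Sum>A | A \<subseteq> I \<and> m \<in> A. (\<Sum>B | m \<in> B \<and> B \<subseteq> A. K B * F (A - B)) * G (I - A)) =
      (\<Sum>(A, B)\<in>(SIGMA A:{A. A \<subseteq> I \<and> m \<in> A}. {B. m \<in> B \<and> B \<subseteq> A}). K B * F (A - B) * G (I - A))"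
    unfolding sum_distrib_right using fin I
    by (intro sum.Sigma) (auto intro: finite_subsets_containing rev_finite_subset[OF finite_subsets[OF I]])
  also have "\<dots> = (\<Sum>(B, C)\<in>(SIGMA B:{B. m \<in> B \<and> B \<subseteq> I}. {C. C \<subseteq> I - B}). K B * (F C * G (I - B - C)))"
    by (rule sum.reindex_bij_witness[of _ "\<lambda>(B, C). (B \<union> C, B)" "\<lambda>(A, B). (B, A - B)"])
       (auto simp: Un_absorb1 Un_Diff mult.assoc intro!: arg_cong2[of _ _ _ _ "(*)"] arg_cong[of _ _ F] arg_cong[of _ _ G])
  also have "\<dots> = (\<Sum>B | m \<in> B \<and> B \<subseteq> I. \<Sum>C | C \<subseteq> I - B. K B * (F C * G (I - B - C)))"
    using I by (intro sum.Sigma[symmetric]) (auto intro: finite_subsets_containing finite_subsets)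
  finally show ?thesis by (simp add: set_conv_def sum_distrib_left)
qed

text \<open>Writing D for the marking of m, \<open>is_cumulant\<close> says D F = (D K) F; multiply
  by G.\<close>

lemma set_conv_mark:
  assumes F: "is_cumulant F K" and I: "finite I" "m \<in> I"
  shows "(\<Sum>A | A \<subseteq> I \<and> m \<in> A. F A * G (I - A)) =
         (\<Sum>B | m \<in> B \<and> B \<subseteq> I. K B * set_conv F G (I - B))"
proof -
  have "F A = (\<Sum>B | m \<in> B \<and> B \<subseteq> A. K B * F (A - B))" if "A \<subseteq> I" "m \<in> A" for A
    using is_cumulant_rec[OF F] that I(1) finite_subset by blast
  then have "(\<Sum>A | A \<subseteq> I \<and> m \<in> A. F A * G (I - A)) =
      (\<Sum>A | A \<subseteq> I \<and> m \<in> A. (\<Sum>B | m \<in> B \<and> B \<subseteq> A. K B * F (A - B)) * G (I - A))"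
    by (intro sum.cong refl arg_cong2[of _ _ _ _ "(*)"]) auto
  then show ?thesis unfolding sum_nested_subsets[OF I(1)] .
qed

text \<open>The marked element lies in A or in its complement, which is the product rule for
  marking; so logarithms add under convolution.\<close>

lemma is_cumulant_set_conv:
  assumes F: "is_cumulant F K" and G: "is_cumulant G L"
  shows "is_cumulant (set_conv F G) (\<lambda>B. K B + L B)"
  unfolding is_cumulant_def
proof (intro conjI allI impI ballI)
  show "set_conv F G {} = 1" using F G by (simp add: set_conv_def is_cumulant_empty)
next
  fix I :: "'a set" and m assume I: "finite I" "m \<in> I"
  have fin: "finite {A. A \<subseteq> I \<and> m \<in> A}" "finite {A. A \<subseteq> I \<and> m \<notin> A}"
    by (auto intro: rev_finite_subset[OF finite_subsets[OF I(1)]])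
  have "set_conv F G I = (\<Sum>A\<in>{A. A \<subseteq> I \<and> m \<in> A} \<union> {A. A \<subseteq> I \<and> m \<notin> A}. F A * G (I - A))"
    unfolding set_conv_def by (intro sum.cong) auto
  also have "\<dots> = (\<Sum>A | A \<subseteq> I \<and> m \<in> A. F A * G (I - A)) + (\<Sum>A | A \<subseteq> I \<and> m \<notin> A. F A * G (I - A))"
    by (intro sum.union_disjoint fin) auto
  also have "(\<Sum>A | A \<subseteq> I \<and> m \<notin> A. F A * G (I - A)) = (\<Sum>A | A \<subseteq> I \<and> m \<in> A. G A * F (I - A))"
    using I(2) by (intro sum.reindex_bij_witness[of _ "\<lambda>A. I - A" "\<lambda>A. I - A"])
      (auto simp: double_diff mult.commute)
  also have "(\<Sum>A | A \<subseteq> I \<and> m \<in> A. F A * G (I - A)) = (\<Sum>B | m \<in> B \<and> B \<subseteq> I. K B * set_conv F G (I - B))"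
    by (rule set_conv_mark[OF F I])
  also have "(\<Sum>A | A \<subseteq> I \<and> m \<in> A. G A * F (I - A)) = (\<Sum>B | m \<in> B \<and> B \<subseteq> I. L B * set_conv F G (I - B))"
    unfolding set_conv_mark[OF G I] using I(1) by (intro sum.cong refl) (simp add: set_conv_commute)
  finally show "set_conv F G I = (\<Sum>B | m \<in> B \<and> B \<subseteq> I. (K B + L B) * set_conv F G (I - B))"
    by (simp add: sum.distrib distrib_right)
qed

lemma is_cumulant_determines:
  assumes "is_cumulant F K" "is_cumulant G K" "finite I"
  shows "F I = G I"
  using assms(3)
proof (induction I rule: finite_psubset_induct)
  case (psubset I)
  show ?case
  proof (cases "I = {}")
    case True
    then show ?thesis using assms by (simp add: is_cumulant_empty)
  next
    case False
    then obtain m where m: "m \<in> I" by auto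
    have "F (I - B) = G (I - B)" if "m \<in> B" "B \<subseteq> I" for B
      using that m by (intro psubset.IH) auto
    then show ?thesis
      unfolding is_cumulant_rec[OF assms(1) psubset.hyps m] is_cumulant_rec[OF assms(2) psubset.hyps m]
      by (intro sum.cong refl) auto
  qed
qed

text \<open>The identity F' / F = exp(log F' - log F) without convolution inverses: the right side
  has logarithm K', and a logarithm determines its function.\<close>

lemma is_cumulant_quotient:
  assumes "is_cumulant F K" "is_cumulant F' K'" "finite I"
  shows "F' I = set_conv F (set_exp (\<lambda>B. K' B - K B)) I"
proof -
  have "is_cumulant (set_conv F (set_exp (\<lambda>B. K' B - K B))) K'"
    using is_cumulant_set_conv[OF assms(1) is_cumulant_set_exp[of "\<lambda>B. K' B - K B"]] by simp
  then show ?thesis by (rule is_cumulant_determines[OF assms(2) _ assms(3)])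
qed

lemma set_conv_cancel:
  assumes "F {} = 1" "finite I" "\<And>A. A \<subseteq> I \<Longrightarrow> set_conv F v A = set_conv F w A"
  shows "v I = w I"
  using assms(2,3)
proof (induction I rule: finite_psubset_induct)
  case (psubset I)
  have split: "set_conv F u I = u I + (\<Sum>A | A \<subseteq> I \<and> A \<noteq> {}. F A * u (I - A))" for u
  proof -
    have "{A. A \<subseteq> I} = insert {} {A. A \<subseteq> I \<and> A \<noteq> {}}" by auto
    moreover have "finite {A. A \<subseteq> I \<and> A \<noteq> {}}"
      by (rule rev_finite_subset[OF finite_subsets[OF psubset.hyps]]) auto
    ultimately show ?thesis using assms(1) by (simp add: set_conv_def)
  qed
  have "v (I - A) = w (I - A)" if "A \<subseteq> I" "A \<noteq> {}" for A
    using that by (intro psubset.IH psubset.prems) auto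
  then have "(\<Sum>A | A \<subseteq> I \<and> A \<noteq> {}. F A * v (I - A)) = (\<Sum>A | A \<subseteq> I \<and> A \<noteq> {}. F A * w (I - A))"
    by (intro sum.cong refl) auto
  then show ?case using psubset.prems[of I] split[of v] split[of w] by simp
qed


text \<open>Used with q raised to an exponent additive in I: a row length of the summed partitions,
  or an exponent in the normalising factor.\<close>

lemma is_cumulant_twist:
  fixes F K :: "'i set \<Rightarrow> 'a::comm_ring_1"
  assumes "is_cumulant F K" "\<phi> {} = 1" "\<And>I B. finite I \<Longrightarrow> B \<subseteq> I \<Longrightarrow> \<phi> I = \<phi> B * \<phi> (I - B)"
  shows "is_cumulant (\<lambda>I. \<phi> I * F I) (\<lambda>I. \<phi> I * K I)"
  unfolding is_cumulant_def
proof (intro conjI allI impI ballI)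
  show "\<phi> {} * F {} = 1" using assms(1,2) by (simp add: is_cumulant_empty)
next
  fix I :: "'i set" and m assume I: "finite I" "m \<in> I"
  show "\<phi> I * F I = (\<Sum>B | m \<in> B \<and> B \<subseteq> I. \<phi> B * K B * (\<phi> (I - B) * F (I - B)))"
    unfolding is_cumulant_rec[OF assms(1) I] sum_distrib_left
  proof (rule sum.cong[OF refl])
    fix B assume "B \<in> {B. m \<in> B \<and> B \<subseteq> I}"
    then have "B \<subseteq> I" by simp
    note e = assms(3)[OF I(1) this]
    show "\<phi> I * (K B * F (I - B)) = \<phi> B * K B * (\<phi> (I - B) * F (I - B))"
      unfolding e by (simp only: mult_ac)
  qed
qed

lemma is_cumulant_hom:
  fixes F K :: "'i set \<Rightarrow> 'a::comm_ring_1" and \<phi> :: "'a \<Rightarrow> 'b::comm_ring_1"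
  assumes "is_cumulant F K" "\<phi> 1 = 1" "\<phi> 0 = 0" "\<And>x y. \<phi> (x + y) = \<phi> x + \<phi> y" "\<And>x y. \<phi> (x * y) = \<phi> x * \<phi> y"
  shows "is_cumulant (\<lambda>I. \<phi> (F I)) (\<lambda>I. \<phi> (K I))"
proof -
  have sum: "\<phi> (\<Sum>i\<in>A. x i) = (\<Sum>i\<in>A. \<phi> (x i))" for A :: "'i set set" and x
    by (induction A rule: infinite_finite_induct) (simp_all add: assms)
  show ?thesis
    unfolding is_cumulant_def
  proof (intro conjI allI impI ballI)
    show "\<phi> (F {}) = 1" using assms by (simp add: is_cumulant_empty)
  next
    fix I :: "'i set" and m assume I: "finite I" "m \<in> I"
    show "\<phi> (F I) = (\<Sum>B | m \<in> B \<and> B \<subseteq> I. \<phi> (K B) * \<phi> (F (I - B)))"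
      unfolding is_cumulant_rec[OF assms(1) I] by (simp add: sum assms(5))
  qed
qed


subsection \<open>Filtrations\<close>

text \<open>Serves orders of vanishing at q = 1 for scalars, for symmetric functions coefficient by
  coefficient, and for power series in z over them.\<close>

locale ring_filtration =
  fixes filt :: "nat \<Rightarrow> 'a::comm_ring_1 \<Rightarrow> bool"
  assumes filt_zero: "filt k 0"
    and filt_one: "filt 0 1"
    and filt_add: "filt k x \<Longrightarrow> filt k y \<Longrightarrow> filt k (x + y)"
    and filt_mult: "filt j x \<Longrightarrow> filt k y \<Longrightarrow> filt (j + k) (x * y)"
begin

lemma filt_sum: "(\<And>i. i \<in> A \<Longrightarrow> filt k (x i)) \<Longrightarrow> filt k (\<Sum>i\<in>A. x i)"
  by (induction A rule: infinite_finite_induct) (auto simp: filt_zero intro: filt_add)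

lemma filt_set_exp:
  assumes "finite I" "\<And>B. B \<subseteq> I \<Longrightarrow> B \<noteq> {} \<Longrightarrow> filt (card B) (K B)"
  shows "filt (card I) (set_exp K I)"
  using assms
proof (induction I rule: finite_psubset_induct)
  case (psubset I)
  show ?case
  proof (cases "I = {}")
    case True
    then show ?thesis using is_cumulant_empty[OF is_cumulant_set_exp[of K]] filt_one by simp
  next
    case False
    then obtain m where m: "m \<in> I" by auto
    have "filt (card I) (K B * set_exp K (I - B))" if B: "m \<in> B" "B \<subseteq> I" for B
    proof -
      have "filt (card (I - B)) (set_exp K (I - B))"
        using B m by (intro psubset.IH psubset.prems) auto
      then have "filt (card B + card (I - B)) (K B * set_exp K (I - B))"
        using B by (intro filt_mult psubset.prems) auto
      moreover have "card B + card (I - B) = card I"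
        using B psubset.hyps by (simp add: card_Diff_subset card_mono finite_subset)
      ultimately show ?thesis by simp
    qed
    then show ?thesis
      unfolding is_cumulant_rec[OF is_cumulant_set_exp psubset.hyps m] by (intro filt_sum) auto
  qed
qed

text \<open>The cardinalities of the blocks add up to that of I. Subtracting \<open>K I\<close>
  removes the one-block partition, so the bound is assumed on proper subsets only, as an induction
  on I requires.\<close>

lemma filt_set_exp_diff:
  assumes "finite I" "I \<noteq> {}" "\<And>B. B \<subset> I \<Longrightarrow> B \<noteq> {} \<Longrightarrow> filt (card B) (K B)"
  shows "filt (card I) (set_exp K I - K I)"
proof -
  obtain m where m: "m \<in> I" using assms(2) by auto
  have "filt (card I) (K B * set_exp K (I - B))" if B: "m \<in> B" "B \<subset> I" for B
  proof -
    have "filt (card (I - B)) (set_exp K (I - B))"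
      using B m assms(1) by (intro filt_set_exp assms(3)) auto
    then have "filt (card B + card (I - B)) (K B * set_exp K (I - B))"
      using B by (intro filt_mult assms(3)) auto
    moreover have "card B + card (I - B) = card I"
      using card_Diff_subset[of B I] card_mono[of I B] finite_subset[of B I] B assms(1) by auto
    ultimately show ?thesis by simp
  qed
  then show ?thesis
    unfolding is_cumulant_split[OF is_cumulant_set_exp assms(1) m] by (auto intro!: filt_sum)
qed

end


section \<open>Leading coefficients\<close>

interpretation ord_ge: ring_filtration ord_ge
  by standard (auto intro: ord_ge_0_one ord_ge_add ord_ge_mult)

definition small_cumulants :: "(nat set \<Rightarrow> qt_field) \<Rightarrow> bool" where
  "small_cumulants f \<longleftrightarrow> f {} = 1 \<and> (\<forall>I. finite I \<longrightarrow> I \<noteq> {} \<longrightarrow> ord_ge (card I - 1) (set_log f I))"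

lemma small_cumulants_cong:
  assumes "small_cumulants f" "\<And>I. finite I \<Longrightarrow> f I = g I"
  shows "small_cumulants g"
  unfolding small_cumulants_def
proof (intro conjI allI impI)
  have f: "f {} = 1" using assms(1) by (simp add: small_cumulants_def)
  then show g: "g {} = 1" using assms(2)[of "{}"] by simp
  fix I :: "nat set" assume I: "finite I" "I \<noteq> {}"
  have "set_log g I = set_log f I"
  proof (rule is_cumulant_unique[OF is_cumulant_set_log[of g] is_cumulant_set_log[of f] I])
    fix A assume "A \<subseteq> I"
    then show "g A = f A" using assms(2)[of A] finite_subset[of A I] I(1) by simp
  qed (use f g in simp_all)
  then show "ord_ge (card I - 1) (set_log g I)" using assms(1) I by (simp add: small_cumulants_def)
qed

text \<open>The constant 1 is the exponential of the indicator of singletons: in the recursion only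
  B = {m} contributes.\<close>

lemma small_cumulants_one: "small_cumulants (\<lambda>_. 1)"
  unfolding small_cumulants_def
proof (intro conjI allI impI)
  fix I :: "nat set" assume I: "finite I" "I \<noteq> {}"
  let ?K = "\<lambda>B :: nat set. if card B = 1 then 1 else (0 :: qt_field)"
  have "is_cumulant (\<lambda>_. 1) ?K"
    unfolding is_cumulant_def
  proof (intro conjI allI impI ballI)
    fix I :: "nat set" and m assume I: "finite I" "m \<in> I"
    have "(\<Sum>B | m \<in> B \<and> B \<subseteq> I. ?K B * 1) = (\<Sum>B | m \<in> B \<and> B \<subseteq> I. if B = {m} then 1 else 0)"
      by (intro sum.cong refl) (auto simp: card_1_singleton_iff)
    also have "\<dots> = 1" using I finite_subsets_containing[OF I(1), of m] by (simp add: sum.delta)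
    finally show "(1 :: qt_field) = (\<Sum>B | m \<in> B \<and> B \<subseteq> I. ?K B * 1)" ..
  qed simp
  then have "set_log (\<lambda>_. 1) I = ?K I"
    using I by (intro is_cumulant_unique[OF is_cumulant_set_log]) auto
  then show "ord_ge (card I - 1) (set_log (\<lambda>_. 1) I)"
    using ord_ge_0_one by simp
qed simp

lemma qvar_power_sum_split:
  fixes y :: "nat \<Rightarrow> nat"
  assumes "finite I" "B \<subseteq> I"
  shows "qvar ^ (\<Sum>i\<in>I. y i) = qvar ^ (\<Sum>i\<in>B. y i) * qvar ^ (\<Sum>i\<in>I - B. y i)"
  by (simp add: sum.subset_diff[OF assms(2,1)] power_add)

text \<open>
  Let \<open>M f I = q^(y I) f I\<close>. Since \<open>y\<close> is additive, \<open>M\<close> is multiplicative, and \<open>M f / f\<close> is the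
  exponential of \<open>(M - 1) (log f)\<close>, which is divisible by one more power of \<open>q - 1\<close> than \<open>log f\<close>.
  On sets containing \<open>j\<close>, the logarithm changes by \<open>- u M (log f)\<close> times \<open>M f / f\<close>.
\<close>

lemma small_cumulants_step:
  fixes y :: "nat \<Rightarrow> nat"
  assumes f: "small_cumulants f" and u: "ord_ge 0 u"
  shows "small_cumulants (\<lambda>I. if j \<in> I then f I * (1 - u * qvar ^ (\<Sum>i\<in>I. y i)) else f I)"
    (is "small_cumulants ?f'")
proof -
  define K where "K = set_log f"
  define Q where "Q I = qvar ^ (\<Sum>i\<in>I. y i)" for I
  define W where "W = set_exp (\<lambda>B. Q B * K B - K B)"
  define K' where "K' I = (if j \<in> I then K I - u * (\<Sum>B | j \<in> B \<and> B \<subseteq> I. Q B * K B * W (I - B)) else K I)" for I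
  have f1: "f {} = 1" using f by (simp add: small_cumulants_def)
  have K: "is_cumulant f K" unfolding K_def by (rule is_cumulant_set_log[of f, OF f1])
  have ordK: "ord_ge (card I - 1) (K I)" if "finite I" "I \<noteq> {}" for I
    using f that by (simp add: small_cumulants_def K_def)
  have QK: "is_cumulant (\<lambda>I. Q I * f I) (\<lambda>I. Q I * K I)"
    by (rule is_cumulant_twist[OF K]) (simp_all add: Q_def qvar_power_sum_split)
  have ordQ: "ord_ge 0 (Q I)" for I
    unfolding Q_def by (rule ord_ge_0_power[OF ord_ge_0_qvar])
  have ordW: "ord_ge (card I) (W I)" if I: "finite I" for I
    unfolding W_def
  proof (rule ord_ge.filt_set_exp[OF I])
    fix B assume B: "B \<subseteq> I" "B \<noteq> {}"
    then have fin: "finite B" using I finite_subset by auto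
    have "ord_ge (1 + (card B - 1)) ((Q B - 1) * K B)"
      unfolding Q_def by (intro ord_ge_mult ord_ge_q_power ordK fin B)
    moreover have "1 + (card B - 1) = card B" using fin B card_gt_0_iff[of B] by simp
    ultimately show "ord_ge (card B) (Q B * K B - K B)" by (simp add: left_diff_distrib)
  qed
  have K'_sum: "(\<Sum>B | j \<in> B \<and> B \<subseteq> I. K' B * f (I - B)) = f I * (1 - u * Q I)"
    if I: "finite I" "j \<in> I" for I
  proof -
    let ?S = "\<lambda>B. \<Sum>C | j \<in> C \<and> C \<subseteq> B. Q C * K C * W (B - C)"
    have "(\<Sum>B | j \<in> B \<and> B \<subseteq> I. K' B * f (I - B)) =
        (\<Sum>B | j \<in> B \<and> B \<subseteq> I. K B * f (I - B) - u * (?S B * f (I - B)))"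
      by (intro sum.cong refl) (simp add: K'_def left_diff_distrib mult.assoc)
    also have "\<dots> = (\<Sum>B | j \<in> B \<and> B \<subseteq> I. K B * f (I - B))
        - u * (\<Sum>B | B \<subseteq> I \<and> j \<in> B. ?S B * f (I - B))"
      by (simp only: sum_subtractf sum_distrib_left conj_commute)
    also have "(\<Sum>B | j \<in> B \<and> B \<subseteq> I. K B * f (I - B)) = f I"
      using is_cumulant_rec[OF K I] ..
    also have "(\<Sum>B | B \<subseteq> I \<and> j \<in> B. ?S B * f (I - B)) =
        (\<Sum>C | j \<in> C \<and> C \<subseteq> I. Q C * K C * set_conv W f (I - C))"
      by (rule sum_nested_subsets[OF I(1)])
    also have "\<dots> = (\<Sum>C | j \<in> C \<and> C \<subseteq> I. Q C * K C * (Q (I - C) * f (I - C)))"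
    \<comment> \<open>\<open>W\<close> represents the quotient of Q f by f, so convolving it with f
      restores Q f.\<close>
    proof (intro sum.cong refl arg_cong2[of _ _ _ _ "(*)"])
      fix C
      show "set_conv W f (I - C) = Q (I - C) * f (I - C)"
        using is_cumulant_quotient[OF K QK, of "I - C"] set_conv_commute[of "I - C" W f] I(1) by (simp add: W_def)
    qed
    also have "\<dots> = Q I * f I"
      using is_cumulant_rec[OF QK I] ..
    finally show ?thesis by (simp add: algebra_simps)
  qed
  have f'1: "?f' {} = 1" using f1 by simp
  have log: "set_log ?f' I = K' I" if "finite I" "I \<noteq> {}" for I
    using that
  proof (induction I rule: finite_psubset_induct)
    case (psubset I)
    show ?case
    proof (cases "j \<in> I")
      case False
      have "set_log ?f' I = K I"
        using False psubset.prems psubset.hyps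
        by (intro is_cumulant_unique[OF is_cumulant_set_log[of ?f', OF f'1] K]) auto
      then show ?thesis using False by (simp add: K'_def)
    next
      case True
      have ins: "{B. j \<in> B \<and> B \<subseteq> I} = insert I {B. j \<in> B \<and> B \<subset> I}" using True by auto
      have fin: "finite {B. j \<in> B \<and> B \<subset> I}"
        by (rule finite_subset[OF _ finite_subsets_containing[OF psubset.hyps, of j]]) auto
      have "f I * (1 - u * Q I) = K' I + (\<Sum>B | j \<in> B \<and> B \<subset> I. K' B * f (I - B))"
        using K'_sum[OF psubset.hyps True] fin f1 unfolding ins by simp
      moreover have "?f' I = set_log ?f' I + (\<Sum>B | j \<in> B \<and> B \<subset> I. set_log ?f' B * ?f' (I - B))"
        by (rule is_cumulant_split[OF is_cumulant_set_log[of ?f', OF f'1] psubset.hyps True])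
      moreover have "(\<Sum>B | j \<in> B \<and> B \<subset> I. set_log ?f' B * ?f' (I - B)) =
          (\<Sum>B | j \<in> B \<and> B \<subset> I. K' B * f (I - B))"
      proof (rule sum.cong[OF refl])
        fix B assume B: "B \<in> {B. j \<in> B \<and> B \<subset> I}"
        then have "set_log ?f' B = K' B" by (intro psubset.IH) auto
        then show "set_log ?f' B * ?f' (I - B) = K' B * f (I - B)" using B by simp
      qed
      ultimately show ?thesis using True by (simp add: Q_def)
    qed
  qed
  have "ord_ge (card I - 1) (K' I)" if I: "finite I" "I \<noteq> {}" for I
  proof (cases "j \<in> I")
    case True
    have "ord_ge (card I - 1) (Q B * K B * W (I - B))" if B: "j \<in> B" "B \<subseteq> I" for B
    proof -
      have fin: "finite B" "B \<noteq> {}" using I(1) finite_subset B by auto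
      have "ord_ge (0 + (card B - 1) + card (I - B)) (Q B * K B * W (I - B))"
        using I(1) by (intro ord_ge_mult ordQ ordK ordW fin) auto
      moreover have "0 + (card B - 1) + card (I - B) = card I - 1"
        using card_Diff_subset[OF fin(1) B(2)] card_mono[OF I(1) B(2)] fin card_gt_0_iff[of B] by simp
      ultimately show ?thesis by simp
    qed
    then have "ord_ge (0 + (card I - 1)) (u * (\<Sum>B | j \<in> B \<and> B \<subseteq> I. Q B * K B * W (I - B)))"
      by (intro ord_ge_mult u ord_ge_sum) auto
    then show ?thesis using True ordK[OF I] by (simp add: K'_def ord_ge_diff)
  qed (use ordK[OF I] in \<open>simp add: K'_def\<close>)
  then show ?thesis using f'1 log by (simp add: small_cumulants_def)
qed

text \<open>The factors are introduced one at a time, each attached to some j with n j > 0. On sets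
  containing j the new factor is the last of the product, where a is the sum of n' over I, so its
  exponent is the additive function d + n'; other sets are unaffected. The finite set R bounds the
  number of steps.\<close>

lemma small_cumulants_block:
  fixes n d :: "nat \<Rightarrow> nat"
  assumes f: "small_cumulants f" and u: "ord_ge 0 u" and R: "finite R" "\<And>i. i \<notin> R \<Longrightarrow> n i = 0"
  shows "small_cumulants (\<lambda>I. f I * (\<Prod>a<(\<Sum>i\<in>I. n i). 1 - u * qvar ^ ((\<Sum>i\<in>I. d i) + a)))"
  using R(2)
proof (induction "\<Sum>i\<in>R. n i" arbitrary: n)
  case 0
  then have "n i = 0" for i using R(1) by (cases "i \<in> R") auto
  then show ?case using f by simp
next
  case (Suc s)
  from Suc.hyps(2) obtain j where j: "j \<in> R" "n j \<noteq> 0"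
    by (metis Zero_not_Suc sum.neutral)
  define n' where "n' = n(j := n j - 1)"
  have sum: "(\<Sum>i\<in>I. n i) = (if j \<in> I then Suc (\<Sum>i\<in>I. n' i) else (\<Sum>i\<in>I. n' i))" if "finite I" for I
  proof (cases "j \<in> I")
    case True
    have "(\<Sum>i\<in>I - {j}. n i) = (\<Sum>i\<in>I - {j}. n' i)" by (rule sum.cong) (auto simp: n'_def)
    then show ?thesis using True that j(2) by (simp add: sum.remove[OF that True] n'_def)
  next
    case False
    have "(\<Sum>i\<in>I. n i) = (\<Sum>i\<in>I. n' i)" by (rule sum.cong) (use False in \<open>auto simp: n'_def\<close>)
    then show ?thesis using False by simp
  qed
  let ?g = "\<lambda>I. f I * (\<Prod>a<(\<Sum>i\<in>I. n' i). 1 - u * qvar ^ ((\<Sum>i\<in>I. d i) + a))"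
  have "small_cumulants ?g"
  proof (rule Suc.hyps(1))
    show "s = (\<Sum>i\<in>R. n' i)" using Suc.hyps(2) sum[OF R(1)] j(1) by simp
    show "n' i = 0" if "i \<notin> R" for i using Suc.prems[OF that] that j(1) by (auto simp: n'_def)
  qed
  from small_cumulants_step[OF this u, of j "\<lambda>i. d i + n' i"]
  show ?case
    by (rule small_cumulants_cong) (simp add: sum sum.distrib mult.assoc)
qed

section \<open>Factorisation of the normalising factors\<close>

lemma prod_telescope_intervals:
  fixes b :: "nat \<Rightarrow> nat"
  assumes "antimono b"
  shows "(\<Prod>k<M. \<Prod>j\<in>{b (Suc k)..<b k}. g j) = (\<Prod>j\<in>{b M..<b 0}. g j :: 'a::comm_monoid_mult)"
proof (induction M)
  case (Suc M)
  have "b (Suc M) \<le> b M" "b M \<le> b 0" using antimonoD[OF assms] by simp_all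
  then have "{b (Suc M)..<b 0} = {b M..<b 0} \<union> {b (Suc M)..<b M}" by auto
  then have "(\<Prod>j\<in>{b (Suc M)..<b 0}. g j) = (\<Prod>j\<in>{b M..<b 0}. g j) * (\<Prod>j\<in>{b (Suc M)..<b M}. g j)"
    by (simp add: prod.union_disjoint)
  then show ?case using Suc by simp
qed simp

text \<open>
  In row \<open>i\<close>, the cells with leg \<open>k\<close> are those in the columns between \<open>l\<^bsub>i+k+1\<^esub>\<close> and \<open>l\<^bsub>i+k\<^esub>\<close>.
  This makes the exponents additive in the partition.
\<close>

lemma macdonald_c_eq:
  assumes l: "is_partition l" and N: "\<And>i. i \<ge> N \<Longrightarrow> Poly_Mapping.lookup l i = 0"
  shows "macdonald_c l = (\<Prod>i<N. \<Prod>k<N.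
      \<Prod>a<Poly_Mapping.lookup l (i + k) - Poly_Mapping.lookup l (i + Suc k).
        1 - tvar ^ (k + 1) * qvar ^ (Poly_Mapping.lookup l i - Poly_Mapping.lookup l (i + k) + a))"
proof -
  let ?l = "Poly_Mapping.lookup l"
  have anti: "?l j \<le> ?l i" if "i \<le> j" for i j
    using l that by (auto simp: is_partition_def dest: antimonoD)
  have cells: "cells l = (SIGMA i:{..<N}. {..<?l i})"
    using N by (force simp: cells_def not_le[symmetric])
  have arm: "arm l (i, j) = ?l i - 1 - j" if "j < ?l i" for i j
  proof -
    have "{j'. j < j' \<and> (i, j') \<in> cells l} = {Suc j..<?l i}" by (auto simp: cells_def)
    then show ?thesis by (simp add: arm_def)
  qed
  have leg: "leg l (i, j) = k" if "?l (i + Suc k) \<le> j" "j < ?l (i + k)" for i j k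
  proof -
    have "{i'. i < i' \<and> (i', j) \<in> cells l} = {i<..i + k}"
    proof (intro set_eqI iffI)
      fix i' assume "i' \<in> {i'. i < i' \<and> (i', j) \<in> cells l}"
      then have i': "i < i'" "j < ?l i'" by (auto simp: cells_def)
      then have "i' \<le> i + k" using anti[of "i + Suc k" i'] that(1) by (cases "i' \<le> i + k") auto
      then show "i' \<in> {i<..i + k}" using i' by simp
    next
      fix i' assume "i' \<in> {i<..i + k}"
      then show "i' \<in> {i'. i < i' \<and> (i', j) \<in> cells l}" using anti[of i' "i + k"] that(2) by (auto simp: cells_def)
    qed
    then show ?thesis by (simp add: leg_def)
  qed
  have "macdonald_c l = (\<Prod>i<N. \<Prod>j<?l i. 1 - qvar ^ arm l (i, j) * tvar ^ (leg l (i, j) + 1))"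
    unfolding macdonald_c_def cells by (subst prod.Sigma) auto
  also have "\<dots> = (\<Prod>i<N. \<Prod>k<N. \<Prod>a<?l (i + k) - ?l (i + Suc k). 1 - tvar ^ (k + 1) * qvar ^ (?l i - ?l (i + k) + a))"
  proof (rule prod.cong[OF refl])
    fix i
    let ?g = "\<lambda>j. 1 - qvar ^ arm l (i, j) * tvar ^ (leg l (i, j) + 1)"
    have "antimono (\<lambda>k. ?l (i + k))" by (rule antimonoI) (simp add: anti)
    from prod_telescope_intervals[OF this, of ?g N]
    have "(\<Prod>j<?l i. ?g j) = (\<Prod>k<N. \<Prod>j\<in>{?l (i + Suc k)..<?l (i + k)}. ?g j)"
      using N[of "i + N"] by (simp add: lessThan_atLeast0)
    also have "\<dots> = (\<Prod>k<N. \<Prod>a<?l (i + k) - ?l (i + Suc k). 1 - tvar ^ (k + 1) * qvar ^ (?l i - ?l (i + k) + a))"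
    proof (rule prod.cong[OF refl])
      fix k
      show "(\<Prod>j\<in>{?l (i + Suc k)..<?l (i + k)}. ?g j) =
          (\<Prod>a<?l (i + k) - ?l (i + Suc k). 1 - tvar ^ (k + 1) * qvar ^ (?l i - ?l (i + k) + a))"
      \<comment> \<open>\<open>a\<close> counts columns from the right end of the interval, so that
        the arm becomes l_i - l_(i+k) + a.\<close>
      proof (rule prod.reindex_bij_witness[of _ "\<lambda>a. ?l (i + k) - 1 - a" "\<lambda>j. ?l (i + k) - 1 - j"])
        fix j assume j: "j \<in> {?l (i + Suc k)..<?l (i + k)}"
        then have "j < ?l i" using anti[of i "i + k"] by simp
        moreover have "?l i - ?l (i + k) + (?l (i + k) - 1 - j) = ?l i - 1 - j"
          using j anti[of i "i + k"] by simp
        ultimately show "1 - tvar ^ (k + 1) * qvar ^ (?l i - ?l (i + k) + (?l (i + k) - 1 - j)) = ?g j"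
          using j arm leg[of i k j] by (simp add: mult.commute)
      qed auto
    qed
    finally show "(\<Prod>j<?l i. ?g j) = (\<Prod>k<N. \<Prod>a<?l (i + k) - ?l (i + Suc k).
        1 - tvar ^ (k + 1) * qvar ^ (?l i - ?l (i + k) + a))" .
  qed
  finally show ?thesis .
qed

lemma lookup_eq_0_bound:
  fixes lam :: "nat \<Rightarrow> (nat \<Rightarrow>\<^sub>0 nat)"
  assumes "finite R"
  obtains N where "\<And>i k. i \<in> R \<Longrightarrow> k \<ge> N \<Longrightarrow> Poly_Mapping.lookup (lam i) k = 0"
proof -
  have fin: "finite (\<Union>i\<in>R. Poly_Mapping.keys (lam i))" using assms by simp
  then obtain N where N: "\<And>k. k \<in> (\<Union>i\<in>R. Poly_Mapping.keys (lam i)) \<Longrightarrow> k < N"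
    unfolding finite_nat_set_iff_bounded by blast
  show ?thesis
  proof (rule that[of N])
    fix i k assume "i \<in> R" "N \<le> k"
    then show "Poly_Mapping.lookup (lam i) k = 0"
      using N[of k] by (cases "k \<in> Poly_Mapping.keys (lam i)") (auto simp: in_keys_iff)
  qed
qed

lemma is_partition_0 [simp]: "is_partition 0"
  by (simp add: is_partition_def antimono_def)

lemma is_partition_sum: "(\<And>i. i \<in> I \<Longrightarrow> is_partition (lam i)) \<Longrightarrow> is_partition (\<Sum>i\<in>I. lam i)"
  unfolding is_partition_def antimono_def lookup_sum by (auto intro: sum_mono)

text \<open>Row lengths are additive in I, and so are the truncated differences \<open>?n\<close>
  and \<open>?d\<close>, because each partition is weakly decreasing. The cells of row i with leg k
  form one block with u = t^(k + 1).\<close>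

lemma small_cumulants_macdonald_c:
  assumes part: "\<And>i. is_partition (lam i)" and R: "finite R" "\<And>i. i \<notin> R \<Longrightarrow> lam i = 0"
  shows "small_cumulants (\<lambda>I. macdonald_c (\<Sum>i\<in>I. lam i))"
proof -
  obtain N where "\<And>i k. i \<in> R \<Longrightarrow> k \<ge> N \<Longrightarrow> Poly_Mapping.lookup (lam i) k = 0"
    using lookup_eq_0_bound[OF R(1)] by blast
  then have N: "Poly_Mapping.lookup (lam i) k = 0" if "k \<ge> N" for i k
    using R(2)[of i] that by (cases "i \<in> R") auto
  let ?n = "\<lambda>(i, k) j. Poly_Mapping.lookup (lam j) (i + k) - Poly_Mapping.lookup (lam j) (i + Suc k)"
  let ?d = "\<lambda>(i, k) j. Poly_Mapping.lookup (lam j) i - Poly_Mapping.lookup (lam j) (i + k)"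
  let ?blk = "\<lambda>p I. \<Prod>a<(\<Sum>j\<in>I. ?n p j). 1 - tvar ^ (snd p + 1) * qvar ^ ((\<Sum>j\<in>I. ?d p j) + a)"
  have "small_cumulants (\<lambda>I. \<Prod>p\<in>P. ?blk p I)" if "finite P" for P
    using that
  proof (induction P rule: finite_induct)
    case empty
    then show ?case by (simp add: small_cumulants_one)
  next
    case (insert p P)
    have "small_cumulants (\<lambda>I. (\<Prod>p\<in>P. ?blk p I) * ?blk p I)"
      by (rule small_cumulants_block[OF insert.IH ord_ge_0_power[OF ord_ge_0_tvar] R(1)])
         (simp add: R(2) case_prod_unfold)
    then show ?case using insert.hyps by (simp add: mult.commute)
  qed
  from this[of "{..<N} \<times> {..<N}"]
  have "small_cumulants (\<lambda>I. \<Prod>p\<in>{..<N} \<times> {..<N}. ?blk p I)" by simp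
  then show ?thesis
  proof (rule small_cumulants_cong[where g = "\<lambda>I. macdonald_c (\<Sum>i\<in>I. lam i)"])
    fix I :: "nat set" assume "finite I"
    have anti: "Poly_Mapping.lookup (lam j) k' \<le> Poly_Mapping.lookup (lam j) k" if "k \<le> k'" for j k k'
      by (rule antimonoD[OF part[of j, unfolded is_partition_def] that])
    have diff: "(\<Sum>j\<in>I. Poly_Mapping.lookup (lam j) k) - (\<Sum>j\<in>I. Poly_Mapping.lookup (lam j) k') =
        (\<Sum>j\<in>I. Poly_Mapping.lookup (lam j) k - Poly_Mapping.lookup (lam j) k')" if "k \<le> k'" for k k'
      by (rule sum_subtractf_nat[symmetric]) (rule anti[OF that])
    have part_sum: "is_partition (\<Sum>i\<in>I. lam i)" by (rule is_partition_sum) (rule part)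
    have "macdonald_c (\<Sum>i\<in>I. lam i) = (\<Prod>i<N. \<Prod>k<N. ?blk (i, k) I)"
      using macdonald_c_eq[OF part_sum, of N] by (simp add: N lookup_sum diff)
    then show "(\<Prod>p\<in>{..<N} \<times> {..<N}. ?blk p I) = macdonald_c (\<Sum>i\<in>I. lam i)"
      by (simp add: prod.cartesian_product case_prod_unfold)
  qed
qed


section \<open>Smallness of the Macdonald cumulants\<close>

definition sym_ord_ge :: "nat \<Rightarrow> qt_field symfun \<Rightarrow> bool" where
  "sym_ord_ge k f \<longleftrightarrow> (\<forall>a. ord_ge k (sym_coeff f a))"

interpretation sym_ord_ge: ring_filtration sym_ord_ge
proof
  fix j k and f g :: "qt_field symfun"
  show "sym_ord_ge k 0" by (simp add: sym_ord_ge_def)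
  show "sym_ord_ge 0 1" by (simp add: sym_ord_ge_def sym_coeff_one ord_ge_0_one)
  show "sym_ord_ge k f \<Longrightarrow> sym_ord_ge k g \<Longrightarrow> sym_ord_ge k (f + g)"
    by (simp add: sym_ord_ge_def sym_coeff_add ord_ge_add)
  show "sym_ord_ge j f \<Longrightarrow> sym_ord_ge k g \<Longrightarrow> sym_ord_ge (j + k) (f * g)"
    unfolding sym_ord_ge_def sym_coeff_mult conv_def by (auto intro!: ord_ge_sum ord_ge_mult)
qed

interpretation fps_ord_ge: ring_filtration "\<lambda>k F. \<forall>n. sym_ord_ge k (fps_nth F n)"
proof
  fix j k and F G :: "qt_field symfun fps"
  show "\<forall>n. sym_ord_ge k (fps_nth 0 n)" by (simp add: sym_ord_ge.filt_zero)
  show "\<forall>n. sym_ord_ge 0 (fps_nth 1 n)" by (simp add: sym_ord_ge.filt_zero sym_ord_ge.filt_one)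
  show "\<forall>n. sym_ord_ge k (fps_nth F n) \<Longrightarrow> \<forall>n. sym_ord_ge k (fps_nth G n) \<Longrightarrow> \<forall>n. sym_ord_ge k (fps_nth (F + G) n)"
    by (simp add: sym_ord_ge.filt_add)
  show "\<forall>n. sym_ord_ge j (fps_nth F n) \<Longrightarrow> \<forall>n. sym_ord_ge k (fps_nth G n) \<Longrightarrow> \<forall>n. sym_ord_ge (j + k) (fps_nth (F * G) n)"
    by (auto simp: fps_mult_nth intro!: sym_ord_ge.filt_sum sym_ord_ge.filt_mult)
qed

lemma sym_ord_ge_scale: "ord_ge j c \<Longrightarrow> sym_ord_ge k f \<Longrightarrow> sym_ord_ge (j + k) (sym_scale c f)"
  by (simp add: sym_ord_ge_def sym_coeff_scale ord_ge_mult)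

lemma sym_ord_ge_diff: "sym_ord_ge k f \<Longrightarrow> sym_ord_ge k g \<Longrightarrow> sym_ord_ge k (f - g)"
  by (simp add: sym_ord_ge_def sym_coeff_diff ord_ge_diff)

lemma sym_ord_ge_hperp: "sym_ord_ge k f \<Longrightarrow> sym_ord_ge k (hperp i f)"
  by (simp add: sym_ord_ge_def sym_coeff_hperp)

text \<open>At q = 1 the shift is the identity. In the recursion the summand i = 0 combines with the
  leading term to (q^m - 1) times \<open>hperp m f\<close>, which has the extra factor.\<close>

lemma sym_ord_ge_qshift:
  assumes "sym_ord_ge k f" "m \<ge> 1"
  shows "sym_ord_ge (Suc k) (qshift qvar m f)"
  using assms(2)
proof (induction m rule: less_induct)
  case (less m)
  have "{..<m} = insert 0 {1..<m}" using less.prems by auto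
  then have "qshift qvar m f =
      sym_scale (qvar ^ m - 1) (hperp m f) - (\<Sum>i\<in>{1..<m}. hperp (m - i) (qshift qvar i f))"
    by (simp add: qshift.simps[of qvar m] sym_scale_diff_left)
  moreover have "sym_ord_ge (1 + k) (sym_scale (qvar ^ m - 1) (hperp m f))"
    by (intro sym_ord_ge_scale ord_ge_q_power sym_ord_ge_hperp assms(1))
  moreover have "sym_ord_ge (Suc k) (\<Sum>i\<in>{1..<m}. hperp (m - i) (qshift qvar i f))"
    by (intro sym_ord_ge.filt_sum sym_ord_ge_hperp less.IH) auto
  ultimately show ?case by (simp add: sym_ord_ge_diff)
qed

lemma sym_ord_ge_gfun: "sym_ord_ge 0 (gfun svar n)"
  unfolding sym_ord_ge_def sym_coeff_gfun
  by (auto intro!: ord_ge_0_power ord_ge_diff ord_ge_0_one ord_ge_0_svar)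

lemma sym_ord_ge_mac_H_diff:
  assumes "sym_ord_ge k f"
  shows "sym_ord_ge (Suc k) (mac_H svar qvar f - f)"
proof -
  obtain N where N: "deg_le N f" using ex_deg_le by blast
  have "{..N} = insert 0 {1..N}" by auto
  then have "mac_H svar qvar f - f = (\<Sum>m\<in>{1..N}. gfun svar (int m) * qshift qvar m f)"
    by (simp add: mac_H_eq[OF N] macop_def)
  moreover have "sym_ord_ge (0 + Suc k) (gfun svar (int m) * qshift qvar m f)" if "m \<ge> 1" for m
    by (intro sym_ord_ge.filt_mult sym_ord_ge_gfun sym_ord_ge_qshift assms that)
  ultimately show ?thesis by (auto intro!: sym_ord_ge.filt_sum)
qed

text \<open>All exponent vectors are tested, not only partitions as in \<open>supp_in\<close>; this
  makes the notion compatible with products.\<close>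

definition dominated_by :: "(nat \<Rightarrow>\<^sub>0 nat) \<Rightarrow> 'a::zero symfun \<Rightarrow> bool" where
  "dominated_by l f \<longleftrightarrow> (\<forall>a. sym_coeff f a \<noteq> 0 \<longrightarrow> dominated a l)"

lemma dominated_by_diff: "dominated_by l f \<Longrightarrow> dominated_by l g \<Longrightarrow> dominated_by l (f - g)"
  by (auto simp: dominated_by_def sym_coeff_diff) metis

lemma dominated_by_sum:
  assumes "\<And>i. i \<in> A \<Longrightarrow> dominated_by l (f i)"
  shows "dominated_by l (\<Sum>i\<in>A. f i)"
  unfolding dominated_by_def sym_coeff_sum
proof (intro allI impI)
  fix a assume "(\<Sum>i\<in>A. sym_coeff (f i) a) \<noteq> 0"
  then obtain i where "i \<in> A" "sym_coeff (f i) a \<noteq> 0"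
    by (rule sum.not_neutral_contains_not_neutral)
  then show "dominated a l" using assms[of i] by (simp add: dominated_by_def)
qed

lemma dominated_add: "dominated a l \<Longrightarrow> dominated b m \<Longrightarrow> dominated (a + b) (l + m)"
  by (simp add: dominated_def weight_add lookup_add sum.distrib add_mono)

lemma dominated_by_mult:
  assumes "dominated_by l f" "dominated_by m g"
  shows "dominated_by (l + m) (f * g)"
  unfolding dominated_by_def
proof (intro allI impI)
  fix a assume "sym_coeff (f * g) a \<noteq> 0"
  then obtain b c where bc: "b + c = a" "sym_coeff f b * sym_coeff g c \<noteq> 0"
    using sym_coeff_mult_eq_0[of a f g] by metis
  then have "sym_coeff f b \<noteq> 0" "sym_coeff g c \<noteq> 0" by auto
  then show "dominated a (l + m)"
    using assms bc(1) dominated_add by (auto simp: dominated_by_def)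
qed

text \<open>If b + c = l + m with b below l and c below m, the inequalities between partial sums add
  up to equalities, so (l, m) is the only contributing splitting.\<close>

lemma sym_coeff_mult_leading:
  assumes "dominated_by l f" "dominated_by m g"
  shows "sym_coeff (f * g) (l + m) = sym_coeff f l * sym_coeff g m"
proof -
  have *: "b = l \<and> c = m" if bc: "b + c = l + m" "sym_coeff f b * sym_coeff g c \<noteq> 0" for b c
  proof -
    have "sym_coeff f b \<noteq> 0" "sym_coeff g c \<noteq> 0" using bc(2) by auto
    then have le: "psum b k \<le> psum l k" "psum c k \<le> psum m k" for k
      using assms by (simp_all add: dominated_by_def dominated_def)
    have sum: "psum b k + psum c k = psum l k + psum m k" for k
      using psum_add[of b c k] psum_add[of l m k] bc(1) by simp
    have "psum b k = psum l k" "psum c k = psum m k" for k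
      using le[of k] sum[of k] by linarith+
    then show ?thesis by (intro conjI psum_eqD)
  qed
  have "sym_coeff (f * g) (l + m) = (\<Sum>p\<in>{(l, m)}. case p of (b, c) \<Rightarrow> sym_coeff f b * sym_coeff g c)"
    unfolding sym_coeff_mult conv_def
    by (rule sum.mono_neutral_right) (use * finite_splittings[of "l + m"] in auto)
  then show ?thesis by simp
qed

lemma dominated_by_macdonald_J:
  assumes l: "is_partition l"
  shows "dominated_by l (macdonald_J l)"
    and "sym_coeff (macdonald_J l) l = macdonald_c l"
proof -
  have low: "sym_coeff (macdonald_P l - monomial_sym l) m = 0" if "is_partition m" "m \<notin> lower l" for m
    using supp_in_macdonald_P[OF l] that by (auto simp: supp_in_def)
  show "sym_coeff (macdonald_J l) l = macdonald_c l"
    using low[OF l] by (simp add: macdonald_J_def sym_coeff_scale sym_coeff_diff sym_coeff_monomial lower_def)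
  show "dominated_by l (macdonald_J l)"
    unfolding dominated_by_def
  proof (intro allI impI)
    fix a assume nz: "sym_coeff (macdonald_J l) a \<noteq> 0"
    obtain m where m: "is_partition m" "rearrangement m a" by (rule ex_partition_rearrangement)
    then have "sym_coeff (macdonald_P l) a = sym_coeff (macdonald_P l) m"
      by (auto simp: rearrangement_def sym_coeff_map_key)
    then have nz': "sym_coeff (macdonald_P l) m \<noteq> 0"
      using nz by (auto simp: macdonald_J_def sym_coeff_scale)
    have "dominated m l"
    proof (cases "m \<in> lower l \<or> m = l")
      case False
      then have "sym_coeff (macdonald_P l) m = 0"
        using low[OF m(1)] l m(1) by (simp add: sym_coeff_diff sym_coeff_monomial_partition)
      with nz' show ?thesis by simp
    qed (auto simp: lower_def)
    moreover have "dominated a m"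
      using psum_rearrangement_le[OF m] weight_rearrangement[OF m(2)] by (simp add: dominated_def)
    ultimately show "dominated a l" by (rule dominated_trans[rotated])
  qed
qed

lemma macdonald_J_0: "macdonald_J 0 = 1"
proof -
  have "m = 0" if "dominated m 0" for m
    using that by (intro psum_eqD) (simp add: dominated_def)
  then have "lower 0 = {}" by (auto simp: lower_def)
  then have "macdonald_P 0 - monomial_sym 0 = 0"
    using supp_in_macdonald_P[OF is_partition_0] by (intro supp_in_empty) simp
  moreover have "monomial_sym 0 = (1 :: qt_field symfun)"
    by (rule symfun_eq_partitionI) (simp add: sym_coeff_monomial_partition sym_coeff_one)
  moreover have "macdonald_c 0 = 1" by (simp add: macdonald_c_def cells_def)
  ultimately show ?thesis by (simp add: macdonald_J_def)
qed

lemma deg_le_dominated_by: "dominated_by l f \<Longrightarrow> deg_le (weight l) f"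
  by (auto simp: dominated_by_def deg_le_def dominated_def)

lemma ord_ge_Suc_cancel: "ord_ge (Suc k) ((qvar - 1) * x) \<Longrightarrow> ord_ge k x"
  using qvar_neq_1 by (simp add: ord_ge_def)

text \<open>
  At \<open>q = 1\<close>, the operator \<open>(H - ev) / (q - 1)\<close> is triangular with respect to dominance, and
  its diagonal entries below \<open>l\<close> do not vanish.
\<close>

lemma sym_ord_ge_if_eigen:
  assumes l: "is_partition l" and f: "dominated_by l f"
    and H: "sym_ord_ge (Suc k) (mac_H svar qvar f - sym_scale (mac_ev svar qvar l) f)"
    and lead: "ord_ge k (sym_coeff f l)"
  shows "sym_ord_ge k f"
proof -
  let ?S = "{m. is_partition m \<and> dominated m l}"
  have S: "?S = insert l (lower l)" using l by (auto simp: lower_def)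
  then have fin: "finite ?S" using finite_lower[of l] by simp
  have supp: "supp_in ?S f" using f by (auto simp: supp_in_def dominated_by_def)
  have "ord_ge k (sym_coeff f a)" if "a \<in> ?S" for a
    using that
  \<comment> \<open>Downward induction from l: the measure counts the partitions between
    \<open>a\<close> and l.\<close>
  proof (induction "card {m \<in> ?S. dominated a m}" arbitrary: a rule: less_induct)
    case less
    then have a: "is_partition a" "dominated a l" by auto
    show ?case
    proof (cases "a = l")
      case False
      let ?h = "\<lambda>m. sym_coeff (mac_H svar qvar (monomial_sym m)) a"
      have "mac_H svar qvar f = (\<Sum>m\<in>?S. sym_scale (sym_coeff f m) (mac_H svar qvar (monomial_sym m)))"
        by (subst supp_in_expansion[OF fin _ supp]) (simp_all add: mac_H_sum mac_H_scale)
      then have "sym_coeff (mac_H svar qvar f) a = (\<Sum>m\<in>?S. sym_coeff f m * ?h m)"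
        by (simp add: sym_coeff_sum sym_coeff_scale)
      also have "\<dots> = sym_coeff f a * ?h a + (\<Sum>m\<in>?S - {a}. sym_coeff f m * ?h m)"
        using less.prems fin by (simp add: sum.remove)
      also have "?h a = mac_ev svar qvar a" by (rule mac_H_monomial_diag[OF a(1)])
      finally have eq: "(mac_ev svar qvar a - mac_ev svar qvar l) * sym_coeff f a =
          sym_coeff (mac_H svar qvar f - sym_scale (mac_ev svar qvar l) f) a
          - (\<Sum>m\<in>?S - {a}. sym_coeff f m * ?h m)"
        by (simp add: sym_coeff_diff sym_coeff_scale algebra_simps)
      have "ord_ge (Suc k) (sym_coeff f m * ?h m)" if m: "m \<in> ?S - {a}" for m
      proof (cases "dominated a m")
        case False
        then have "?h m = 0" using mac_H_monomial_dominated[of m] m by blast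
        then show ?thesis by simp
      next
        case True
        have "{m' \<in> ?S. dominated m m'} \<subset> {m' \<in> ?S. dominated a m'}"
        proof
          show "{m' \<in> ?S. dominated m m'} \<subseteq> {m' \<in> ?S. dominated a m'}"
            using True dominated_trans by blast
          have "a \<in> {m' \<in> ?S. dominated a m'}" "a \<notin> {m' \<in> ?S. dominated m m'}"
            using less.prems True m dominated_antisym by auto
          then show "{m' \<in> ?S. dominated m m'} \<noteq> {m' \<in> ?S. dominated a m'}" by blast
        qed
        then have "card {m' \<in> ?S. dominated m m'} < card {m' \<in> ?S. dominated a m'}"
          by (rule psubset_card_mono[OF finite_subset[OF _ fin], rotated]) auto
        then have "ord_ge k (sym_coeff f m)" using m by (intro less.hyps) auto
        \<comment> \<open>Off the diagonal, H has the same entries as H - 1, which is divisible by q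
          - 1.\<close>
        moreover have "ord_ge 1 (?h m)"
        proof -
          have "sym_ord_ge 0 (monomial_sym m)"
            by (simp add: sym_ord_ge_def sym_coeff_monomial ord_ge_0_one)
          then have "sym_ord_ge (Suc 0) (mac_H svar qvar (monomial_sym m) - monomial_sym m)"
            by (rule sym_ord_ge_mac_H_diff)
          then have "ord_ge 1 (sym_coeff (mac_H svar qvar (monomial_sym m) - monomial_sym m) a)"
            by (simp add: sym_ord_ge_def)
          then show ?thesis
            using m a(1) by (auto simp: sym_coeff_diff sym_coeff_monomial_partition)
        qed
        ultimately show ?thesis using ord_ge_mult[of k _ 1] by simp
      qed
      then have "ord_ge (Suc k) ((mac_ev svar qvar a - mac_ev svar qvar l) * sym_coeff f a)"
        unfolding eq using H by (intro ord_ge_diff ord_ge_sum) (auto simp: sym_ord_ge_def)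
      moreover obtain v where v: "v \<noteq> 0"
        "has_value 1 ((mac_ev svar qvar a - mac_ev svar qvar l) / (qvar - 1)) v"
        using mac_ev_diff_value[OF False] by (elim exE conjE)
      moreover have "(mac_ev svar qvar a - mac_ev svar qvar l) * sym_coeff f a =
          (qvar - 1) * ((mac_ev svar qvar a - mac_ev svar qvar l) / (qvar - 1) * sym_coeff f a)"
        using qvar_neq_1 by simp
      ultimately have "ord_ge k ((mac_ev svar qvar a - mac_ev svar qvar l) / (qvar - 1) * sym_coeff f a)"
        by (metis ord_ge_Suc_cancel)
      then show ?thesis by (rule ord_ge_cancel[OF v(2,1)])
    qed (simp add: lead)
  qed
  moreover have "sym_coeff f a = 0" if "is_partition a" "a \<notin> ?S" for a
    using supp that by (auto simp: supp_in_def)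
  ultimately have part: "ord_ge k (sym_coeff f a)" if "is_partition a" for a
    using that by (cases "a \<in> ?S") auto
  show ?thesis
    unfolding sym_ord_ge_def
  proof
    fix a
    obtain m where m: "is_partition m" "rearrangement m a" by (rule ex_partition_rearrangement)
    then have "sym_coeff f a = sym_coeff f m" by (auto simp: rearrangement_def sym_coeff_map_key)
    then show "ord_ge k (sym_coeff f a)" using part[OF m(1)] by simp
  qed
qed

text \<open>With all z-coefficients collected, the shift is a ring homomorphism into power series,
  along which cumulants can be transported.\<close>

definition qshift_fps :: "'a::comm_ring_1 \<Rightarrow> 'a symfun \<Rightarrow> 'a symfun fps" where
  "qshift_fps q f = Abs_fps (\<lambda>m. qshift q m f)"

lemma qshift_fps_nth [simp]: "fps_nth (qshift_fps q f) m = qshift q m f"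
  by (simp add: qshift_fps_def)

lemma is_cumulant_qshift_fps:
  assumes "is_cumulant F K"
  shows "is_cumulant (\<lambda>I. qshift_fps q (F I)) (\<lambda>I. qshift_fps q (K I))"
  using assms
  by (rule is_cumulant_hom)
     (auto intro!: fps_ext simp: qshift_one qshift_add qshift_mult fps_mult_nth atMost_atLeast0)

text \<open>What H does after the shift: multiply by the kernel and take the constant term in z.
  This is linear over symmetric functions but not multiplicative, so the division by F takes place
  among power series.\<close>

definition mac_L :: "nat \<Rightarrow> qt_field symfun fps \<Rightarrow> qt_field symfun" where
  "mac_L N X = (\<Sum>m\<le>N. gfun svar (int m) * fps_nth X m)"

lemma mac_L_qshift_fps: "deg_le N f \<Longrightarrow> mac_L N (qshift_fps qvar f) = mac_H svar qvar f"
  by (simp add: mac_L_def mac_H_eq macop_def)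

lemma mac_L_const_mult: "mac_L N (fps_const f * X) = f * mac_L N X"
  by (simp add: mac_L_def sum_distrib_left mult_ac)

lemma mac_L_const: "mac_L N (fps_const f) = f"
proof -
  have "mac_L N (fps_const f) = (\<Sum>m\<le>N. if m = 0 then f else 0)"
    unfolding mac_L_def by (intro sum.cong) auto
  then show ?thesis by simp
qed

lemma mac_L_diff: "mac_L N (X - Y) = mac_L N X - mac_L N Y"
  by (simp add: mac_L_def right_diff_distrib sum_subtractf)

lemma mac_L_sum: "mac_L N (\<Sum>i\<in>A. X i) = (\<Sum>i\<in>A. mac_L N (X i))"
  unfolding mac_L_def fps_sum_nth sum_distrib_left by (rule sum.swap)

lemma sym_ord_ge_mac_L:
  assumes "\<forall>n. sym_ord_ge k (fps_nth X n)"
  shows "sym_ord_ge k (mac_L N X)"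
proof -
  have "sym_ord_ge (0 + k) (gfun svar (int m) * fps_nth X m)" for m
    using assms by (intro sym_ord_ge.filt_mult sym_ord_ge_gfun) auto
  then show ?thesis unfolding mac_L_def by (intro sym_ord_ge.filt_sum) auto
qed

lemma set_conv_const_left: "mac_L N (set_conv (\<lambda>I. fps_const (F I)) W I) = set_conv F (\<lambda>I. mac_L N (W I)) I"
  by (simp add: set_conv_def mac_L_sum mac_L_const_mult)

lemma set_conv_delta:
  assumes "finite I"
  shows "set_conv F (\<lambda>A. if A = {} then 1 else 0) I = F I"
proof -
  have "set_conv F (\<lambda>A. if A = {} then 1 else 0) I = (\<Sum>A | A \<subseteq> I. if A = I then F I else 0)"
    unfolding set_conv_def by (intro sum.cong) auto
  then show ?thesis using finite_subsets[OF assms] by simp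
qed

text \<open>
  The eigenvalue equation \<open>H (F I) = ev I F I\<close> holds with \<open>F I = J\<close> at the sum of the partitions
  in \<open>I\<close>. Both sides are written as \<open>F\<close> convolved with an exponential: on the left the shift is
  a ring homomorphism, and on the right \<open>q^(l\<^sub>k)\<close> is multiplicative in \<open>l\<close>. Dividing by \<open>F\<close> leaves
  an equation in which the nonlinear terms only involve cumulants of smaller sets.
\<close>

lemma mac_H_cumulant:
  fixes lam :: "nat \<Rightarrow> (nat \<Rightarrow>\<^sub>0 nat)"
  defines "lamI \<equiv> \<lambda>I. \<Sum>i\<in>I. lam i"
  assumes F: "is_cumulant F K" and I: "finite I" "I \<noteq> {}"
    and dom: "\<And>A. A \<subseteq> I \<Longrightarrow> dominated_by (lamI A) (F A)" "dominated_by (lamI I) (K I)"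
    and ev: "\<And>A. A \<subseteq> I \<Longrightarrow> mac_H svar qvar (F A) = sym_scale (mac_ev svar qvar (lamI A)) (F A)"
    and IH: "\<And>B. B \<subset> I \<Longrightarrow> B \<noteq> {} \<Longrightarrow> sym_ord_ge (card B - 1) (K B)"
  shows "sym_ord_ge (card I) (mac_H svar qvar (K I) - sym_scale (mac_ev svar qvar (lamI I)) (K I))"
proof -
  define N where "N = weight (lamI I)"
  obtain n where n: "\<And>i k. i \<in> I \<Longrightarrow> k \<ge> n \<Longrightarrow> Poly_Mapping.lookup (lam i) k = 0"
    using lookup_eq_0_bound[OF I(1)] by blast
  have fin: "finite A" if "A \<subseteq> I" for A using that I(1) finite_subset by auto
  have split: "lamI A = lamI B + lamI (A - B)" if "finite A" "B \<subseteq> A" for A B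
    using sum.subset_diff[OF that(2,1), of lam] by (simp add: lamI_def add.commute)
  have F1: "F {} = 1" using F by (rule is_cumulant_empty)
  have wt: "weight (lamI A) \<le> N" if "A \<subseteq> I" for A
    unfolding N_def split[OF I(1) that] by (simp add: weight_add)
  have degF: "deg_le N (F A)" if "A \<subseteq> I" for A
    by (rule deg_le_mono[OF deg_le_dominated_by[OF dom(1)[OF that]] wt[OF that]])
  have degK: "deg_le N (K I)"
    unfolding N_def by (rule deg_le_dominated_by[OF dom(2)])
  have card: "Suc (card B - 1) = card B" if "B \<subseteq> I" "B \<noteq> {}" for B
    using fin[OF that(1)] that(2) card_gt_0_iff[of B] by simp

  define \<delta> :: "nat set \<Rightarrow> qt_field symfun" where "\<delta> A = (if A = {} then 1 else 0)" for A
  \<comment> \<open>\<open>DT\<close> and \<open>DQ k\<close> are the logarithms of the quotients by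
    F of the shifted F and of F twisted by the length of row k.\<close>
  define DT where "DT B = qshift_fps qvar (K B) - fps_const (K B)" for B
  define Q where "Q k A = qvar ^ Poly_Mapping.lookup (lamI A) k" for k A
  define DQ where "DQ k B = sym_scale (Q k B) 1 * K B - K B" for k B
  define w where "w A = mac_L N (set_exp DT A)" for A
  \<comment> \<open>The eigenvalue divided through by F: \<open>\<delta>\<close>, the unit of
    convolution, replaces the constant 1, and the exponential of \<open>DQ k\<close> replaces the
    power of q for row k.\<close>
  define v where "v A = \<delta> A + sym_scale (1 - svar) (\<Sum>k<n. sym_scale (svar ^ k) (set_exp (DQ k) A - \<delta> A))" for A

  have constF: "is_cumulant (\<lambda>A. fps_const (F A)) (\<lambda>A. fps_const (K A))"
    by (rule is_cumulant_hom[OF F]) simp_all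
  have Qsplit: "sym_scale (Q k A) 1 = sym_scale (Q k B) 1 * sym_scale (Q k (A - B)) (1 :: qt_field symfun)"
    if "finite A" "B \<subseteq> A" for A B k
    unfolding Q_def split[OF that] by (simp add: lookup_add power_add mult.commute)
  have QF: "is_cumulant (\<lambda>A. sym_scale (Q k A) 1 * F A) (\<lambda>A. sym_scale (Q k A) 1 * K A)" for k
    by (rule is_cumulant_twist[OF F _ Qsplit]) (simp_all add: Q_def lamI_def)

  have scale_ev: "sym_scale (mac_ev svar qvar (lamI A)) f =
      f + sym_scale (1 - svar) (\<Sum>k<n. sym_scale (svar ^ k) (sym_scale (Q k A) 1 * f - f))"
    if A: "A \<subseteq> I" for A f
  proof -
    have "Poly_Mapping.keys (lamI A) \<subseteq> {..<n}"
    proof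
      fix k assume "k \<in> Poly_Mapping.keys (lamI A)"
      then have "(\<Sum>i\<in>A. Poly_Mapping.lookup (lam i) k) \<noteq> 0"
        by (simp add: in_keys_iff lamI_def lookup_sum)
      then obtain i where "i \<in> A" "Poly_Mapping.lookup (lam i) k \<noteq> 0"
        by (rule sum.not_neutral_contains_not_neutral)
      then show "k \<in> {..<n}" using n[of i k] A by (cases "k \<ge> n") auto
    qed
    then have "mac_ev svar qvar (lamI A) = 1 + (1 - svar) * (\<Sum>k<n. svar ^ k * (Q k A - 1))"
      by (simp add: mac_ev_superset[of "{..<n}"] Q_def)
    then show ?thesis
      by (simp only: sym_scale_add_left sym_scale_scale[symmetric] sym_scale_sum_left sym_scale_diff_left
          sym_scale_1 sym_scale_mult_left mult_1)
  qed

  have "set_conv F w A = set_conv F v A" if A: "A \<subseteq> I" for A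
  proof -
    have "set_conv F w A = mac_L N (qshift_fps qvar (F A))"
      using is_cumulant_quotient[OF constF is_cumulant_qshift_fps[OF F, of qvar] fin[OF A]]
      by (simp add: w_def[abs_def] DT_def[abs_def] set_conv_const_left)
    also have "\<dots> = sym_scale (mac_ev svar qvar (lamI A)) (F A)"
      using ev[OF A] mac_L_qshift_fps[OF degF[OF A]] by simp
    also have "\<dots> = F A + sym_scale (1 - svar) (\<Sum>k<n. sym_scale (svar ^ k) (sym_scale (Q k A) 1 * F A - F A))"
      by (rule scale_ev[OF A])
    also have "\<dots> = set_conv F \<delta> A + sym_scale (1 - svar)
        (\<Sum>k<n. sym_scale (svar ^ k) (set_conv F (set_exp (DQ k)) A - set_conv F \<delta> A))"
    proof -
      have "set_conv F \<delta> A = F A" using set_conv_delta[OF fin[OF A], of F] by (simp add: \<delta>_def[abs_def])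
      moreover have "set_conv F (set_exp (DQ k)) A = sym_scale (Q k A) 1 * F A" for k
        using is_cumulant_quotient[OF F QF fin[OF A], of k] by (simp only: DQ_def[abs_def])
      ultimately show ?thesis by (simp only:)
    qed
    also have "\<dots> = set_conv F v A"
    proof -
      have "set_conv F v A = set_conv F \<delta> A + (\<Sum>B | B \<subseteq> A. sym_scale (1 - svar)
          (\<Sum>k<n. sym_scale (svar ^ k) (F B * set_exp (DQ k) (A - B) - F B * \<delta> (A - B))))"
        by (simp add: set_conv_def v_def distrib_left sum.distrib sum_distrib_left right_diff_distrib)
      also have "\<dots> = set_conv F \<delta> A + sym_scale (1 - svar)
          (\<Sum>k<n. sym_scale (svar ^ k) (set_conv F (set_exp (DQ k)) A - set_conv F \<delta> A))"
        by (simp only: sym_scale_sum_right[symmetric] sum.swap[of _ "{..<n}"] set_conv_def sum_subtractf)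
      finally show ?thesis ..
    qed
    finally show ?thesis .
  qed
  then have "w I = v I" using set_conv_cancel[of F I w v, OF F1 I(1)] by blast
  then have wv: "w I = sym_scale (1 - svar) (\<Sum>k<n. sym_scale (svar ^ k) (set_exp (DQ k) I))"
    using I(2) by (simp add: v_def \<delta>_def)

  have "\<forall>m. sym_ord_ge (card I) (fps_nth (set_exp DT I - DT I) m)"
  proof (rule fps_ord_ge.filt_set_exp_diff[OF I])
    fix B assume B: "B \<subset> I" "B \<noteq> {}"
    \<comment> \<open>Only m >= 1 matters: the constant subtracted in \<open>DT B\<close> is its
      coefficient at m = 0, the one without an extra factor q - 1.\<close>
    have "sym_ord_ge (Suc (card B - 1)) (qshift qvar m (K B))" if "m \<ge> 1" for m
      by (rule sym_ord_ge_qshift[OF IH[OF B] that])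
    moreover have "Suc (card B - 1) = card B" using card B by auto
    ultimately show "\<forall>m. sym_ord_ge (card B) (fps_nth (DT B) m)"
      by (auto simp: DT_def sym_ord_ge.filt_zero)
  qed
  then have "sym_ord_ge (card I) (w I - mac_L N (DT I))"
    unfolding w_def mac_L_diff[symmetric] by (rule sym_ord_ge_mac_L)
  moreover have "mac_L N (DT I) = mac_H svar qvar (K I) - K I"
    by (simp add: DT_def mac_L_diff mac_L_const mac_L_qshift_fps[OF degK])
  ultimately have 1: "sym_ord_ge (card I) (w I - (mac_H svar qvar (K I) - K I))" by simp

  have "sym_ord_ge (card I) (set_exp (DQ k) I - DQ k I)" for k
  proof (rule sym_ord_ge.filt_set_exp_diff[OF I])
    fix B assume B: "B \<subset> I" "B \<noteq> {}"
    have "sym_ord_ge (1 + (card B - 1)) (sym_scale (Q k B - 1) (K B))"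
      unfolding Q_def by (intro sym_ord_ge_scale ord_ge_q_power IH B)
    moreover have "1 + (card B - 1) = card B" using card B by auto
    ultimately show "sym_ord_ge (card B) (DQ k B)"
      by (simp add: DQ_def sym_scale_diff_left)
  qed
  then have "sym_ord_ge (0 + card I) (sym_scale (svar ^ k) (set_exp (DQ k) I - DQ k I))" for k
    by (intro sym_ord_ge_scale ord_ge_0_power ord_ge_0_svar)
  then have "sym_ord_ge (0 + card I)
      (sym_scale (1 - svar) (\<Sum>k<n. sym_scale (svar ^ k) (set_exp (DQ k) I - DQ k I)))"
    by (intro sym_ord_ge_scale sym_ord_ge.filt_sum ord_ge_diff ord_ge_0_one ord_ge_0_svar) simp
  then have 2: "sym_ord_ge (card I) (w I - sym_scale (1 - svar) (\<Sum>k<n. sym_scale (svar ^ k) (DQ k I)))"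
    unfolding wv by (simp add: sym_scale_diff_right sum_subtractf)

  have "sym_scale (1 - svar) (\<Sum>k<n. sym_scale (svar ^ k) (DQ k I)) =
      sym_scale (mac_ev svar qvar (lamI I)) (K I) - K I"
    unfolding scale_ev[OF order_refl] DQ_def by simp
  with sym_ord_ge_diff[OF 2 1]
  show ?thesis by simp
qed

theorem theorem1p3:
  fixes r :: nat and lam :: "nat \<Rightarrow> (nat \<Rightarrow>\<^sub>0 nat)"
  assumes "r \<ge> 1"
    and "\<And>i. i \<in> {1..r} \<Longrightarrow> is_partition (lam i)"
  shows "big_O1 (macdonald_cumulant r lam) ((qvar - 1) ^ (r - 1))"
proof -
  \<comment> \<open>Extension by the empty partition makes \<open>F\<close> well-behaved on all
    finite sets of naturals and keeps the family finitely supported.\<close>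
  define lam' where "lam' i = (if i \<in> {1..r} then lam i else 0)" for i
  define lamI where "lamI I = (\<Sum>i\<in>I. lam' i)" for I
  define F where "F I = macdonald_J (lamI I)" for I
  define K where "K = set_log F"
  have part: "is_partition (lam' i)" for i using assms(2) by (simp add: lam'_def)
  have partI: "is_partition (lamI I)" for I unfolding lamI_def by (rule is_partition_sum) (rule part)
  have split: "lamI A = lamI B + lamI (A - B)" if "finite A" "B \<subseteq> A" for A B
    using sum.subset_diff[OF that(2,1), of lam'] by (simp add: lamI_def add.commute)
  have F1: "F {} = 1" by (simp add: F_def lamI_def macdonald_J_0)
  have K: "is_cumulant F K" unfolding K_def by (rule is_cumulant_set_log[of F, OF F1])
  have domF: "dominated_by (lamI A) (F A)" for A
    unfolding F_def by (rule dominated_by_macdonald_J(1)[OF partI])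
  have domK: "dominated_by (lamI I) (K I)" if "finite I" "I \<noteq> {}" for I
    using that
  proof (induction I rule: finite_psubset_induct)
    case (psubset I)
    then obtain m where m: "m \<in> I" by auto
    have eq: "K I = F I - (\<Sum>B | m \<in> B \<and> B \<subset> I. K B * F (I - B))"
      using is_cumulant_split[OF K psubset.hyps m] by simp
    have "dominated_by (lamI I) (K B * F (I - B))" if "m \<in> B" "B \<subset> I" for B
      unfolding split[OF psubset.hyps psubset_imp_subset[OF that(2)]]
      using that by (intro dominated_by_mult domF psubset.IH) auto
    then show ?case unfolding eq by (intro dominated_by_diff domF dominated_by_sum) auto
  qed
  \<comment> \<open>Leading coefficients multiply, so taking them turns the cumulant relation for J
    into the one for the normalising factors.\<close>
  have "is_cumulant (\<lambda>I. macdonald_c (lamI I)) (\<lambda>I. sym_coeff (K I) (lamI I))"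
    unfolding is_cumulant_def
  proof (intro conjI allI impI ballI)
    show "macdonald_c (lamI {}) = 1" by (simp add: lamI_def macdonald_c_def cells_def)
  next
    fix I :: "nat set" and m assume I: "finite I" "m \<in> I"
    have "macdonald_c (lamI I) = sym_coeff (F I) (lamI I)"
      unfolding F_def by (rule dominated_by_macdonald_J(2)[OF partI, symmetric])
    also have "\<dots> = (\<Sum>B | m \<in> B \<and> B \<subseteq> I. sym_coeff (K B * F (I - B)) (lamI I))"
      unfolding is_cumulant_rec[OF K I] sym_coeff_sum ..
    also have "\<dots> = (\<Sum>B | m \<in> B \<and> B \<subseteq> I. sym_coeff (K B) (lamI B) * macdonald_c (lamI (I - B)))"
    proof (rule sum.cong[OF refl])
      fix B assume "B \<in> {B. m \<in> B \<and> B \<subseteq> I}"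
      then have B: "B \<subseteq> I" "finite B" "B \<noteq> {}" using I(1) finite_subset by auto
      show "sym_coeff (K B * F (I - B)) (lamI I) = sym_coeff (K B) (lamI B) * macdonald_c (lamI (I - B))"
        unfolding split[OF I(1) B(1)] sym_coeff_mult_leading[OF domK[OF B(2,3)] domF]
        by (simp add: F_def dominated_by_macdonald_J(2)[OF partI])
    qed
    finally show "macdonald_c (lamI I) =
        (\<Sum>B | m \<in> B \<and> B \<subseteq> I. sym_coeff (K B) (lamI B) * macdonald_c (lamI (I - B)))" .
  qed
  note c_cumulant = this
  have small: "small_cumulants (\<lambda>I. macdonald_c (lamI I))"
    unfolding lamI_def by (rule small_cumulants_macdonald_c[OF part, of "{1..r}"]) (auto simp: lam'_def)
  have lead: "ord_ge (card I - 1) (sym_coeff (K I) (lamI I))" if "finite I" "I \<noteq> {}" for I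
  proof -
    have "sym_coeff (K I) (lamI I) = set_log (\<lambda>I. macdonald_c (lamI I)) I"
      using small that
      by (intro is_cumulant_unique[OF c_cumulant is_cumulant_set_log]) (auto simp: small_cumulants_def)
    then show ?thesis using small that by (simp add: small_cumulants_def)
  qed
  have ord: "sym_ord_ge (card I - 1) (K I)" if "finite I" "I \<noteq> {}" for I
    using that
  proof (induction I rule: finite_psubset_induct)
    case (psubset I)
    have evF: "mac_H svar qvar (F A) = sym_scale (mac_ev svar qvar (lamI A)) (F A)" for A
      unfolding F_def macdonald_J_def mac_H_scale mac_H_macdonald_P[OF partI] by (simp add: mult.commute)
    have "sym_ord_ge (card I) (mac_H svar qvar (K I) - sym_scale (mac_ev svar qvar (lamI I)) (K I))"
      unfolding lamI_def
      using psubset.IH domF domK[OF psubset.hyps psubset.prems] evF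
      by (intro mac_H_cumulant[OF K psubset.hyps psubset.prems]) (simp_all flip: lamI_def)
    moreover have "card I = Suc (card I - 1)"
      using psubset.hyps psubset.prems card_gt_0_iff[of I] by simp
    ultimately have "sym_ord_ge (Suc (card I - 1))
        (mac_H svar qvar (K I) - sym_scale (mac_ev svar qvar (lamI I)) (K I))" by simp
    then show ?case
      by (rule sym_ord_ge_if_eigen[OF partI domK[OF psubset.hyps psubset.prems] _
            lead[OF psubset.hyps psubset.prems]])
  qed
  have "{1..r} \<noteq> {}" using assms(1) by simp
  have "macdonald_cumulant r lam =
      (\<Sum>\<pi> | partition_on {1..r} \<pi>. of_int (partition_moebius {1..r} \<pi> {{1..r}}) * (\<Prod>B\<in>\<pi>. F B))"
    unfolding macdonald_cumulant_def
  proof (intro sum.cong refl arg_cong2[of _ _ _ _ "(*)"] prod.cong)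
    fix \<pi> B assume "\<pi> \<in> {\<pi>. partition_on {1..r} \<pi>}" "B \<in> \<pi>"
    then have "B \<subseteq> {1..r}" by (auto simp: partition_on_def)
    then have "(\<Sum>i\<in>B. lam i) = lamI B"
      unfolding lamI_def lam'_def by (intro sum.cong) auto
    then show "macdonald_J (\<Sum>i\<in>B. lam i) = F B" by (simp add: F_def)
  qed
  also have "\<dots> = K {1..r}"
    unfolding K_def using \<open>{1..r} \<noteq> {}\<close> F1 by (intro moebius_sum_eq_set_log) auto
  finally have "sym_ord_ge (r - 1) (macdonald_cumulant r lam)"
    using ord[of "{1..r}"] \<open>{1..r} \<noteq> {}\<close> by simp
  then show ?thesis by (simp add: big_O1_def sym_ord_ge_def ord_ge_def)
qed

end
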